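(* Let $A$, $C$, $E$ be finite-dimensional quantum systems with Hilbert spaces $\mathsf{A},\mathsf{C},\mathsf{E}$, let $|C|=\dim \mathsf{C}$, let $\lambda$ be a real number, and let $\alpha\in(1,2]$. Let $\{\mathcal{R}^h_{A\to C} : h\in\mathcal{H}\}$, with probability distribution $p$ on $\mathcal{H}$, be a $\lambda$-randomizing family of channels, and let $\mathcal{U}_{A\to C}$ be the perfectly randomizing channel $\mathcal{U}(\theta_A)=\operatorname{Tr}[\theta_A]\,\frac{\mathbb{1}_C}{|C|}$. Let $\rho_{AE}$ be a density operator on $\mathsf{A}\otimes\mathsf{E}$ and $\sigma_E$ a density operator on $\mathsf{E}$ such that $\rho_{AE}$ is supported on $\mathsf{A}\otimes\operatorname{supp}(\sigma_E)$. Then $$\mathbb{E}_{h\sim p}\left\|(\mathcal{R}^h-\mathcal{U})(\rho_{AE})\right\|_1\;\leqslant\; 2^{\frac{2}{\alpha}-1}\cdot 2^{\frac{\alpha-1}{\alpha}\left(\log|C|-H_\alpha(A|E)_{\rho|\sigma}+2\log\lambda\right)}.$$ Furthermore, if $\rho_{AE}$ is a CQ state (classical on $A$) and $\{\mathcal{R}^h : h\in\mathcal{H}\}$ is a $\lambda$-randomizing family of hash functions, the same bound holds.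
   Context: All Hilbert spaces are finite-dimensional, each with a fixed computational basis ($\{|a\rangle\}$ for system $A$). $\mathrm{L}(\mathsf{A})$ denotes the linear operators on $\mathsf{A}$; a density operator is a positive semidefinite operator of unit trace. Logarithms are base 2. A superoperator acting on $A$ is applied to operators on $\mathsf{A}\otimes\mathsf{E}$ as its tensor product with the identity superoperator on $E$; likewise an operator $\sigma_E$ is identified with $\mathbb{1}\otimes\sigma_E$. A channel is a completely positive trace-preserving map. Schatten norms: $\|X\|_p=\operatorname{Tr}[(X^\dagger X)^{p/2}]^{1/p}$ for $p\geqslant 1$. CQ operator: $X_{AE}=\sum_a |a\rangle\langle a|\otimes X_E(a)$ with $X_E(a)\in \mathrm{L}(\mathsf{E})$ for all $a$. Sandwiched Rényi entropy of order $\alpha>1$ relative to $\sigma_E$, when $\rho_{AE}$ is supported on $\mathsf{A}\otimes\operatorname{supp}(\sigma_E)$: $$H_\alpha(A|E)_{\rho|\sigma}=\frac{1}{1-\alpha}\log\operatorname{Tr}\left[\left(\sigma_E^{\frac{1-\alpha}{2\alpha}}\rho_{AE}\,\sigma_E^{\frac{1-\alpha}{2\alpha}}\right)^\alpha\right],$$ where negative powers of $\sigma_E$ are taken on its support. Randomizing family: a family of channels $\{\mathcal{R}^h_{A\to C}:h\in\mathcal{H}\}$ with distribution $p$ on $\mathcal{H}$ is $\lambda$-randomizing if for every (finite-dimensional) system $E$ and every $\rho_{AE}\in \mathrm{L}(\mathsf{A}\otimes\mathsf{E})$, $$\mathbb{E}_{h\sim p}\|(\mathcal{R}^h-\mathcal{U})(\rho_{AE})\|_2\leqslant\lambda\|\rho_{AE}\|_2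 .$$ Hash functions: a family of hash functions consists of functions $h:\mathcal{A}\to\mathcal{C}$, where the computational bases of $\mathsf{A}$ and $\mathsf{C}$ are indexed by the finite sets $\mathcal{A}$ and $\mathcal{C}$; to each $h$ is associated the channel $\mathcal{R}^h(\theta_A)=\sum_{a\in\mathcal{A}}\langle a|\theta_A|a\rangle\,|h(a)\rangle\langle h(a)|_C$. Such a family is $\lambda$-randomizing if the displayed 2-norm inequality holds for every CQ operator $\rho_{AE}$ (rather than for every operator). *)

theory Defs
  imports
    "HOL-Probability.Probability_Measure"
    "Jordan_Normal_Form.Schur_Decomposition"
    "Jordan_Normal_Form.Matrix_Kernel"
begin

text \<open>
  A system of dimension \<open>d\<close> is modelled by its computational basis \<open>{..<d}\<close>; operators are
  complex \<open>d \<times> d\<close> matrices. The basis vector \<open>|i\<rangle> \<otimes> |k\<rangle>\<close> of \<open>A \<otimes> E\<close> has index \<open>i * dE + k\<close>, so an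
  index \<open>x\<close> of \<open>A \<otimes> E\<close> splits into \<open>x div dE\<close> and \<open>x mod dE\<close>. Dimensions are terms rather than types
  because the definition of a randomizing family quantifies over all systems \<open>E\<close>.
\<close>

section \<open>Operators\<close>

definition mat_trace :: "complex mat \<Rightarrow> complex" where
  "mat_trace X = (\<Sum>i<dim_row X. X $$ (i, i))"

definition unitary_mat :: "nat \<Rightarrow> complex mat \<Rightarrow> bool" where
  "unitary_mat n U \<longleftrightarrow> U \<in> carrier_mat n n \<and> U * mat_adjoint U = 1\<^sub>m n"

text \<open>The order on \<open>complex\<close> makes \<open>0 \<le> z\<close> say that \<open>z\<close> is real and non-negative; in
  particular a positive semidefinite operator is Hermitian.\<close>

definition psd :: "nat \<Rightarrow> complex mat \<Rightarrow> bool" where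
  "psd n X \<longleftrightarrow> X \<in> carrier_mat n n \<and> (\<forall>v \<in> carrier_vec n. 0 \<le> (X *\<^sub>v v) \<bullet>c v)"

definition density_op :: "nat \<Rightarrow> complex mat \<Rightarrow> bool" where
  "density_op n X \<longleftrightarrow> psd n X \<and> mat_trace X = 1"

text \<open>Functional calculus for Hermitian \<open>X\<close>: the result does not depend on the chosen
  spectral decomposition.\<close>

definition mat_fun :: "(real \<Rightarrow> real) \<Rightarrow> complex mat \<Rightarrow> complex mat" where
  "mat_fun f X = (SOME Y. \<exists>U d. unitary_mat (dim_row X) U \<and>
     X = U * mat_diag (dim_row X) (\<lambda>i. complex_of_real (d i)) * mat_adjoint U \<and>
     Y = U * mat_diag (dim_row X) (\<lambda>i. complex_of_real (f (d i))) * mat_adjoint U)"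

text \<open>Since \<open>0 powr s = 0\<close> for every \<open>s\<close>, negative powers of a positive semidefinite operator
  are taken on its support.\<close>

definition mat_powr :: "complex mat \<Rightarrow> real \<Rightarrow> complex mat" where
  "mat_powr X s = mat_fun (\<lambda>x. x powr s) X"

definition schatten_norm :: "real \<Rightarrow> complex mat \<Rightarrow> real" where
  "schatten_norm p X = Re (mat_trace (mat_powr (mat_adjoint X * X) (p / 2))) powr (1 / p)"

definition tensor_mat :: "complex mat \<Rightarrow> complex mat \<Rightarrow> complex mat" where
  "tensor_mat X Y = Matrix.mat (dim_row X * dim_row Y) (dim_col X * dim_col Y)
     (\<lambda>(i, j). X $$ (i div dim_row Y, j div dim_col Y) * Y $$ (i mod dim_row Y, j mod dim_col Y))"

definition mat_sum :: "nat \<Rightarrow> ('i \<Rightarrow> complex mat) \<Rightarrow> 'i set \<Rightarrow> complex mat" where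
  "mat_sum n X I = Matrix.mat n n (\<lambda>(i, j). \<Sum>x\<in>I. X x $$ (i, j))"

text \<open>\<open>ket_proj n i\<close> is \<open>|i\<rangle>\<langle>i|\<close>.\<close>

definition ket_proj :: "nat \<Rightarrow> nat \<Rightarrow> complex mat" where
  "ket_proj n i = Matrix.mat n n (\<lambda>(k, l). if k = i \<and> l = i then 1 else 0)"

definition cq :: "nat \<Rightarrow> nat \<Rightarrow> complex mat \<Rightarrow> bool" where
  "cq dA dE X \<longleftrightarrow> (\<exists>Y. (\<forall>x<dA. Y x \<in> carrier_mat dE dE) \<and>
     X = mat_sum (dA * dE) (\<lambda>x. tensor_mat (ket_proj dA x) (Y x)) {..<dA})"

definition supp :: "nat \<Rightarrow> complex mat \<Rightarrow> complex vec set" where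
  "supp n X = {v \<in> carrier_vec n. \<forall>w \<in> mat_kernel X. v \<bullet>c w = 0}"

text \<open>The subspace \<open>A \<otimes> S\<close> for a subspace \<open>S\<close> of \<open>E\<close>: writing \<open>v = (\<Sum>i<dA. |i\<rangle> \<otimes> v\<^sub>i)\<close>, all the
  components \<open>v\<^sub>i\<close> must lie in \<open>S\<close>.\<close>

definition tensor_space :: "nat \<Rightarrow> nat \<Rightarrow> complex vec set \<Rightarrow> complex vec set" where
  "tensor_space dA dE S = {v \<in> carrier_vec (dA * dE).
     \<forall>i<dA. Matrix.vec dE (\<lambda>k. v $ (i * dE + k)) \<in> S}"

section \<open>Sandwiched Renyi entropy\<close>

definition sandwiched_entropy ::
  "nat \<Rightarrow> real \<Rightarrow> complex mat \<Rightarrow> complex mat \<Rightarrow> real" where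
  "sandwiched_entropy dA \<alpha> \<rho> \<sigma> =
     (let s = tensor_mat (1\<^sub>m dA) (mat_powr \<sigma> ((1 - \<alpha>) / (2 * \<alpha>)))
      in 1 / (1 - \<alpha>) * log 2 (Re (mat_trace (mat_powr (s * \<rho> * s) \<alpha>))))"

section \<open>Superoperators and channels\<close>

definition superop :: "nat \<Rightarrow> nat \<Rightarrow> (complex mat \<Rightarrow> complex mat) \<Rightarrow> bool" where
  "superop dA dC \<Phi> \<longleftrightarrow>
     (\<forall>X \<in> carrier_mat dA dA. \<Phi> X \<in> carrier_mat dC dC) \<and>
     (\<forall>X \<in> carrier_mat dA dA. \<forall>Y \<in> carrier_mat dA dA. \<Phi> (X + Y) = \<Phi> X + \<Phi> Y) \<and>
     (\<forall>z. \<forall>X \<in> carrier_mat dA dA. \<Phi> (z \<cdot>\<^sub>m X) = z \<cdot>\<^sub>m \<Phi> X)"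

text \<open>\<open>\<Phi> \<otimes> id\<^sub>E\<close>: writing \<open>X = (\<Sum>k l. X\<^sub>k\<^sub>l \<otimes> |k\<rangle>\<langle>l|)\<close> with \<open>X\<^sub>k\<^sub>l = \<langle>k|X|l\<rangle>\<close> an operator on \<open>A\<close>, the
  result is \<open>(\<Sum>k l. \<Phi>(X\<^sub>k\<^sub>l) \<otimes> |k\<rangle>\<langle>l|)\<close>.\<close>

definition E_block :: "nat \<Rightarrow> nat \<Rightarrow> complex mat \<Rightarrow> nat \<Rightarrow> nat \<Rightarrow> complex mat" where
  "E_block dA dE X k l = Matrix.mat dA dA (\<lambda>(i, j). X $$ (i * dE + k, j * dE + l))"

definition superop_ext ::
  "nat \<Rightarrow> nat \<Rightarrow> nat \<Rightarrow> (complex mat \<Rightarrow> complex mat) \<Rightarrow> complex mat \<Rightarrow> complex mat" where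
  "superop_ext dA dC dE \<Phi> X = Matrix.mat (dC * dE) (dC * dE)
     (\<lambda>(i, j). \<Phi> (E_block dA dE X (i mod dE) (j mod dE)) $$ (i div dE, j div dE))"

definition completely_positive :: "nat \<Rightarrow> nat \<Rightarrow> (complex mat \<Rightarrow> complex mat) \<Rightarrow> bool" where
  "completely_positive dA dC \<Phi> \<longleftrightarrow>
     (\<forall>dE X. psd (dA * dE) X \<longrightarrow> psd (dC * dE) (superop_ext dA dC dE \<Phi> X))"

definition channel :: "nat \<Rightarrow> nat \<Rightarrow> (complex mat \<Rightarrow> complex mat) \<Rightarrow> bool" where
  "channel dA dC \<Phi> \<longleftrightarrow> superop dA dC \<Phi> \<and> completely_positive dA dC \<Phi> \<and>
     (\<forall>X \<in> carrier_mat dA dA. mat_trace (\<Phi> X) = mat_trace X)"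

definition perfectly_randomizing :: "nat \<Rightarrow> complex mat \<Rightarrow> complex mat" where
  "perfectly_randomizing dC \<theta> = (mat_trace \<theta> / of_nat dC) \<cdot>\<^sub>m 1\<^sub>m dC"

section \<open>Randomizing families\<close>

text \<open>The index set \<open>\<H>\<close> with its distribution is an arbitrary probability space \<open>M\<close>. The
  measurability of the matrix entries gives the expectations below a meaning (together with
  boundedness, it makes the integrands integrable); it is automatic for a discrete \<open>M\<close>.\<close>

definition channel_family ::
  "nat \<Rightarrow> nat \<Rightarrow> 'h measure \<Rightarrow> ('h \<Rightarrow> complex mat \<Rightarrow> complex mat) \<Rightarrow> bool" where
  "channel_family dA dC M R \<longleftrightarrow> prob_space M \<and> (\<forall>h \<in> space M. channel dA dC (R h)) \<and>
     (\<forall>X \<in> carrier_mat dA dA. \<forall>i<dC. \<forall>j<dC. (\<lambda>h. R h X $$ (i, j)) \<in> borel_measurable M)"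

definition hash_family :: "nat \<Rightarrow> nat \<Rightarrow> 'h measure \<Rightarrow> ('h \<Rightarrow> nat \<Rightarrow> nat) \<Rightarrow> bool" where
  "hash_family dA dC M f \<longleftrightarrow> prob_space M \<and> (\<forall>h \<in> space M. f h ` {..<dA} \<subseteq> {..<dC}) \<and>
     (\<forall>x<dA. (\<lambda>h. f h x) \<in> measurable M (count_space UNIV))"

definition hash_channel :: "nat \<Rightarrow> nat \<Rightarrow> (nat \<Rightarrow> nat) \<Rightarrow> complex mat \<Rightarrow> complex mat" where
  "hash_channel dA dC f \<theta> = mat_sum dC (\<lambda>x. \<theta> $$ (x, x) \<cdot>\<^sub>m ket_proj dC (f x)) {..<dA}"

definition deviation ::
  "nat \<Rightarrow> nat \<Rightarrow> nat \<Rightarrow> (complex mat \<Rightarrow> complex mat) \<Rightarrow> complex mat \<Rightarrow> complex mat" where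
  "deviation dA dC dE \<Phi> X = superop_ext dA dC dE (\<lambda>\<theta>. \<Phi> \<theta> - perfectly_randomizing dC \<theta>) X"

definition randomizing_on ::
  "(nat \<Rightarrow> complex mat set) \<Rightarrow> nat \<Rightarrow> nat \<Rightarrow> 'h measure
     \<Rightarrow> ('h \<Rightarrow> complex mat \<Rightarrow> complex mat) \<Rightarrow> real \<Rightarrow> bool" where
  "randomizing_on \<X> dA dC M R lam \<longleftrightarrow> (\<forall>dE. \<forall>X \<in> \<X> dE.
     (\<integral>h. schatten_norm 2 (deviation dA dC dE (R h) X) \<partial>M) \<le> lam * schatten_norm 2 X)"

definition randomizing ::
  "nat \<Rightarrow> nat \<Rightarrow> 'h measure \<Rightarrow> ('h \<Rightarrow> complex mat \<Rightarrow> complex mat) \<Rightarrow> real \<Rightarrow> bool" where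
  "randomizing dA dC M R lam \<longleftrightarrow>
     randomizing_on (\<lambda>dE. carrier_mat (dA * dE) (dA * dE)) dA dC M R lam"

definition hash_randomizing ::
  "nat \<Rightarrow> nat \<Rightarrow> 'h measure \<Rightarrow> ('h \<Rightarrow> nat \<Rightarrow> nat) \<Rightarrow> real \<Rightarrow> bool" where
  "hash_randomizing dA dC M f lam \<longleftrightarrow>
     randomizing_on (\<lambda>dE. {X. cq dA dE X}) dA dC M (\<lambda>h. hash_channel dA dC (f h)) lam"

section \<open>Extended logarithm and exponential\<close>

text \<open>A family can be \<open>0\<close>-randomizing, and then \<open>log \<lambda> = -\<infinity>\<close> and \<open>2 powr -\<infinity> = 0\<close> are meant,
  whereas \<open>log 2 0 = 0\<close> in the library. (No family of channels with \<open>dA > 0\<close> is randomizing for a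
  negative \<open>\<lambda>\<close>.)\<close>

definition elog2 :: "real \<Rightarrow> ereal" where
  "elog2 x = (if x > 0 then ereal (log 2 x) else -\<infinity>)"

fun eexp2 :: "ereal \<Rightarrow> ereal" where
  "eexp2 (ereal x) = ereal (2 powr x)"
| "eexp2 PInfty = \<infinity>"
| "eexp2 MInfty = 0"

end

theory Submission
  imports
    Defs
    "HOL-Complex_Analysis.Complex_Analysis"
    "HOL-Real_Asymp.Real_Asymp"
    "Jordan_Normal_Form.Spectral_Radius"
begin

text \<open>
  The bound interpolates between the trivial estimate \<open>\<parallel>(\<R> - \<U>)(X)\<parallel>\<^sub>1 \<le> 2 \<parallel>X\<parallel>\<^sub>1\<close> and the case \<open>\<alpha> = 2\<close>,
  where \<open>\<parallel>\<sigma>\<^bsup>1/4\<^esup> Y \<sigma>\<^bsup>1/4\<^esup>\<parallel>\<^sub>1 \<le> |C|\<^bsup>1/2\<^esup> \<parallel>Y\<parallel>\<^sub>2\<close> reduces the claim to the randomizing property. Put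
  \<open>t = 2 (\<alpha> - 1) / \<alpha>\<close>, \<open>X = \<sigma>\<^bsup>-t/4\<^esup> \<rho> \<sigma>\<^bsup>-t/4\<^esup>\<close> and \<open>X(z) = X\<^bsup>\<alpha>(1 - z/2)\<^esup>\<close>, so that \<open>X(t) = X\<close>. If \<open>W\<^sub>h\<close> is a
  contraction depending measurably on \<open>h\<close>, then \<open>G(z) = \<E>\<^sub>h Tr[W\<^sub>h\<^sup>* \<sigma>\<^bsup>z/4\<^esup> (\<R>\<^sub>h - \<U>)(X(z)) \<sigma>\<^bsup>z/4\<^esup>]\<close> is an
  entire function, bounded by \<open>2 Tr X\<^sup>\<alpha>\<close> on \<open>Re z = 0\<close> and by \<open>|C|\<^bsup>1/2\<^esup> \<lambda> (Tr X\<^sup>\<alpha>)\<^bsup>1/2\<^esup>\<close> on \<open>Re z = 1\<close>, and the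
  three lines theorem bounds \<open>G(t)\<close>. By duality \<open>W\<^sub>h\<close> can be chosen, from a countable dense set of
  contractions, such that \<open>G(t)\<close> is arbitrarily close to \<open>\<E>\<^sub>h \<parallel>(\<R>\<^sub>h - \<U>)(\<rho>)\<parallel>\<^sub>1\<close>. For a CQ state all the
  operators \<open>X(z)\<close> are CQ, so the randomizing property is only needed for those.
\<close>

section \<open>Spectral theorem\<close>

text \<open>The exponents are forced by the two ends of the strip. The eigenvalues of
  \<open>X(z)\<close> have modulus \<open>x^\<alpha>\<close> on \<open>Re z = 0\<close> and
  \<open>x^(\<alpha>/2)\<close> on \<open>Re z = 1\<close>, so trace norm and 2-norm are both
  governed by \<open>tau = Tr X^\<alpha>\<close>. The point \<open>t\<close> solves
  \<open>\<alpha> * (1 - t / 2) = 1\<close> and lies in \<open>(0, 1]\<close> exactly for \<alpha>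
  in \<open>(1, 2]\<close>. As \<open>1 - t = 2 / \<alpha> - 1\<close>, the trivial factor 2 becomes
  the prefactor of the theorem, and \<open>tau\<close> collects the exponent
  \<open>1 - t / 2 = 1 / \<alpha>\<close>, which the definition of the entropy turns into
  \<open>-(\<alpha> - 1) / \<alpha> * H\<close>. Two points shape the formal proof. The
  \<open>X(z)\<close> need not be Hermitian, hence spectral decompositions with complex eigenvalues.
  And analyticity of an expectation is delicate in general: in the eigenbases of \<sigma> and
  \<open>X\<close> it is a finite sum of exponentials in \<open>z\<close>, whose coefficients are
  integrated over \<open>h\<close> beforehand. The support hypothesis makes the passage from \<rho>
  to \<open>X\<close> invertible.\<close>

lemma index_mult_sum:
  assumes "A \<in> carrier_mat n m" "B \<in> carrier_mat m p" "i < n" "j < p"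
  shows "(A * B) $$ (i, j) = (\<Sum>k<m. A $$ (i, k) * B $$ (k, j))"
  using assms by (auto simp: scalar_prod_def lessThan_atLeast0 intro!: sum.cong)

lemma index_mult_mat_vec_sum:
  assumes "A \<in> carrier_mat n m" "v \<in> carrier_vec m" "i < n"
  shows "(A *\<^sub>v v) $ i = (\<Sum>k<m. A $$ (i, k) * v $ k)"
  using assms by (auto simp: scalar_prod_def lessThan_atLeast0 intro!: sum.cong)

lemma mat_adjoint_dim [simp]:
  "dim_row (mat_adjoint A) = dim_col A" "dim_col (mat_adjoint A) = dim_row A"
  by (auto simp: mat_adjoint_def mat_of_rows_def)

lemma mat_adjoint_carrier [simp]:
  "A \<in> carrier_mat n m \<Longrightarrow> mat_adjoint A \<in> carrier_mat m n"
  by (rule carrier_matI) auto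

lemma mat_adjoint_index:
  fixes A :: "complex mat"
  assumes "A \<in> carrier_mat n m" "i < m" "j < n"
  shows "mat_adjoint A $$ (i, j) = cnj (A $$ (j, i))"
  using assms by (auto simp: mat_adjoint_def mat_of_rows_def)

lemma mat_adjoint_adjoint [simp]: "mat_adjoint (mat_adjoint A) = (A :: complex mat)"
proof -
  have A: "A \<in> carrier_mat (dim_row A) (dim_col A)" by auto
  show ?thesis
    by (rule eq_matI) (auto simp: mat_adjoint_index[OF A] mat_adjoint_index[OF mat_adjoint_carrier[OF A]])
qed

lemma mat_adjoint_mult:
  fixes A :: "complex mat"
  assumes A: "A \<in> carrier_mat n m" and B: "B \<in> carrier_mat m p"
  shows "mat_adjoint (A * B) = mat_adjoint B * mat_adjoint A"
proof (rule eq_matI)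
  fix i j assume "i < dim_row (mat_adjoint B * mat_adjoint A)" "j < dim_col (mat_adjoint B * mat_adjoint A)"
  then have ij: "i < p" "j < n" using A B by auto
  have "A * B \<in> carrier_mat n p" using A B by auto
  then show "mat_adjoint (A * B) $$ (i, j) = (mat_adjoint B * mat_adjoint A) $$ (i, j)"
    using ij
    by (simp add: mat_adjoint_index[of _ n p] index_mult_sum[OF A B]
        index_mult_sum[OF mat_adjoint_carrier[OF B] mat_adjoint_carrier[OF A]]
        mat_adjoint_index[OF A] mat_adjoint_index[OF B] mult.commute)
qed (use A B in auto)

lemma mat_diag_dims [simp]: "dim_row (mat_diag n d) = n" "dim_col (mat_diag n d) = n"
  by (auto simp: mat_diag_def)

lemma mat_diag_cong: "(\<And>i. i < n \<Longrightarrow> c i = d i) \<Longrightarrow> mat_diag n c = mat_diag n d"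
  by (rule eq_matI) (auto simp: mat_diag_def)

lemma mat_adjoint_diag: "mat_adjoint (mat_diag n d) = mat_diag n (\<lambda>i. cnj (d i))"
  by (rule eq_matI) (simp add: mat_adjoint_index[OF mat_diag_dim], auto simp: mat_diag_def)

lemma unitary_matD:
  assumes "unitary_mat n U"
  shows "U \<in> carrier_mat n n" "U * mat_adjoint U = 1\<^sub>m n" "mat_adjoint U * U = 1\<^sub>m n"
  using assms mat_mult_left_right_inverse[of U n "mat_adjoint U"]
  by (auto simp: unitary_mat_def)

lemma unitary_cancel:
  assumes U: "unitary_mat n U" and A: "A \<in> carrier_mat n n"
  shows "mat_adjoint U * (U * A) = A" "U * (mat_adjoint U * A) = A"
proof -
  note U' = unitary_matD[OF U]
  show "mat_adjoint U * (U * A) = A"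
    by (subst assoc_mult_mat[symmetric, of _ n n _ n _ n]) (use U' A in auto)
  show "U * (mat_adjoint U * A) = A"
    by (subst assoc_mult_mat[symmetric, of _ n n _ n _ n]) (use U' A in auto)
qed

lemma unitary_mat_mult:
  assumes U: "unitary_mat n U" and V: "unitary_mat n V"
  shows "unitary_mat n (U * V)"
proof -
  note [simp] = unitary_matD[OF U] unitary_matD(1)[OF V]
  have "U * V * mat_adjoint (U * V) = U * (V * (mat_adjoint V * mat_adjoint U))"
    by (subst mat_adjoint_mult[of U n n V n])
       (simp_all add: assoc_mult_mat[of _ n n _ n _ n] mult_carrier_mat[of _ n n _ n])
  also have "V * (mat_adjoint V * mat_adjoint U) = mat_adjoint U"
    by (rule unitary_cancel[OF V]) simp
  finally show ?thesis by (simp add: unitary_mat_def mult_carrier_mat[of _ n n _ n])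
qed

text \<open>The eigenvalues \<open>c\<close> are complex because imaginary powers of positive
  operators occur on the boundary of the strip. For a fixed unitary \<open>U\<close> the map from
  \<open>c\<close> to the matrix respects products and adjoints, so operator identities reduce to
  pointwise ones.\<close>

definition spectral_mat :: "nat \<Rightarrow> complex mat \<Rightarrow> (nat \<Rightarrow> complex) \<Rightarrow> complex mat" where
  "spectral_mat n U c = U * mat_diag n c * mat_adjoint U"

lemma spectral_mat_carrier [simp]:
  "unitary_mat n U \<Longrightarrow> spectral_mat n U c \<in> carrier_mat n n"
  by (auto simp: spectral_mat_def unitary_mat_def)

lemma spectral_mat_index:
  assumes "unitary_mat n U" "i < n" "j < n"
  shows "spectral_mat n U c $$ (i, j) = (\<Sum>k<n. c k * (U $$ (i, k) * cnj (U $$ (j, k))))"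
proof -
  note U = unitary_matD(1)[OF assms(1)]
  have "U * mat_diag n c \<in> carrier_mat n n" using U by auto
  then have "spectral_mat n U c $$ (i, j) = (\<Sum>k<n. (U * mat_diag n c) $$ (i, k) * mat_adjoint U $$ (k, j))"
    unfolding spectral_mat_def using U assms by (intro index_mult_sum) auto
  also have "\<dots> = (\<Sum>k<n. c k * (U $$ (i, k) * cnj (U $$ (j, k))))"
    using U assms by (intro sum.cong) (auto simp: mat_diag_mult_right[OF U] mat_adjoint_index[OF U])
  finally show ?thesis .
qed

lemma spectral_mat_mult:
  assumes U: "unitary_mat n U"
  shows "spectral_mat n U c * spectral_mat n U d = spectral_mat n U (\<lambda>i. c i * d i)"
proof -
  note [simp] = unitary_matD[OF U]
  have "spectral_mat n U c * spectral_mat n U d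
     = U * (mat_diag n c * (mat_adjoint U * (U * (mat_diag n d * mat_adjoint U))))"
    by (simp add: spectral_mat_def assoc_mult_mat[of _ n n _ n _ n] mult_carrier_mat[of _ n n _ n] del: mat_diag_diag)
  also have "mat_adjoint U * (U * (mat_diag n d * mat_adjoint U)) = mat_diag n d * mat_adjoint U"
    by (rule unitary_cancel[OF U]) (simp add: mult_carrier_mat[of _ n n _ n])
  finally show ?thesis
    by (simp add: spectral_mat_def assoc_mult_mat[of _ n n _ n _ n] mult_carrier_mat[of _ n n _ n] flip: mat_diag_diag)
qed

lemma spectral_mat_adjoint:
  assumes U: "unitary_mat n U"
  shows "mat_adjoint (spectral_mat n U c) = spectral_mat n U (\<lambda>i. cnj (c i))"
proof -
  note [simp] = unitary_matD[OF U]
  show ?thesis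
    unfolding spectral_mat_def
    by (simp add: mat_adjoint_mult[of _ n n _ n] mat_adjoint_diag assoc_mult_mat[of _ n n _ n _ n]
        mult_carrier_mat[of _ n n _ n])
qed

lemma spectral_mat_cong: "(\<And>i. i < n \<Longrightarrow> c i = d i) \<Longrightarrow> spectral_mat n U c = spectral_mat n U d"
  unfolding spectral_mat_def using mat_diag_cong[of n c d] by simp

lemma spectral_mat_one: "unitary_mat n U \<Longrightarrow> spectral_mat n U (\<lambda>_. 1) = 1\<^sub>m n"
  by (simp add: spectral_mat_def unitary_matD right_mult_one_mat[of _ n n])

lemma spectral_mat_conj:
  assumes U: "unitary_mat n U"
  shows "mat_adjoint U * spectral_mat n U c * U = mat_diag n c"
proof -
  note [simp] = unitary_matD(1)[OF U]
  have "mat_adjoint U * spectral_mat n U c * U = mat_adjoint U * (U * (mat_diag n c * (mat_adjoint U * U)))"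
    by (simp add: spectral_mat_def assoc_mult_mat[of _ n n _ n _ n] mult_carrier_mat[of _ n n _ n])
  also have "\<dots> = mat_diag n c"
    unfolding unitary_matD(3)[OF U] right_mult_one_mat[OF mat_diag_dim]
    by (rule unitary_cancel[OF U]) simp
  finally show ?thesis .
qed

lemma mat_trace_comm:
  assumes A: "A \<in> carrier_mat n m" and B: "B \<in> carrier_mat m n"
  shows "mat_trace (A * B) = mat_trace (B * A)"
proof -
  have "mat_trace (A * B) = (\<Sum>i<n. \<Sum>k<m. A $$ (i, k) * B $$ (k, i))"
    using A B by (auto simp: mat_trace_def index_mult_sum[OF A B] simp del: index_mult_mat(1) intro!: sum.cong)
  also have "\<dots> = (\<Sum>k<m. \<Sum>i<n. B $$ (k, i) * A $$ (i, k))"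
    by (subst sum.swap) (simp add: mult.commute)
  also have "\<dots> = mat_trace (B * A)"
    using A B by (auto simp: mat_trace_def index_mult_sum[OF B A] simp del: index_mult_mat(1) intro!: sum.cong)
  finally show ?thesis .
qed

lemma mat_trace_diag: "mat_trace (mat_diag n c) = (\<Sum>i<n. c i)"
  by (auto simp: mat_trace_def mat_diag_def)

lemma mat_trace_spectral:
  assumes U: "unitary_mat n U"
  shows "mat_trace (spectral_mat n U c) = (\<Sum>i<n. c i)"
proof -
  note U' = unitary_matD[OF U]
  have "mat_trace (spectral_mat n U c) = mat_trace (mat_adjoint U * (U * mat_diag n c))"
    unfolding spectral_mat_def by (rule mat_trace_comm[of _ n n]) (use U' in auto)
  also have "mat_adjoint U * (U * mat_diag n c) = mat_diag n c"
    by (rule unitary_cancel[OF U]) auto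
  finally show ?thesis by (simp add: mat_trace_diag)
qed

section \<open>Quadratic forms and positivity\<close>

definition qform :: "nat \<Rightarrow> complex mat \<Rightarrow> (nat \<Rightarrow> complex) \<Rightarrow> complex" where
  "qform n X v = (\<Sum>i<n. \<Sum>j<n. cnj (v i) * X $$ (i, j) * v j)"

lemma psd_iff_qform:
  "psd n X \<longleftrightarrow> X \<in> carrier_mat n n \<and> (\<forall>v. 0 \<le> qform n X v)"
proof -
  have *: "(X *\<^sub>v w) \<bullet>c w = qform n X (($) w)" if "X \<in> carrier_mat n n" "w \<in> carrier_vec n" for w
    using that
    by (auto simp: qform_def scalar_prod_def index_mult_mat_vec_sum[OF that] sum_distrib_left
        sum_distrib_right lessThan_atLeast0 mult_ac intro!: sum.cong)
  have "qform n X v = (X *\<^sub>v vec n v) \<bullet>c vec n v" if "X \<in> carrier_mat n n" for v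
    by (subst *[OF that]) (auto simp: qform_def)
  then have "0 \<le> qform n X v" if "X \<in> carrier_mat n n" "\<forall>v \<in> carrier_vec n. 0 \<le> (X *\<^sub>v v) \<bullet>c v" for v
    using that by (metis vec_carrier)
  then show ?thesis using * unfolding psd_def by metis
qed

lemma qform_support:
  assumes "S \<subseteq> {..<n}" "\<And>k. k \<notin> S \<Longrightarrow> v k = 0"
  shows "qform n X v = (\<Sum>i\<in>S. \<Sum>j\<in>S. cnj (v i) * X $$ (i, j) * v j)"
proof -
  have "qform n X v = (\<Sum>i\<in>S. \<Sum>j<n. cnj (v i) * X $$ (i, j) * v j)"
    unfolding qform_def using assms by (intro sum.mono_neutral_right) auto
  also have "\<dots> = (\<Sum>i\<in>S. \<Sum>j\<in>S. cnj (v i) * X $$ (i, j) * v j)"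
    using assms by (intro sum.cong sum.mono_neutral_right) auto
  finally show ?thesis .
qed

text \<open>Polarization: the form is real at every \<open>e_i + b e_j\<close>. Once the diagonal is
  known to be real, \<open>b = 1\<close> compares the imaginary parts of the two off-diagonal
  entries and \<open>b = \<i>\<close> their real parts.\<close>

lemma psd_hermitian:
  assumes "psd n X" shows "mat_adjoint X = X"
proof -
  have X: "X \<in> carrier_mat n n" and q: "\<And>v. Im (qform n X v) = 0"
    using assms by (auto simp: psd_iff_qform less_eq_complex_def)
  have d: "Im (X $$ (k, k)) = 0" if "k < n" for k
    using q[of "\<lambda>l. if l = k then 1 else 0"] that by (subst (asm) qform_support[of "{k}"]) auto
  have h: "X $$ (i, j) = cnj (X $$ (j, i))" if ij: "i < n" "j < n" for i j
  proof (cases "i = j")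
    case True
    with d ij show ?thesis by (simp add: complex_eq_iff)
  next
    case False
    have *: "Im (X $$ (i, i) + cnj b * X $$ (j, i) + X $$ (i, j) * b + cnj b * X $$ (j, j) * b) = 0" for b
    proof -
      have "qform n X (\<lambda>k. if k = i then 1 else if k = j then b else 0)
         = X $$ (i, i) + cnj b * X $$ (j, i) + X $$ (i, j) * b + cnj b * X $$ (j, j) * b"
        using False ij by (subst qform_support[of "{i,j}"]) auto
      from this[symmetric] show ?thesis by (simp only: q)
    qed
    have "Im (X $$ (j, i)) + Im (X $$ (i, j)) = 0"
      using *[of 1] d ij by simp
    moreover have "Re (X $$ (i, j)) - Re (X $$ (j, i)) = 0"
      using *[of \<i>] d ij by simp
    ultimately show ?thesis by (simp add: complex_eq_iff)
  qed
  show ?thesis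
  proof (rule eq_matI)
    fix i j assume "i < dim_row X" "j < dim_col X"
    with X have ij: "i < n" "j < n" by auto
    show "mat_adjoint X $$ (i, j) = X $$ (i, j)"
      unfolding mat_adjoint_index[OF X ij] by (rule h[OF ij, symmetric])
  qed (use X in auto)
qed

text \<open>Gram-Schmidt applied to a basis that starts with \<open>v\<close> leaves
  \<open>v\<close> in front. Its output is orthogonal but not normalized, so the columns are divided
  by their norms; \<open>c\<close> is the inverse norm of \<open>v\<close>.\<close>

lemma unitary_first_column:
  fixes v :: "complex Matrix.vec"
  assumes v: "v \<in> carrier_vec n" "v \<noteq> 0\<^sub>v n"
  obtains W c where "unitary_mat n W" "\<And>i. i < n \<Longrightarrow> W $$ (i, 0) = c * v $ i"
proof -
  interpret cof_vec_space n "TYPE(complex)" .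
  define b where "b = basis_completion v"
  note bc = basis_completion[OF v, folded b_def]
  define ws where "ws = gram_schmidt n b"
  have n: "n > 0" using v by (cases n) (auto intro!: eq_vecI)
  from bc n obtain vs where b: "b = v # vs" by (cases b) auto
  from gram_schmidt_result[OF bc(2,4,5) refl, folded ws_def] bc(6)
  have ws: "set ws \<subseteq> carrier_vec n" "corthogonal ws" "length ws = n" by auto
  from gram_schmidt_hd[OF v(1), of vs, folded b] have hd: "hd ws = v" by (simp add: ws_def)
  define N where "N j = (\<Sum>k<n. (cmod (ws ! j $ k))\<^sup>2)" for j
  have wsc: "ws ! j \<in> carrier_vec n" if "j < n" for j using ws that by auto
  have ip: "ws ! i \<bullet>c ws ! j = (\<Sum>k<n. ws ! i $ k * cnj (ws ! j $ k))" if "i < n" "j < n" for i j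
    using wsc[OF that(1)] wsc[OF that(2)]
    by (auto simp: scalar_prod_def lessThan_atLeast0 intro!: sum.cong)
  have ip0: "(\<Sum>k<n. ws ! i $ k * cnj (ws ! j $ k)) = 0 \<longleftrightarrow> i \<noteq> j" if "i < n" "j < n" for i j
    using corthogonalD[OF ws(2), of i j] ws(3) that ip[OF that] by auto
  have ipN: "(\<Sum>k<n. ws ! j $ k * cnj (ws ! j $ k)) = of_real (N j)" for j
    by (simp add: N_def complex_norm_square del: of_real_power)
  have Npos: "N j > 0" if "j < n" for j
  proof -
    have "N j \<noteq> 0" using ip0[OF that that] ipN[of j] by auto
    moreover have "N j \<ge> 0" by (auto simp: N_def intro!: sum_nonneg)
    ultimately show ?thesis by simp
  qed
  define W where "W = Matrix.mat n n (\<lambda>(i, j). ws ! j $ i / of_real (sqrt (N j)))"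
  have W: "W \<in> carrier_mat n n" by (simp add: W_def)
  have "mat_adjoint W * W = 1\<^sub>m n"
  proof (rule eq_matI)
    fix i j assume "i < dim_row (1\<^sub>m n)" "j < dim_col (1\<^sub>m n)"
    then have ij: "i < n" "j < n" by auto
    have "(mat_adjoint W * W) $$ (i, j) = (\<Sum>k<n. cnj (W $$ (k, i)) * W $$ (k, j))"
      using ij by (subst index_mult_sum[OF mat_adjoint_carrier[OF W] W])
        (auto simp: mat_adjoint_index[OF W])
    also have "\<dots> = (\<Sum>k<n. ws ! j $ k * cnj (ws ! i $ k)) / (of_real (sqrt (N i)) * of_real (sqrt (N j)))"
      using ij by (simp add: W_def sum_divide_distrib mult_ac)
    also have "\<dots> = 1\<^sub>m n $$ (i, j)"
    proof (cases "i = j")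
      case True
      then show ?thesis using Npos[OF ij(1)] ij
        by (simp add: ipN flip: of_real_mult)
    next
      case False
      then have "(\<Sum>k<n. ws ! j $ k * cnj (ws ! i $ k)) = 0"
        using ip0[of j i] ij by simp
      then show ?thesis using False ij by simp
    qed
    finally show "(mat_adjoint W * W) $$ (i, j) = 1\<^sub>m n $$ (i, j)" .
  qed (use W in auto)
  then have "unitary_mat n W"
    using mat_mult_left_right_inverse[of "mat_adjoint W" n W] W by (auto simp: unitary_mat_def)
  moreover have "W $$ (i, 0) = inverse (of_real (sqrt (N 0))) * v $ i" if "i < n" for i
  proof -
    have "ws ! 0 = v" using hd ws(3) n by (cases ws) auto
    then show ?thesis using that n by (simp add: W_def field_simps)
  qed
  ultimately show ?thesis using that by blast
qed

text \<open>Deflation: in an orthonormal basis that starts with an eigenvector, the first column of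
  the matrix is \<open>e\<close> times the first basis vector. Hermitian symmetry then makes
  \<open>e\<close> real and clears the first row, which leaves a Hermitian block \<open>B\<close> of
  smaller size for the induction.\<close>

theorem hermitian_spectral:
  fixes X :: "complex mat"
  assumes "X \<in> carrier_mat n n" "mat_adjoint X = X"
  shows "\<exists>U d. unitary_mat n U \<and> X = spectral_mat n U (\<lambda>i. complex_of_real (d i))"
  using assms
proof (induction n arbitrary: X)
  case 0
  then have "X = spectral_mat 0 (1\<^sub>m 0) (\<lambda>i. complex_of_real 0)"
    by (intro eq_matI) (auto simp: spectral_mat_def)
  moreover have "unitary_mat 0 (1\<^sub>m 0)"
    unfolding unitary_mat_def by (auto intro!: eq_matI)
  ultimately show ?case by (intro exI[of _ "1\<^sub>m 0"] exI[of _ "\<lambda>_. 0"]) auto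
next
  case (Suc n)
  let ?n = "Suc n"
  note X = Suc.prems
  obtain e v where v: "v \<in> carrier_vec ?n" "v \<noteq> 0\<^sub>v ?n" "X *\<^sub>v v = e \<cdot>\<^sub>v v"
    using spectrum_non_empty[OF X(1)] X(1)
    by (auto simp: spectrum_def eigenvalue_def eigenvector_def)
  obtain W c where W: "unitary_mat ?n W" and col: "\<And>i. i < ?n \<Longrightarrow> W $$ (i, 0) = c * v $ i"
    using unitary_first_column[OF v(1,2)] by blast
  note W' = unitary_matD[OF W]
  define A where "A = mat_adjoint W * (X * W)"
  have XW: "X * W \<in> carrier_mat ?n ?n" using X W' by auto
  have A: "A \<in> carrier_mat ?n ?n" using XW W' by (simp add: A_def mult_carrier_mat[of _ ?n ?n _ ?n])
  have XWA: "X = W * (A * mat_adjoint W)"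
  proof -
    have "W * (A * mat_adjoint W) = W * (mat_adjoint W * (X * (W * mat_adjoint W)))"
      using X W'(1) XW by (simp add: A_def assoc_mult_mat[of _ ?n ?n _ ?n _ ?n] mult_carrier_mat[of _ ?n ?n _ ?n])
    also have "\<dots> = X" using X(1) unitary_cancel(2)[OF W X(1)] by (simp add: W'(2))
    finally show ?thesis ..
  qed
  have Aadj: "mat_adjoint A = A"
    unfolding A_def using X W'(1) XW
    by (simp add: mat_adjoint_mult[of _ ?n ?n _ ?n] assoc_mult_mat[of _ ?n ?n _ ?n _ ?n])
  have Ah: "A $$ (i, j) = cnj (A $$ (j, i))" if "i < ?n" "j < ?n" for i j
    using mat_adjoint_index[OF A that] by (simp add: Aadj)
  have A0: "A $$ (i, 0) = (if i = 0 then e else 0)" if i: "i < ?n" for i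
  proof -
    have XW0: "(X * W) $$ (k, 0) = e * W $$ (k, 0)" if "k < ?n" for k
    proof -
      have "(X * W) $$ (k, 0) = (\<Sum>l<?n. X $$ (k, l) * (c * v $ l))"
        by (subst index_mult_sum[OF X(1) W'(1) that]) (auto simp: col intro!: sum.cong)
      also have "\<dots> = c * (\<Sum>l<?n. X $$ (k, l) * v $ l)"
        unfolding sum_distrib_left by (simp add: mult_ac)
      also have "(\<Sum>l<?n. X $$ (k, l) * v $ l) = (X *\<^sub>v v) $ k"
        by (rule index_mult_mat_vec_sum[OF X(1) v(1) that, symmetric])
      also have "\<dots> = e * v $ k" using v that by simp
      finally show ?thesis using col[OF that] by simp
    qed
    have "A $$ (i, 0) = (\<Sum>k<?n. mat_adjoint W $$ (i, k) * (X * W) $$ (k, 0))"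
      unfolding A_def by (rule index_mult_sum) (use W' XW i in auto)
    also have "\<dots> = e * (\<Sum>k<?n. mat_adjoint W $$ (i, k) * W $$ (k, 0))"
      unfolding sum_distrib_left by (intro sum.cong) (auto simp: XW0 mult_ac simp del: index_mult_mat(1))
    also have "(\<Sum>k<?n. mat_adjoint W $$ (i, k) * W $$ (k, 0)) = (mat_adjoint W * W) $$ (i, 0)"
      by (rule index_mult_sum[symmetric]) (use W' i in auto)
    finally show ?thesis using i by (simp add: W'(3))
  qed
  define B where "B = Matrix.mat n n (\<lambda>(i, j). A $$ (Suc i, Suc j))"
  have B: "B \<in> carrier_mat n n" by (simp add: B_def)
  have "mat_adjoint B = B"
  proof (rule eq_matI)
    fix i j assume "i < dim_row B" "j < dim_col B"
    then have ij: "i < n" "j < n" using B by auto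
    then show "mat_adjoint B $$ (i, j) = B $$ (i, j)"
      unfolding mat_adjoint_index[OF B ij]
      using Ah[of "Suc i" "Suc j"] by (simp add: B_def)
  qed (use B in auto)
  from Suc.IH[OF B this] obtain V d where V: "unitary_mat n V"
    and Bd: "B = spectral_mat n V (\<lambda>i. complex_of_real (d i))" by blast
  note V' = unitary_matD[OF V]
  define Q where "Q = Matrix.mat ?n ?n (\<lambda>(i, j). if i = 0 \<and> j = 0 then 1
     else if i = 0 \<or> j = 0 then 0 else V $$ (i - 1, j - 1))"
  have Q: "Q \<in> carrier_mat ?n ?n" by (simp add: Q_def)
  have Q0: "Q $$ (0, 0) = 1" "\<And>j. j < n \<Longrightarrow> Q $$ (0, Suc j) = 0" "\<And>i. i < n \<Longrightarrow> Q $$ (Suc i, 0) = 0"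
    "\<And>i j. i < n \<Longrightarrow> j < n \<Longrightarrow> Q $$ (Suc i, Suc j) = V $$ (i, j)"
    by (auto simp: Q_def)
  have QQ: "Q * mat_adjoint Q = 1\<^sub>m ?n"
  proof (rule eq_matI)
    fix i j assume "i < dim_row (1\<^sub>m ?n)" "j < dim_col (1\<^sub>m ?n)"
    then have ij: "i < ?n" "j < ?n" by auto
    have *: "(Q * mat_adjoint Q) $$ (i, j) = (\<Sum>k<?n. Q $$ (i, k) * cnj (Q $$ (j, k)))"
      using ij by (subst index_mult_sum[OF Q mat_adjoint_carrier[OF Q]])
        (auto simp: mat_adjoint_index[OF Q] intro!: sum.cong)
    have VV: "(\<Sum>k<n. V $$ (i, k) * cnj (V $$ (j, k))) = (if i = j then 1 else 0)" if "i < n" "j < n" for i j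
    proof -
      have "(V * mat_adjoint V) $$ (i, j) = (\<Sum>k<n. V $$ (i, k) * cnj (V $$ (j, k)))"
        using that by (subst index_mult_sum[OF V'(1) mat_adjoint_carrier[OF V'(1)]])
          (auto simp: mat_adjoint_index[OF V'(1)] intro!: sum.cong)
      then show ?thesis using that by (simp add: V'(2))
    qed
    show "(Q * mat_adjoint Q) $$ (i, j) = 1\<^sub>m ?n $$ (i, j)"
      unfolding * sum.lessThan_Suc_shift using ij
      by (cases i; cases j) (auto simp: Q0 VV)
  qed (use Q in auto)
  then have Qu: "unitary_mat ?n Q" using Q by (simp add: unitary_mat_def)
  define d' where "d' = case_nat (Re e) d"
  have e: "e = complex_of_real (Re e)"
    using Ah[of 0 0] A0[of 0] by (simp add: complex_eq_iff)
  have "A = spectral_mat ?n Q (\<lambda>i. complex_of_real (d' i))"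
  proof (rule eq_matI)
    fix i j assume "i < dim_row (spectral_mat ?n Q (\<lambda>i. complex_of_real (d' i)))"
      "j < dim_col (spectral_mat ?n Q (\<lambda>i. complex_of_real (d' i)))"
    then have ij: "i < ?n" "j < ?n"
      using spectral_mat_carrier[OF Qu, of "\<lambda>i. complex_of_real (d' i)"] by auto
    have Bij: "A $$ (Suc i, Suc j) = (\<Sum>k<n. complex_of_real (d k) * (V $$ (i, k) * cnj (V $$ (j, k))))"
      if "i < n" "j < n" for i j
      using that spectral_mat_index[OF V that, of "\<lambda>k. complex_of_real (d k)", folded Bd] by (simp add: B_def)
    show "A $$ (i, j) = spectral_mat ?n Q (\<lambda>i. complex_of_real (d' i)) $$ (i, j)"
      unfolding spectral_mat_index[OF Qu ij] sum.lessThan_Suc_shift using ij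
      by (cases i; cases j) (auto simp: Q0 Bij d'_def A0 e[symmetric] Ah[of 0 "Suc _"])
  qed (use A spectral_mat_carrier[OF Qu, of "\<lambda>i. complex_of_real (d' i)"] in auto)
  then have "X = spectral_mat ?n (W * Q) (\<lambda>i. complex_of_real (d' i))"
    unfolding XWA spectral_mat_def using W'(1) Q
    by (simp add: mat_adjoint_mult[of _ ?n ?n _ ?n] assoc_mult_mat[of _ ?n ?n _ ?n _ ?n]
        mult_carrier_mat[of _ ?n ?n _ ?n])
  with unitary_mat_mult[OF W Qu] show ?case by blast
qed

text \<open>The value picked by \<open>SOME\<close> comes with a decomposition of its own. Obtaining
  that decomposition together with the value makes it possible to work with one pair
  \<open>U\<close>, \<open>d\<close> throughout, without proving that the functional calculus is
  independent of the choice.\<close>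

lemma mat_fun_spectral:
  assumes X: "X \<in> carrier_mat n n" "mat_adjoint X = X"
  obtains U d where "unitary_mat n U" "X = spectral_mat n U (\<lambda>i. complex_of_real (d i))"
    "mat_fun f X = spectral_mat n U (\<lambda>i. complex_of_real (f (d i)))"
proof -
  have [simp]: "dim_row X = n" using X by auto
  have ex: "\<exists>Y U d. unitary_mat (dim_row X) U \<and>
     X = U * mat_diag (dim_row X) (\<lambda>i. complex_of_real (d i)) * mat_adjoint U \<and>
     Y = U * mat_diag (dim_row X) (\<lambda>i. complex_of_real (f (d i))) * mat_adjoint U"
    using hermitian_spectral[OF X] unfolding spectral_mat_def by auto
  have "\<exists>U d. unitary_mat n U \<and> X = spectral_mat n U (\<lambda>i. complex_of_real (d i)) \<and>
     mat_fun f X = spectral_mat n U (\<lambda>i. complex_of_real (f (d i)))"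
    using someI_ex[OF ex, folded mat_fun_def] by (simp add: spectral_mat_def)
  then show ?thesis using that by blast
qed

lemma qform_spectral:
  assumes U: "unitary_mat n U"
  shows "qform n (spectral_mat n U c) v = (\<Sum>k<n. c k * of_real ((cmod (\<Sum>j<n. cnj (U $$ (j, k)) * v j))\<^sup>2))"
proof -
  have "qform n (spectral_mat n U c) v
     = (\<Sum>i<n. \<Sum>j<n. \<Sum>k<n. c k * ((U $$ (i, k) * cnj (v i)) * (cnj (U $$ (j, k)) * v j)))"
    unfolding qform_def
    by (intro sum.cong) (auto simp: spectral_mat_index[OF U] sum_distrib_left sum_distrib_right mult_ac)
  also have "\<dots> = (\<Sum>k<n. \<Sum>i<n. \<Sum>j<n. c k * ((U $$ (i, k) * cnj (v i)) * (cnj (U $$ (j, k)) * v j)))"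
    by (rule trans[OF sum.cong[OF refl sum.swap] sum.swap])
  also have "\<dots> = (\<Sum>k<n. c k * ((\<Sum>i<n. U $$ (i, k) * cnj (v i)) * (\<Sum>j<n. cnj (U $$ (j, k)) * v j)))"
    by (simp only: sum_product, simp only: sum_distrib_left)
  also have "\<dots> = (\<Sum>k<n. c k * of_real ((cmod (\<Sum>j<n. cnj (U $$ (j, k)) * v j))\<^sup>2))"
    unfolding complex_norm_square by (intro sum.cong) (auto simp: mult_ac)
  finally show ?thesis .
qed

lemma psd_spectral:
  assumes U: "unitary_mat n U" and d: "\<And>i. i < n \<Longrightarrow> d i \<ge> 0"
  shows "psd n (spectral_mat n U (\<lambda>i. complex_of_real (d i)))"
  unfolding psd_iff_qform qform_spectral[OF U]
  using d by (auto simp: U less_eq_complex_def simp flip: of_real_mult simp del: of_real_power intro!: sum_nonneg)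

lemma psd_spectral_nonneg:
  assumes U: "unitary_mat n U" and psd: "psd n (spectral_mat n U (\<lambda>i. complex_of_real (d i)))" and i: "i < n"
  shows "d i \<ge> 0"
proof -
  note U' = unitary_matD[OF U]
  have ort: "(\<Sum>j<n. cnj (U $$ (j, k)) * U $$ (j, i)) = (if k = i then 1 else 0)" if "k < n" for k
  proof -
    have "(mat_adjoint U * U) $$ (k, i) = (\<Sum>j<n. cnj (U $$ (j, k)) * U $$ (j, i))"
      using that i by (subst index_mult_sum[OF mat_adjoint_carrier[OF U'(1)] U'(1)])
        (auto simp: mat_adjoint_index[OF U'(1)] intro!: sum.cong)
    then show ?thesis using that i by (simp add: U'(3))
  qed
  have "qform n (spectral_mat n U (\<lambda>i. complex_of_real (d i))) (\<lambda>j. U $$ (j, i)) = (\<Sum>k<n. if k = i then of_real (d i) else 0)"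
    unfolding qform_spectral[OF U] by (intro sum.cong) (auto simp: ort)
  also have "\<dots> = of_real (d i)" using i by simp
  finally have "Re (qform n (spectral_mat n U (\<lambda>i. complex_of_real (d i))) (\<lambda>j. U $$ (j, i))) = d i" by simp
  moreover have "Re (qform n (spectral_mat n U (\<lambda>i. complex_of_real (d i))) (\<lambda>j. U $$ (j, i))) \<ge> 0"
    using psd by (simp add: psd_iff_qform less_eq_complex_def)
  ultimately show ?thesis by simp
qed

lemma psd_mat_fun_spectral:
  assumes X: "psd n X"
  obtains U d where "unitary_mat n U" "X = spectral_mat n U (\<lambda>i. complex_of_real (d i))"
    "mat_fun f X = spectral_mat n U (\<lambda>i. complex_of_real (f (d i)))" "\<And>i. i < n \<Longrightarrow> d i \<ge> 0"
proof -
  have "X \<in> carrier_mat n n" using X by (simp add: psd_def)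
  from mat_fun_spectral[OF this psd_hermitian[OF X]] that psd_spectral_nonneg X show ?thesis
    by metis
qed

section \<open>Schatten norms and contractions\<close>

definition hs_inner :: "nat \<Rightarrow> complex mat \<Rightarrow> complex mat \<Rightarrow> complex" where
  "hs_inner n W Y = (\<Sum>k<n. \<Sum>l<n. cnj (W $$ (k, l)) * Y $$ (k, l))"

definition hs_norm :: "nat \<Rightarrow> complex mat \<Rightarrow> real" where
  "hs_norm n Y = sqrt (\<Sum>k<n. \<Sum>l<n. (cmod (Y $$ (k, l)))\<^sup>2)"

text \<open>Operator norm at most 1. Vectors are functions on the indices, of which only the values
  below \<open>n\<close> count.\<close>

definition contraction_mat :: "nat \<Rightarrow> complex mat \<Rightarrow> bool" where
  "contraction_mat n W \<longleftrightarrow> W \<in> carrier_mat n n \<and>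
     (\<forall>v. (\<Sum>k<n. (cmod (\<Sum>l<n. W $$ (k, l) * v l))\<^sup>2) \<le> (\<Sum>l<n. (cmod (v l))\<^sup>2))"

lemma contraction_matD:
  assumes "contraction_mat n W"
  shows "W \<in> carrier_mat n n"
    and "(\<Sum>k<n. (cmod (\<Sum>l<n. W $$ (k, l) * v l))\<^sup>2) \<le> (\<Sum>l<n. (cmod (v l))\<^sup>2)"
  using assms by (auto simp: contraction_mat_def)

lemma hs_inner_trace:
  assumes W: "W \<in> carrier_mat n n" and Y: "Y \<in> carrier_mat n n"
  shows "hs_inner n W Y = mat_trace (mat_adjoint W * Y)"
proof -
  have "mat_trace (mat_adjoint W * Y) = (\<Sum>l<n. (mat_adjoint W * Y) $$ (l, l))"
    using W by (simp add: mat_trace_def del: index_mult_mat(1))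
  also have "\<dots> = (\<Sum>l<n. \<Sum>k<n. cnj (W $$ (k, l)) * Y $$ (k, l))"
    by (intro sum.cong refl, subst index_mult_sum[OF mat_adjoint_carrier[OF W] Y])
       (auto simp: mat_adjoint_index[OF W])
  finally show ?thesis unfolding hs_inner_def by (subst sum.swap) simp
qed

lemma hs_inner_sandwich:
  assumes [simp]: "W \<in> carrier_mat n n" "Y \<in> carrier_mat n n" "S \<in> carrier_mat n n" "T \<in> carrier_mat n n"
  shows "hs_inner n W (S * Y * T) = hs_inner n (mat_adjoint S * W * mat_adjoint T) Y"
proof -
  note [simp] = mult_carrier_mat[of _ n n _ n] assoc_mult_mat[of _ n n _ n _ n] mat_adjoint_mult[of _ n n _ n]
  have "hs_inner n W (S * Y * T) = mat_trace ((mat_adjoint W * S * Y) * T)"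
    by (simp add: hs_inner_trace)
  also have "\<dots> = mat_trace (T * (mat_adjoint W * S * Y))"
    by (rule mat_trace_comm[of _ n n]) auto
  also have "\<dots> = hs_inner n (mat_adjoint S * W * mat_adjoint T) Y"
    by (simp add: hs_inner_trace)
  finally show ?thesis .
qed

lemma hs_norm_square:
  assumes Y: "Y \<in> carrier_mat n n"
  shows "complex_of_real ((hs_norm n Y)\<^sup>2) = mat_trace (mat_adjoint Y * Y)"
proof -
  have "(hs_norm n Y)\<^sup>2 = (\<Sum>k<n. \<Sum>l<n. (cmod (Y $$ (k, l)))\<^sup>2)"
    by (auto simp: hs_norm_def intro!: real_sqrt_pow2 sum_nonneg)
  then show ?thesis
    unfolding hs_inner_trace[OF Y Y, symmetric] hs_inner_def
    by (simp add: complex_norm_square mult.commute del: of_real_power)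
qed

lemma hs_norm_nonneg [simp]: "hs_norm n Y \<ge> 0"
  by (auto simp: hs_norm_def intro!: sum_nonneg)

lemma qform_adjoint_mult:
  assumes Y: "Y \<in> carrier_mat m m"
  shows "qform m (mat_adjoint Y * Y) v = of_real (\<Sum>k<m. (cmod (\<Sum>l<m. Y $$ (k, l) * v l))\<^sup>2)"
proof -
  have "qform m (mat_adjoint Y * Y) v
     = (\<Sum>i<m. \<Sum>j<m. \<Sum>k<m. cnj (Y $$ (k, i) * v i) * (Y $$ (k, j) * v j))"
    unfolding qform_def
    by (intro sum.cong refl, subst index_mult_sum[OF mat_adjoint_carrier[OF Y] Y])
       (auto simp: mat_adjoint_index[OF Y] sum_distrib_left sum_distrib_right mult_ac)
  also have "\<dots> = (\<Sum>k<m. \<Sum>i<m. \<Sum>j<m. cnj (Y $$ (k, i) * v i) * (Y $$ (k, j) * v j))"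
    by (rule trans[OF sum.cong[OF refl sum.swap] sum.swap])
  also have "\<dots> = (\<Sum>k<m. cnj (\<Sum>i<m. Y $$ (k, i) * v i) * (\<Sum>j<m. Y $$ (k, j) * v j))"
    by (simp only: sum_product cnj_sum)
  also have "\<dots> = of_real (\<Sum>k<m. (cmod (\<Sum>l<m. Y $$ (k, l) * v l))\<^sup>2)"
    by (simp add: complex_norm_square mult.commute del: of_real_power)
  finally show ?thesis .
qed

lemma psd_adjoint_mult:
  assumes Y: "Y \<in> carrier_mat m m"
  shows "psd m (mat_adjoint Y * Y)"
  using Y by (auto simp: psd_iff_qform qform_adjoint_mult less_eq_complex_def mult_carrier_mat[of _ m m]
      simp del: of_real_sum intro!: sum_nonneg)

lemma schatten_norm_2:
  assumes Y: "Y \<in> carrier_mat m m"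
  shows "schatten_norm 2 Y = hs_norm m Y"
proof -
  obtain U d where U: "unitary_mat m U" "mat_adjoint Y * Y = spectral_mat m U (\<lambda>i. complex_of_real (d i))"
    "mat_powr (mat_adjoint Y * Y) 1 = spectral_mat m U (\<lambda>i. complex_of_real (d i powr 1))" "\<And>i. i < m \<Longrightarrow> d i \<ge> 0"
    using psd_mat_fun_spectral[OF psd_adjoint_mult[OF Y], of "\<lambda>x. x powr 1"] unfolding mat_powr_def by metis
  \<comment> \<open>Positivity of the eigenvalues enters here: \<open>x powr 1 = x\<close> is used
    for \<open>x \<ge> 0\<close>.\<close>
  have "spectral_mat m U (\<lambda>i. complex_of_real (d i powr 1)) = spectral_mat m U (\<lambda>i. complex_of_real (d i))"
    by (rule spectral_mat_cong) (use U(4) in auto)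
  then have "mat_powr (mat_adjoint Y * Y) 1 = mat_adjoint Y * Y"
    using U(2,3) by simp
  then have "schatten_norm 2 Y = Re (mat_trace (mat_adjoint Y * Y)) powr (1 / 2)"
    by (simp add: schatten_norm_def)
  also have "\<dots> = hs_norm m Y"
    unfolding hs_norm_square[OF Y, symmetric]
    by (simp add: powr_half_sqrt)
  finally show ?thesis .
qed

lemma qform_one: "qform n (1\<^sub>m n) v = of_real (\<Sum>k<n. (cmod (v k))\<^sup>2)"
proof -
  have "(\<Sum>j<n. cnj (v i) * 1\<^sub>m n $$ (i, j) * v j) = of_real ((cmod (v i))\<^sup>2)" if "i < n" for i
  proof -
    have "(\<Sum>j<n. cnj (v i) * 1\<^sub>m n $$ (i, j) * v j) = (\<Sum>j<n. if i = j then cnj (v i) * v i else 0)"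
      using that by (intro sum.cong) auto
    then show ?thesis using that by (simp add: complex_norm_square mult.commute del: of_real_power)
  qed
  then show ?thesis by (simp add: qform_def del: of_real_power)
qed

text \<open>The squared norm of \<open>W v\<close> is the quadratic form of \<open>W* W\<close> at
  \<open>v\<close>, that is, a combination of the \<open>c k\<close> with the squared coordinates of
  \<open>v\<close> in the basis \<open>U\<close> as weights; these weights add up to the squared
  norm of \<open>v\<close>.\<close>

lemma contraction_matI:
  assumes W: "W \<in> carrier_mat n n" and U: "unitary_mat n U"
    and WW: "mat_adjoint W * W = spectral_mat n U (\<lambda>i. complex_of_real (c i))"
    and c: "\<And>i. i < n \<Longrightarrow> c i \<le> 1"
  shows "contraction_mat n W"
proof -
  have "(\<Sum>k<n. (cmod (\<Sum>l<n. W $$ (k, l) * v l))\<^sup>2) \<le> (\<Sum>l<n. (cmod (v l))\<^sup>2)" for v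
  proof -
    define q where "q k = (cmod (\<Sum>j<n. cnj (U $$ (j, k)) * v j))\<^sup>2" for k
    have "complex_of_real (\<Sum>k<n. (cmod (\<Sum>l<n. W $$ (k, l) * v l))\<^sup>2) = of_real (\<Sum>k<n. c k * q k)"
      unfolding qform_adjoint_mult[OF W, symmetric] WW qform_spectral[OF U] q_def[symmetric] by simp
    then have "(\<Sum>k<n. (cmod (\<Sum>l<n. W $$ (k, l) * v l))\<^sup>2) = (\<Sum>k<n. c k * q k)"
      by (simp only: of_real_eq_iff)
    also have "\<dots> \<le> (\<Sum>k<n. q k)"
    proof (rule sum_mono)
      fix k assume "k \<in> {..<n}"
      then have "c k * q k \<le> 1 * q k" using c by (intro mult_right_mono) (auto simp: q_def)
      then show "c k * q k \<le> q k" by simp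
    qed
    also have "complex_of_real (\<Sum>k<n. q k) = of_real (\<Sum>l<n. (cmod (v l))\<^sup>2)"
      using qform_spectral[OF U, of "\<lambda>_. 1" v, folded q_def]
      by (simp add: spectral_mat_one[OF U] qform_one)
    then have "(\<Sum>k<n. q k) = (\<Sum>l<n. (cmod (v l))\<^sup>2)"
      by (simp only: of_real_eq_iff)
    finally show ?thesis .
  qed
  then show ?thesis using W by (auto simp: contraction_mat_def)
qed

lemma contraction_mat_spectral:
  assumes U: "unitary_mat n U" and c: "\<And>i. i < n \<Longrightarrow> cmod (c i) \<le> 1"
  shows "contraction_mat n (spectral_mat n U c)"
proof (rule contraction_matI[OF _ U])
  show "mat_adjoint (spectral_mat n U c) * spectral_mat n U c
      = spectral_mat n U (\<lambda>i. complex_of_real ((cmod (c i))\<^sup>2))"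
    by (simp add: spectral_mat_adjoint[OF U] spectral_mat_mult[OF U] complex_norm_square mult.commute
        del: of_real_power)
  show "(cmod (c i))\<^sup>2 \<le> 1" if "i < n" for i
    using c[OF that] by (simp add: power_le_one)
qed (use U in auto)

lemma contraction_mat_unitary:
  assumes U: "unitary_mat n U" shows "contraction_mat n U"
  by (rule contraction_matI[OF _ U, of _ "\<lambda>_. 1"])
     (auto simp: unitary_matD[OF U] spectral_mat_one[OF U])

lemma cmod_sum_mult_le_L2:
  "cmod (\<Sum>i\<in>A. f i * g i) \<le> L2_set (\<lambda>i. cmod (f i)) A * L2_set (\<lambda>i. cmod (g i)) A"
proof -
  have "cmod (\<Sum>i\<in>A. f i * g i) \<le> (\<Sum>i\<in>A. \<bar>cmod (f i)\<bar> * \<bar>cmod (g i)\<bar>)"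
    by (rule order_trans[OF norm_sum]) (simp add: norm_mult)
  then show ?thesis using L2_set_mult_ineq by (rule order_trans)
qed

section \<open>Adjoints, products and entries of contractions\<close>

lemma contraction_mat_iff_L2:
  "contraction_mat n W \<longleftrightarrow> W \<in> carrier_mat n n \<and>
     (\<forall>v. L2_set (\<lambda>k. cmod (\<Sum>l<n. W $$ (k, l) * v l)) {..<n} \<le> L2_set (\<lambda>l. cmod (v l)) {..<n})"
  by (simp add: contraction_mat_def L2_set_def)

text \<open>With \<open>u = W* v\<close> of norm \<open>N\<close>, moving \<open>W\<close> across
  the inner product gives \<open>N^2 = <v, W u>\<close>, which Cauchy-Schwarz bounds by the norm of
  \<open>v\<close> times \<open>N\<close>; then one factor \<open>N\<close> cancels.\<close>

lemma contraction_mat_adjoint: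
  assumes "contraction_mat n W" shows "contraction_mat n (mat_adjoint W)"
proof -
  note W = contraction_matD(1)[OF assms]
  have "L2_set (\<lambda>k. cmod (\<Sum>l<n. mat_adjoint W $$ (k, l) * v l)) {..<n} \<le> L2_set (\<lambda>l. cmod (v l)) {..<n}" for v
  proof -
    define u where "u k = (\<Sum>l<n. cnj (W $$ (l, k)) * v l)" for k
    define N where "N = L2_set (\<lambda>k. cmod (u k)) {..<n}"
    have "complex_of_real (N\<^sup>2) = (\<Sum>k<n. u k * cnj (u k))"
      by (simp add: N_def L2_set_def sum_nonneg complex_norm_square del: of_real_power)
    also have "\<dots> = (\<Sum>k<n. \<Sum>l<n. v l * cnj (W $$ (l, k) * u k))"
      by (simp add: u_def[of _, symmetric]) (simp add: u_def sum_distrib_right mult_ac)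
    also have "\<dots> = (\<Sum>l<n. v l * cnj (\<Sum>k<n. W $$ (l, k) * u k))"
      by (subst sum.swap) (simp add: sum_distrib_left)
    finally have "N\<^sup>2 = cmod (\<Sum>l<n. v l * cnj (\<Sum>k<n. W $$ (l, k) * u k))"
      by (metis norm_of_real abs_power2)
    also have "\<dots> \<le> L2_set (\<lambda>l. cmod (v l)) {..<n} * L2_set (\<lambda>l. cmod (\<Sum>k<n. W $$ (l, k) * u k)) {..<n}"
      using cmod_sum_mult_le_L2[of v "\<lambda>l. cnj (\<Sum>k<n. W $$ (l, k) * u k)" "{..<n}"]
      by (simp del: cnj_sum complex_cnj_mult)
    also have "\<dots> \<le> L2_set (\<lambda>l. cmod (v l)) {..<n} * N"
      using assms unfolding N_def by (intro mult_left_mono) (auto simp: contraction_mat_iff_L2)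
    finally have "N \<le> L2_set (\<lambda>l. cmod (v l)) {..<n}"
      using L2_set_nonneg[of "\<lambda>k. cmod (u k)" "{..<n}", folded N_def]
      by (cases "N = 0") (auto simp: power2_eq_square mult_le_cancel_right)
    also have "N = L2_set (\<lambda>k. cmod (\<Sum>l<n. mat_adjoint W $$ (k, l) * v l)) {..<n}"
      unfolding N_def u_def by (intro L2_set_cong arg_cong[of _ _ cmod] sum.cong)
        (auto simp: mat_adjoint_index[OF W])
    finally show ?thesis .
  qed
  then show ?thesis using W by (simp add: contraction_mat_iff_L2)
qed

lemma contraction_mat_mult:
  assumes V: "contraction_mat n V" and W: "contraction_mat n W"
  shows "contraction_mat n (V * W)"
proof -
  note V' = contraction_matD[OF V] and W' = contraction_matD[OF W]
  have "(\<Sum>k<n. (cmod (\<Sum>l<n. (V * W) $$ (k, l) * v l))\<^sup>2) \<le> (\<Sum>l<n. (cmod (v l))\<^sup>2)" for v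
  proof -
    have "(\<Sum>l<n. (V * W) $$ (k, l) * v l) = (\<Sum>j<n. V $$ (k, j) * (\<Sum>l<n. W $$ (j, l) * v l))" if "k < n" for k
    proof -
      have "(\<Sum>l<n. (V * W) $$ (k, l) * v l) = (\<Sum>l<n. \<Sum>j<n. V $$ (k, j) * (W $$ (j, l) * v l))"
        using that by (intro sum.cong refl, subst index_mult_sum[OF V'(1) W'(1)])
          (auto simp: sum_distrib_right sum_distrib_left mult_ac)
      then show ?thesis by (subst (asm) sum.swap) (simp add: sum_distrib_left)
    qed
    then have "(\<Sum>k<n. (cmod (\<Sum>l<n. (V * W) $$ (k, l) * v l))\<^sup>2)
        = (\<Sum>k<n. (cmod (\<Sum>j<n. V $$ (k, j) * (\<Sum>l<n. W $$ (j, l) * v l)))\<^sup>2)" by simp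
    also have "\<dots> \<le> (\<Sum>j<n. (cmod (\<Sum>l<n. W $$ (j, l) * v l))\<^sup>2)" by (rule V'(2))
    also have "\<dots> \<le> (\<Sum>l<n. (cmod (v l))\<^sup>2)" by (rule W'(2))
    finally show ?thesis .
  qed
  then show ?thesis using V'(1) W'(1) by (simp add: contraction_mat_def mult_carrier_mat[of _ n n])
qed

text \<open>A column is the image of a basis vector. Together with the bound for rows this yields
  the weighted 2-norm estimate on the line \<open>Re z = 1\<close>.\<close>

lemma contraction_mat_col:
  assumes W: "contraction_mat n W" and l: "l < n"
  shows "(\<Sum>k<n. (cmod (W $$ (k, l)))\<^sup>2) \<le> 1"
proof -
  have "(\<Sum>j<n. W $$ (k, j) * (if j = l then 1 else 0)) = W $$ (k, l)" for k
    using l by (simp add: if_distrib cong: if_cong)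
  moreover have "(\<Sum>j<n. (cmod (if j = l then 1 else 0))\<^sup>2) = 1"
  proof -
    have "(\<Sum>j<n. (cmod (if j = l then 1 else 0))\<^sup>2) = (\<Sum>j<n. if j = l then 1 else 0)"
      by (intro sum.cong) auto
    then show ?thesis using l by simp
  qed
  ultimately show ?thesis
    using contraction_matD(2)[OF W, of "\<lambda>j. if j = l then 1 else 0"] by simp
qed

lemma contraction_mat_row:
  assumes W: "contraction_mat n W" and k: "k < n"
  shows "(\<Sum>l<n. (cmod (W $$ (k, l)))\<^sup>2) \<le> 1"
  using contraction_mat_col[OF contraction_mat_adjoint[OF W] k] k
  by (simp add: mat_adjoint_index[OF contraction_matD(1)[OF W]])

lemma contraction_mat_entry:
  assumes W: "contraction_mat n W" and kl: "k < n" "l < n"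
  shows "cmod (W $$ (k, l)) \<le> 1"
proof -
  have "(cmod (W $$ (k, l)))\<^sup>2 \<le> (\<Sum>k<n. (cmod (W $$ (k, l)))\<^sup>2)"
    using kl by (intro member_le_sum) auto
  then have "(cmod (W $$ (k, l)))\<^sup>2 \<le> 1" using contraction_mat_col[OF W kl(2)] by simp
  then show ?thesis by (simp add: power_le_one_iff)
qed

text \<open>In an eigenbasis of \<open>P\<close> only the diagonal of the conjugated contraction
  meets the eigenvalues, and its entries have modulus at most 1.\<close>

lemma hs_inner_psd_le:
  assumes W: "contraction_mat n W" and P: "psd n P"
  shows "cmod (hs_inner n W P) \<le> Re (mat_trace P)"
proof -
  obtain U d where U: "unitary_mat n U" and P': "P = spectral_mat n U (\<lambda>i. complex_of_real (d i))"
    and d: "\<And>i. i < n \<Longrightarrow> d i \<ge> 0"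
    using psd_mat_fun_spectral[OF P] by metis
  note U' = unitary_matD[OF U] and Wc = contraction_matD(1)[OF W]
  define V where "V = mat_adjoint U * W * U"
  have V: "contraction_mat n V"
    unfolding V_def
    by (intro contraction_mat_mult contraction_mat_adjoint[OF contraction_mat_unitary] contraction_mat_unitary[OF U] U W)
  have "hs_inner n W P = hs_inner n V (mat_diag n (\<lambda>i. complex_of_real (d i)))"
    unfolding P' spectral_mat_def V_def
    by (subst hs_inner_sandwich) (use U' Wc in auto)
  also have "\<dots> = (\<Sum>i<n. cnj (V $$ (i, i)) * complex_of_real (d i))"
    unfolding hs_inner_def
  proof (intro sum.cong refl)
    fix k assume k: "k \<in> {..<n}"
    have "(\<Sum>l<n. cnj (V $$ (k, l)) * mat_diag n (\<lambda>i. complex_of_real (d i)) $$ (k, l))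
       = (\<Sum>l<n. if k = l then cnj (V $$ (k, k)) * complex_of_real (d k) else 0)"
      using k by (intro sum.cong) (auto simp: mat_diag_def)
    then show "(\<Sum>l<n. cnj (V $$ (k, l)) * mat_diag n (\<lambda>i. complex_of_real (d i)) $$ (k, l))
       = cnj (V $$ (k, k)) * complex_of_real (d k)" using k by simp
  qed
  finally have "cmod (hs_inner n W P) \<le> (\<Sum>i<n. cmod (V $$ (i, i)) * d i)"
    using d by (auto intro!: order_trans[OF norm_sum] sum_mono simp: norm_mult)
  also have "\<dots> \<le> (\<Sum>i<n. 1 * d i)"
    using d contraction_mat_entry[OF V] by (intro sum_mono mult_right_mono) auto
  also have "\<dots> = Re (mat_trace P)"
    unfolding P' mat_trace_spectral[OF U] by simp
  finally show ?thesis .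
qed

text \<open>For a basis \<open>U\<close> that diagonalizes \<open>Y* Y\<close>, the columns of
  \<open>Z = Y U\<close> have squared norms \<open>d i\<close>, and the trace norm is the sum of the
  \<open>sqrt (d i)\<close>. Cauchy-Schwarz in each column, against the columns of the contraction
  \<open>W U\<close>, gives the upper bound.\<close>

lemma schatten_norm_1_dual:
  assumes Y: "Y \<in> carrier_mat n n"
  shows hs_inner_le_schatten_1: "\<And>W. contraction_mat n W \<Longrightarrow> cmod (hs_inner n W Y) \<le> schatten_norm 1 Y"
    and schatten_1_attained: "\<exists>W. contraction_mat n W \<and> hs_inner n W Y = of_real (schatten_norm 1 Y)"
proof -
  obtain U d where U: "unitary_mat n U" and YY: "mat_adjoint Y * Y = spectral_mat n U (\<lambda>i. complex_of_real (d i))"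
    and p: "mat_powr (mat_adjoint Y * Y) (1/2) = spectral_mat n U (\<lambda>i. complex_of_real (d i powr (1/2)))"
    and d: "\<And>i. i < n \<Longrightarrow> d i \<ge> 0"
    using psd_mat_fun_spectral[OF psd_adjoint_mult[OF Y], of "\<lambda>x. x powr (1/2)"] unfolding mat_powr_def by metis
  note U' = unitary_matD[OF U]
  note [simp] = U'(1) Y mult_carrier_mat[of _ n n _ n]
  have s: "schatten_norm 1 Y = (\<Sum>i<n. sqrt (d i))"
  proof -
    have "schatten_norm 1 Y = (\<Sum>i<n. d i powr (1/2)) powr 1"
      unfolding schatten_norm_def by (simp add: p[simplified] mat_trace_spectral[OF U])
    also have "\<dots> = (\<Sum>i<n. sqrt (d i))"
    proof -
      have "(\<Sum>i<n. sqrt (d i)) \<ge> 0" using d by (intro sum_nonneg) auto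
      then show ?thesis using d by (simp add: powr_half_sqrt)
    qed
    finally show ?thesis .
  qed
  define Z where "Z = Y * U"
  have Zc: "Z \<in> carrier_mat n n" by (simp add: Z_def)
  have ZZ: "mat_adjoint Z * Z = mat_diag n (\<lambda>i. complex_of_real (d i))"
  proof -
    have "mat_adjoint Z * Z = mat_adjoint U * (mat_adjoint Y * Y) * U"
      by (simp add: Z_def mat_adjoint_mult[of _ n n _ n] assoc_mult_mat[of _ n n _ n _ n])
    then show ?thesis by (simp add: YY spectral_mat_conj[OF U])
  qed
  have Zcol: "(\<Sum>k<n. (cmod (Z $$ (k, i)))\<^sup>2) = d i" if "i < n" for i
  proof -
    have "(mat_adjoint Z * Z) $$ (i, i) = of_real (\<Sum>k<n. (cmod (Z $$ (k, i)))\<^sup>2)"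
      using that by (subst index_mult_sum[OF mat_adjoint_carrier[OF Zc] Zc])
        (auto simp: mat_adjoint_index[OF Zc] complex_norm_square mult.commute simp del: of_real_power)
    then have "complex_of_real (d i) = of_real (\<Sum>k<n. (cmod (Z $$ (k, i)))\<^sup>2)"
      unfolding ZZ using that by (simp add: mat_diag_def)
    then show ?thesis by (simp only: of_real_eq_iff)
  qed
  show "cmod (hs_inner n W Y) \<le> schatten_norm 1 Y" if W: "contraction_mat n W" for W
  proof -
    define V where "V = W * U"
    have V: "contraction_mat n V"
      unfolding V_def by (intro contraction_mat_mult contraction_mat_unitary[OF U] W)
    note Wc [simp] = contraction_matD(1)[OF W]
    have "hs_inner n W Y = mat_trace (mat_adjoint W * (Y * (U * mat_adjoint U)))"
      by (simp add: hs_inner_trace U'(2) right_mult_one_mat[of _ n n])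
    also have "\<dots> = mat_trace (mat_adjoint W * Y * U * mat_adjoint U)"
      by (simp add: assoc_mult_mat[of _ n n _ n _ n])
    also have "\<dots> = mat_trace (mat_adjoint U * (mat_adjoint W * Y * U))"
      by (rule mat_trace_comm[of _ n n]) auto
    also have "\<dots> = hs_inner n V Z"
      by (simp add: hs_inner_trace V_def Z_def mat_adjoint_mult[of _ n n _ n] assoc_mult_mat[of _ n n _ n _ n])
    also have "\<dots> = (\<Sum>l<n. \<Sum>k<n. cnj (V $$ (k, l)) * Z $$ (k, l))"
      unfolding hs_inner_def by (rule sum.swap)
    finally have "cmod (hs_inner n W Y) \<le> (\<Sum>l<n. cmod (\<Sum>k<n. cnj (V $$ (k, l)) * Z $$ (k, l)))"
      by (simp add: norm_sum)
    also have "\<dots> \<le> (\<Sum>l<n. 1 * sqrt (d l))"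
    proof (rule sum_mono)
      fix l assume "l \<in> {..<n}"
      then have l: "l < n" by simp
      have "cmod (\<Sum>k<n. cnj (V $$ (k, l)) * Z $$ (k, l))
          \<le> L2_set (\<lambda>k. cmod (cnj (V $$ (k, l)))) {..<n} * L2_set (\<lambda>k. cmod (Z $$ (k, l))) {..<n}"
        by (rule cmod_sum_mult_le_L2)
      also have "\<dots> \<le> 1 * sqrt (d l)"
        using contraction_mat_col[OF V l] d[OF l]
        by (intro mult_mono) (auto simp: L2_set_def Zcol[OF l])
      finally show "cmod (\<Sum>k<n. cnj (V $$ (k, l)) * Z $$ (k, l)) \<le> 1 * sqrt (d l)" .
    qed
    finally show ?thesis by (simp add: s)
  qed
  show "\<exists>W. contraction_mat n W \<and> hs_inner n W Y = of_real (schatten_norm 1 Y)"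
  proof -
    \<comment> \<open>The partial isometry of the polar decomposition; since \<open>1 / 0 = 0\<close> it vanishes on the kernel of \<open>Y\<close>.\<close>
    define S where "S = spectral_mat n U (\<lambda>i. complex_of_real (1 / sqrt (d i)))"
    define W where "W = Y * S"
    have [simp]: "S \<in> carrier_mat n n" by (simp add: S_def U)
    have [simp]: "W \<in> carrier_mat n n" by (simp add: W_def)
    have Sadj: "mat_adjoint S = S" by (simp add: S_def spectral_mat_adjoint[OF U])
    have Wadj: "mat_adjoint W = S * mat_adjoint Y"
      by (simp add: W_def mat_adjoint_mult[of _ n n _ n] Sadj)
    have WY: "mat_adjoint W * Y = spectral_mat n U (\<lambda>i. complex_of_real (sqrt (d i)))"
    proof -
      have "mat_adjoint W * Y = S * (mat_adjoint Y * Y)"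
        by (simp add: Wadj assoc_mult_mat[of _ n n _ n _ n])
      also have "\<dots> = spectral_mat n U (\<lambda>i. complex_of_real (1 / sqrt (d i)) * complex_of_real (d i))"
        by (simp only: YY S_def spectral_mat_mult[OF U])
      also have "\<dots> = spectral_mat n U (\<lambda>i. complex_of_real (sqrt (d i)))"
        by (rule spectral_mat_cong) (use d in \<open>auto simp: real_div_sqrt simp flip: of_real_mult of_real_divide\<close>)
      finally show ?thesis .
    qed
    have "mat_adjoint W * W = spectral_mat n U (\<lambda>i. complex_of_real (if d i = 0 then 0 else 1))"
    proof -
      have "mat_adjoint W * W = (mat_adjoint W * Y) * S"
        by (simp add: W_def assoc_mult_mat[of _ n n _ n _ n])
      also have "\<dots> = spectral_mat n U (\<lambda>i. complex_of_real (sqrt (d i)) * complex_of_real (1 / sqrt (d i)))"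
        by (simp only: WY S_def spectral_mat_mult[OF U])
      also have "\<dots> = spectral_mat n U (\<lambda>i. complex_of_real (if d i = 0 then 0 else 1))"
        by (rule spectral_mat_cong) auto
      finally show ?thesis .
    qed
    then have "contraction_mat n W" by (rule contraction_matI[rotated 2]) (auto simp: U)
    moreover have "hs_inner n W Y = of_real (schatten_norm 1 Y)"
      by (simp add: hs_inner_trace WY mat_trace_spectral[OF U] s)
    ultimately show ?thesis by blast
  qed
qed

section \<open>Interpolation\<close>

text \<open>The function is divided by \<open>A^(1-z) B^z\<close>, which has the right modulus on
  both vertical sides, and the maximum modulus principle is applied on a rectangle. The bound
  \<open>K\<close> controls the horizontal sides.\<close>

lemma three_lines:
  assumes hol: "f holomorphic_on UNIV"
    and K: "\<And>z. 0 \<le> Re z \<Longrightarrow> Re z \<le> 1 \<Longrightarrow> cmod (f z) \<le> K"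
    and A: "\<And>z. Re z = 0 \<Longrightarrow> cmod (f z) \<le> A" and B: "\<And>z. Re z = 1 \<Longrightarrow> cmod (f z) \<le> B"
    and pos: "A > 0" "B > 0" and t: "0 \<le> t" "t \<le> 1"
  shows "cmod (f (of_real t)) \<le> A powr (1 - t) * B powr t"
proof -
  \<comment> \<open>The Gaussian factor makes the function small at the ends of a long rectangle; it is removed by \<open>e \<rightarrow> 0\<close>.\<close>
  define g where "g e z = f z * exp ((z - 1) * of_real (ln A) - z * of_real (ln B)) * exp (of_real e * (z\<^sup>2 - 1))" for e z
  have norm_g: "cmod (g e z) = cmod (f z) * exp ((Re z - 1) * ln A - Re z * ln B) * exp (e * ((Re z)\<^sup>2 - (Im z)\<^sup>2 - 1))" for e z
    by (simp add: g_def norm_mult power2_eq_square)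
  have g1: "cmod (g e (of_real t)) \<le> 1" if e: "e > 0" for e
  proof -
    define C where "C = max K 1 * exp (\<bar>ln A\<bar> + \<bar>ln B\<bar>)"
    have C: "C > 0" by (simp add: C_def)
    \<comment> \<open>Chosen so that \<open>ln C \<le> e * T \<le> e * T^2\<close>, where
      \<open>T \<ge> 1\<close> gives the second inequality. On the horizontal sides the Gaussian
      factor is at most \<open>exp (- e * T^2)\<close>, because \<open>(Re z)^2 \<le> 1\<close>, and
      so it outweighs \<open>C\<close>.\<close>
    define T where "T = 1 + \<bar>ln C\<bar> / e"
    have T: "T \<ge> 1" using e by (simp add: T_def)
    have CT: "C * exp (- e * T\<^sup>2) \<le> 1"
    proof -
      have "ln C \<le> e * T" using e by (simp add: T_def distrib_left)
      also have "\<dots> \<le> e * T\<^sup>2" using T e by (simp add: power2_eq_square)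
      finally have "exp (ln C) \<le> exp (e * T\<^sup>2)" by simp
      then show ?thesis using C by (simp add: exp_minus field_simps)
    qed
    define S where "S = cbox (Complex 0 (-T)) (Complex 1 T)"
    have ghol: "g e holomorphic_on X" for X
      unfolding g_def by (intro holomorphic_intros holomorphic_on_subset[OF hol]) auto
    show ?thesis
    proof (rule maximum_modulus_frontier[of "g e" S])
      show "g e holomorphic_on interior S" by (rule ghol)
      show "continuous_on (closure S) (g e)" by (rule holomorphic_on_imp_continuous_on[OF ghol])
      show "bounded S" by (simp add: S_def)
      show "complex_of_real t \<in> S" using t T by (simp add: S_def in_cbox_complex_iff)
      fix z assume "z \<in> frontier S"
      then have z: "0 \<le> Re z" "Re z \<le> 1" "-T \<le> Im z" "Im z \<le> T"
        and cases: "Re z = 0 \<or> Re z = 1 \<or> \<bar>Im z\<bar> = T"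
        by (auto simp: S_def frontier_cbox in_cbox_complex_iff in_box_complex_iff)
      have le1: "a * b * c \<le> 1" if "a * b \<le> 1" "0 \<le> c" "c \<le> 1" "0 \<le> a * b" for a b c :: real
        using mult_mono[OF that(1,3)] that by simp
      from cases consider "Re z = 0" | "Re z = 1" | "\<bar>Im z\<bar> = T" by blast
      then show "cmod (g e z) \<le> 1"
      proof cases
        case 1
        have "cmod (f z) * exp (- ln A) \<le> 1"
          using A[OF 1] pos by (simp add: exp_minus field_simps)
        then show ?thesis unfolding norm_g 1
          using e by (intro le1) (auto simp: mult_le_0_iff intro: order_trans[OF _ zero_le_power2])
      next
        case 2
        have "cmod (f z) * exp (- ln B) \<le> 1"
          using B[OF 2] pos by (simp add: exp_minus field_simps)
        then show ?thesis unfolding norm_g 2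
          using e by (intro le1) (auto simp: mult_le_0_iff)
      next
        case 3
        have "(Re z - 1) * ln A - Re z * ln B \<le> \<bar>(Re z - 1) * ln A\<bar> + \<bar>Re z * ln B\<bar>" by linarith
        also have "\<dots> \<le> 1 * \<bar>ln A\<bar> + 1 * \<bar>ln B\<bar>"
          unfolding abs_mult using z by (intro add_mono mult_right_mono) auto
        finally have "cmod (f z) * exp ((Re z - 1) * ln A - Re z * ln B) \<le> C"
          unfolding C_def using K[OF z(1,2)] by (intro mult_mono) auto
        moreover have "exp (e * ((Re z)\<^sup>2 - (Im z)\<^sup>2 - 1)) \<le> exp (- e * T\<^sup>2)"
        proof -
          have "(Im z)\<^sup>2 = T\<^sup>2" using 3 by (metis power2_abs)
          moreover have "(Re z)\<^sup>2 \<le> 1" using z by (simp add: power_le_one)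
          ultimately show ?thesis using e by (simp add: algebra_simps)
        qed
        ultimately have "cmod (g e z) \<le> C * exp (- e * T\<^sup>2)"
          unfolding norm_g by (intro mult_mono) (use C in auto)
        then show ?thesis using CT by simp
      qed
    qed
  qed
  define L where "L = A powr (1 - t) * B powr t"
  have L: "L > 0" using pos by (simp add: L_def)
  have Linv: "exp ((t - 1) * ln A - t * ln B) = 1 / L"
  proof -
    have "L = exp (- ((t - 1) * ln A - t * ln B))"
      using pos by (simp add: L_def powr_def algebra_simps flip: exp_add)
    then show ?thesis by (simp only: exp_minus) (simp add: field_simps)
  qed
  have "cmod (f (of_real t)) \<le> L * exp (e * (1 - t\<^sup>2))" if "e > 0" for e
  proof -
    have "cmod (f (of_real t)) * (1 / L) * exp (- (e * (1 - t\<^sup>2))) \<le> 1"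
      using g1[OF that] unfolding norm_g by (simp add: Linv right_diff_distrib)
    moreover have "F \<le> L * exp c" if "F * (1 / L) * exp (- c) \<le> 1" for F c :: real
      using that L by (simp add: exp_minus field_simps)
    ultimately show ?thesis by blast
  qed
  then have "eventually (\<lambda>e. cmod (f (of_real t)) \<le> L * exp (e * (1 - t\<^sup>2))) (at_right 0)"
    by (auto simp: eventually_at_right_less eventually_at_filter)
  moreover have "((\<lambda>e. L * exp (e * (1 - t\<^sup>2))) \<longlongrightarrow> L * exp (0 * (1 - t\<^sup>2))) (at_right 0)"
    by (intro tendsto_intros)
  ultimately have "cmod (f (of_real t)) \<le> L * exp (0 * (1 - t\<^sup>2))"
    by (intro tendsto_lowerbound[of _ _ "at_right (0::real)"]) auto
  then show ?thesis by (simp add: L_def)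
qed

lemma contraction_mat_diag:
  assumes "\<And>i. i < n \<Longrightarrow> cmod (c i) \<le> 1"
  shows "contraction_mat n (mat_diag n c)"
proof -
  have "mat_adjoint (1\<^sub>m n) = (1\<^sub>m n :: complex mat)"
    using mat_adjoint_diag[of n "\<lambda>_. 1"] by simp
  then have "unitary_mat n (1\<^sub>m n)" "spectral_mat n (1\<^sub>m n) c = mat_diag n c"
    by (auto simp: unitary_mat_def spectral_mat_def right_mult_one_mat[of _ n n] left_mult_one_mat[of _ n n])
  then show ?thesis using contraction_mat_spectral[of n "1\<^sub>m n" c] assms by simp
qed

text \<open>The analytic core, freed from tensor products by passing to eigenbases. In the
  application \<open>s\<close> lists the eigenvalues of \<open>1 \<otimes> \<sigma>\<close>, with
  sum \<open>b = |C|\<close>, \<open>x\<close> those of \<open>X\<close>, and \<open>N h i\<close>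
  is the deviation of the \<open>i\<close>-th eigenprojection of \<open>X\<close>. The randomizing
  property enters as \<open>N2\<close>, for functions \<open>g\<close> of \<open>X\<close> only, a
  form that is available for CQ states too.\<close>

lemma interpolated_expectation_bound:
  fixes M :: "'h measure" and w :: "'h \<Rightarrow> complex mat" and N :: "'h \<Rightarrow> nat \<Rightarrow> complex mat"
    and x s :: "nat \<Rightarrow> real"
  assumes M: "prob_space M"
    and w: "\<And>h. h \<in> space M \<Longrightarrow> contraction_mat n (w h)"
    and wm: "\<And>k l. k < n \<Longrightarrow> l < n \<Longrightarrow> (\<lambda>h. w h $$ (k, l)) \<in> borel_measurable M"
    and Nm: "\<And>i k l. i < m \<Longrightarrow> k < n \<Longrightarrow> l < n \<Longrightarrow> (\<lambda>h. N h i $$ (k, l)) \<in> borel_measurable M"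
    and Nc: "\<And>h i. h \<in> space M \<Longrightarrow> i < m \<Longrightarrow> N h i \<in> carrier_mat n n"
    and N1: "\<And>h i W. h \<in> space M \<Longrightarrow> i < m \<Longrightarrow> contraction_mat n W \<Longrightarrow> cmod (hs_inner n W (N h i)) \<le> 2"
    and N2: "\<And>g :: real \<Rightarrow> complex.
       (\<integral>h. hs_norm n (Matrix.mat n n (\<lambda>(k, l). \<Sum>i<m. g (x i) * N h i $$ (k, l))) \<partial>M)
         \<le> lam * sqrt (\<Sum>i<m. (cmod (g (x i)))\<^sup>2)"
    and s: "\<And>k. k < n \<Longrightarrow> s k \<ge> 0" "(\<Sum>k<n. s k) \<le> b"
    and x: "\<And>i. i < m \<Longrightarrow> x i \<ge> 0"
    and tau: "tau = (\<Sum>i<m. x i powr a)" "tau > 0"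
    and pos: "a > 0" "lam > 0" "b > 0" "0 \<le> t" "t \<le> 1"
  shows "cmod (\<integral>h. (\<Sum>k<n. \<Sum>l<n. cnj (w h $$ (k, l)) * of_real (s k powr (t / 4) * s l powr (t / 4)) *
             (\<Sum>i<m. of_real (x i powr (a * (1 - t / 2))) * N h i $$ (k, l))) \<partial>M)
         \<le> (2 * tau) powr (1 - t) * (sqrt b * (lam * sqrt tau)) powr t"
proof -
  interpret prob_space M by fact
  \<comment> \<open>Since \<open>0 powr z = 0\<close> for all complex \<open>z\<close>, these powers
    are entire in \<open>z\<close> also at zero eigenvalues, where they vanish identically.\<close>
  define X :: "complex \<Rightarrow> real \<Rightarrow> complex" where "X z r = of_real r powr (of_real a * (1 - z / 2))" for z r
  define S :: "complex \<Rightarrow> nat \<Rightarrow> complex" where "S z k = of_real (s k) powr (z / 4)" for z k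
  define Q where "Q z h = Matrix.mat n n (\<lambda>(k, l). \<Sum>i<m. X z (x i) * N h i $$ (k, l))" for z h
  define P where "P z h = (\<Sum>k<n. \<Sum>l<n. cnj (w h $$ (k, l)) * (S z k * S z l) * Q z h $$ (k, l))" for z h
  define g where "g i k l = (\<integral>h. cnj (w h $$ (k, l)) * N h i $$ (k, l) \<partial>M)" for i k l
  \<comment> \<open>The expectation of \<open>P z\<close> with the integral moved into the
    coefficients \<open>g i k l\<close>; as a finite sum it is visibly holomorphic.\<close>
  define G where "G z = (\<Sum>k<n. \<Sum>l<n. \<Sum>i<m. (S z k * S z l) * X z (x i) * g i k l)" for z
  have normX: "cmod (X z (x i)) = x i powr (a * (1 - Re z / 2))" if "i < m" for z i
    using x[OF that] by (simp add: X_def norm_powr_real_powr)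
  have normS: "cmod (S z k) = s k powr (Re z / 4)" if "k < n" for z k
    using s(1)[OF that] by (simp add: S_def norm_powr_real_powr)
  \<comment> \<open>A matrix unit is a contraction, so testing \<open>N1\<close> against it bounds
    single entries. This supplies the integrability used below.\<close>
  have N2': "cmod (N h i $$ (k, l)) \<le> 2" if h: "h \<in> space M" "i < m" "k < n" "l < n" for h i k l
  proof -
    define W where "W = (Matrix.mat n n (\<lambda>(p, q). if p = k \<and> q = l then 1 else 0) :: complex mat)"
    have "(cmod (\<Sum>q<n. W $$ (p, q) * v q))\<^sup>2 = (if p = k then (cmod (v l))\<^sup>2 else 0)" if "p < n" for v p
    proof -
      have "(\<Sum>q<n. W $$ (p, q) * v q) = (\<Sum>q<n. if q = l then (if p = k then v l else 0) else 0)"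
        using that by (intro sum.cong) (auto simp: W_def)
      then show ?thesis using h by simp
    qed
    then have "(\<Sum>p<n. (cmod (\<Sum>q<n. W $$ (p, q) * v q))\<^sup>2) = (cmod (v l))\<^sup>2" for v
      using h by simp
    moreover have "(cmod (v l))\<^sup>2 \<le> (\<Sum>l<n. (cmod (v l))\<^sup>2)" for v
      using h by (intro member_le_sum) auto
    ultimately have "contraction_mat n W" by (simp add: contraction_mat_def W_def)
    moreover have "hs_inner n W (N h i) = N h i $$ (k, l)"
    proof -
      have "(\<Sum>q<n. cnj (W $$ (p, q)) * N h i $$ (p, q)) = (if p = k then N h i $$ (k, l) else 0)" if "p < n" for p
      proof -
        have "(\<Sum>q<n. cnj (W $$ (p, q)) * N h i $$ (p, q)) = (\<Sum>q<n. if q = l then (if p = k then N h i $$ (k, l) else 0) else 0)"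
          using that by (intro sum.cong) (auto simp: W_def)
        then show ?thesis using h by simp
      qed
      then show ?thesis using h by (simp add: hs_inner_def)
    qed
    ultimately show ?thesis using N1[OF h(1,2), of W] by simp
  qed
  have wN: "integrable M (\<lambda>h. cnj (w h $$ (k, l)) * N h i $$ (k, l))" if "i < m" "k < n" "l < n" for i k l
  proof (rule integrable_const_bound[where B = 2])
    show "AE h in M. cmod (cnj (w h $$ (k, l)) * N h i $$ (k, l)) \<le> 2"
    proof (rule AE_I2)
      fix h assume h: "h \<in> space M"
      have "cmod (w h $$ (k, l)) * cmod (N h i $$ (k, l)) \<le> 1 * 2"
        using contraction_mat_entry[OF w[OF h] that(2,3)] N2'[OF h that] by (intro mult_mono) auto
      then show "cmod (cnj (w h $$ (k, l)) * N h i $$ (k, l)) \<le> 2" by (simp add: norm_mult)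
    qed
    show "(\<lambda>h. cnj (w h $$ (k, l)) * N h i $$ (k, l)) \<in> borel_measurable M"
      using that by (intro borel_measurable_times wm Nm borel_measurable_continuous_onI[THEN measurable_compose[rotated], of cnj] continuous_intros)
  qed
  have P': "P z h = (\<Sum>k<n. \<Sum>l<n. \<Sum>i<m. (S z k * S z l) * X z (x i) * (cnj (w h $$ (k, l)) * N h i $$ (k, l)))" for z h
    unfolding P_def by (intro sum.cong refl) (simp add: Q_def sum_distrib_left mult_ac)
  have PG: "integrable M (P z)" "(\<integral>h. P z h \<partial>M) = G z" for z
  proof -
    show "integrable M (P z)"
      unfolding P' by (intro Bochner_Integration.integrable_sum integrable_mult_right wN) auto
    have "(\<integral>h. P z h \<partial>M) = (\<Sum>k<n. \<Sum>l<n. \<Sum>i<m. \<integral>h. (S z k * S z l) * X z (x i) * (cnj (w h $$ (k, l)) * N h i $$ (k, l)) \<partial>M)"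
      unfolding P'
      by (subst Bochner_Integration.integral_sum, (intro Bochner_Integration.integrable_sum integrable_mult_right wN; simp),
          intro sum.cong refl)+
    then show "(\<integral>h. P z h \<partial>M) = G z"
      by (simp add: G_def g_def)
  qed
  \<comment> \<open>Any bound uniform on the strip will do. The bases are raised to
    \<open>1 + s k\<close> and \<open>1 + x i\<close>, since for a base of at least 1 the power
    grows with the exponent.\<close>
  have strip: "cmod (G z) \<le> (\<Sum>k<n. \<Sum>l<n. \<Sum>i<m. ((1 + s k) * (1 + s l)) * (1 + x i) powr a * cmod (g i k l))"
    if z: "0 \<le> Re z" "Re z \<le> 1" for z
  proof -
    have S1: "cmod (S z k) \<le> 1 + s k" if "k < n" for k
    proof -
      have "s k powr (Re z / 4) \<le> (1 + s k) powr (Re z / 4)"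
        using z s(1)[OF that] by (intro powr_mono2) auto
      also have "\<dots> \<le> (1 + s k) powr 1" using z s(1)[OF that] by (intro powr_mono) auto
      finally show ?thesis using s(1)[OF that] by (simp add: normS[OF that])
    qed
    have X1: "cmod (X z (x i)) \<le> (1 + x i) powr a" if "i < m" for i
    proof -
      have "x i powr (a * (1 - Re z / 2)) \<le> (1 + x i) powr (a * (1 - Re z / 2))"
        using z x[OF that] pos by (intro powr_mono2) auto
      also have "\<dots> \<le> (1 + x i) powr a"
        using z x[OF that] pos by (intro powr_mono) (auto simp: mult_le_cancel_left1)
      finally show ?thesis by (simp add: normX[OF that])
    qed
    show ?thesis
      unfolding G_def
      by (intro order_trans[OF norm_sum] sum_mono)
         (auto simp: norm_mult intro!: mult_mono S1 X1 mult_nonneg_nonneg add_nonneg_nonneg s)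
  qed
  \<comment> \<open>On this line the powers of the eigenvalues of \<sigma> have modulus at most 1
    (they are 0 at zero eigenvalues), so they can be absorbed into the contraction as
    \<open>W = D w D\<close>. Then \<open>N1\<close> applies to each eigenprojection, with weights
    \<open>x i powr a\<close> that sum to \<open>tau\<close>.\<close>
  have line0: "cmod (G z) \<le> 2 * tau" if z: "Re z = 0" for z
  proof -
    have "cmod (P z h) \<le> 2 * tau" if h: "h \<in> space M" for h
    proof -
      define D where "D = mat_diag n (\<lambda>k. cnj (S z k))"
      define W where "W = D * w h * D"
      have D: "contraction_mat n D" unfolding D_def
        by (rule contraction_mat_diag) (use z normS in auto)
      have W: "contraction_mat n W"
        unfolding W_def by (intro contraction_mat_mult D w h)
      have We: "W $$ (k, l) = cnj (S z k) * w h $$ (k, l) * cnj (S z l)" if "k < n" "l < n" for k l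
        using contraction_matD(1)[OF w[OF h]] that
        by (simp add: W_def D_def mat_diag_mult_left[of _ n n] mat_diag_mult_right[of _ n n])
      have "P z h = (\<Sum>k<n. \<Sum>l<n. \<Sum>i<m. X z (x i) * (cnj (W $$ (k, l)) * N h i $$ (k, l)))"
        unfolding P' by (intro sum.cong refl) (simp add: We mult_ac)
      also have "\<dots> = (\<Sum>k<n. \<Sum>i<m. \<Sum>l<n. X z (x i) * (cnj (W $$ (k, l)) * N h i $$ (k, l)))"
        by (intro sum.cong refl sum.swap)
      also have "\<dots> = (\<Sum>i<m. X z (x i) * hs_inner n W (N h i))"
        by (subst sum.swap) (simp add: hs_inner_def sum_distrib_left)
      finally have "cmod (P z h) \<le> (\<Sum>i<m. cmod (X z (x i)) * cmod (hs_inner n W (N h i)))"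
        by (simp add: norm_sum flip: norm_mult)
      also have "\<dots> \<le> (\<Sum>i<m. x i powr a * 2)"
        using z by (intro sum_mono mult_mono) (auto simp: normX N1[OF h _ W])
      also have "\<dots> = 2 * tau" by (simp add: tau sum_distrib_left mult.commute)
      finally show ?thesis .
    qed
    then have "(\<integral>h. cmod (P z h) \<partial>M) \<le> 2 * tau"
      using PG(1) by (intro integral_le_const) auto
    then show ?thesis
      using integral_norm_bound[of M "P z"] PG(2)[of z] by simp
  qed
  have line1: "cmod (G z) \<le> sqrt b * (lam * sqrt tau)" if z: "Re z = 1" for z
  proof -
    \<comment> \<open>Cauchy-Schwarz for the 2-norm separates the weighted contraction
      \<open>F\<close> from the deviation \<open>Q\<close>.\<close>
    have PQ: "cmod (P z h) \<le> sqrt b * hs_norm n (Q z h)" if h: "h \<in> space M" for h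
    proof -
      let ?I = "{..<n} \<times> {..<n}"
      define F where "F = (\<lambda>(k, l). cnj (w h $$ (k, l)) * (S z k * S z l))"
      have "P z h = (\<Sum>p\<in>?I. F p * Q z h $$ p)"
        unfolding P_def F_def by (simp add: sum.cartesian_product case_prod_beta)
      then have "cmod (P z h) \<le> L2_set (\<lambda>p. cmod (F p)) ?I * L2_set (\<lambda>p. cmod (Q z h $$ p)) ?I"
        by (simp add: cmod_sum_mult_le_L2)
      also have "L2_set (\<lambda>p. cmod (Q z h $$ p)) ?I = hs_norm n (Q z h)"
        by (simp add: L2_set_def hs_norm_def sum.cartesian_product case_prod_beta)
      also have "L2_set (\<lambda>p. cmod (F p)) ?I \<le> sqrt b"
      proof -
        \<comment> \<open>The arithmetic-geometric mean replaces \<open>sqrt (s k * s l)\<close> by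
          a sum of terms in \<open>k\<close> alone and in \<open>l\<close> alone; the rows and
          columns of a contraction then have total weight at most 1, which leaves the sum of the
          \<open>s k\<close>.\<close>
        have Fp: "(cmod (F (k, l)))\<^sup>2 \<le> (cmod (w h $$ (k, l)))\<^sup>2 * (s k / 2) + (cmod (w h $$ (k, l)))\<^sup>2 * (s l / 2)"
          if kl: "k < n" "l < n" for k l
        proof -
          have sq: "(s j powr (1 / 4))\<^sup>2 = sqrt (s j)" if "j < n" for j
            using s(1)[OF that] by (simp add: powr_half_sqrt flip: powr_add add: power2_eq_square)
          have "(cmod (F (k, l)))\<^sup>2 = (cmod (w h $$ (k, l)))\<^sup>2 * (sqrt (s k) * sqrt (s l))"
            using kl z by (simp add: F_def norm_mult normS power_mult_distrib sq)
          also have "sqrt (s k) * sqrt (s l) \<le> s k / 2 + s l / 2"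
            using arith_geo_mean_sqrt[OF s(1)[OF kl(1)] s(1)[OF kl(2)]] by (simp add: real_sqrt_mult field_simps)
          finally show ?thesis by (simp add: mult_left_mono distrib_left)
        qed
        have "(\<Sum>p\<in>?I. (cmod (F p))\<^sup>2) = (\<Sum>k<n. \<Sum>l<n. (cmod (F (k, l)))\<^sup>2)"
          by (simp add: sum.cartesian_product case_prod_beta)
        also have "\<dots> \<le> (\<Sum>k<n. \<Sum>l<n. (cmod (w h $$ (k, l)))\<^sup>2 * (s k / 2) + (cmod (w h $$ (k, l)))\<^sup>2 * (s l / 2))"
          using Fp by (intro sum_mono) auto
        also have "\<dots> = (\<Sum>k<n. (\<Sum>l<n. (cmod (w h $$ (k, l)))\<^sup>2) * (s k / 2))
            + (\<Sum>l<n. (\<Sum>k<n. (cmod (w h $$ (k, l)))\<^sup>2) * (s l / 2))"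
          unfolding sum.distrib sum_distrib_right by (intro arg_cong2[of _ _ _ _ "(+)"] refl sum.swap)
        also have "\<dots> \<le> (\<Sum>k<n. 1 * (s k / 2)) + (\<Sum>l<n. 1 * (s l / 2))"
          using s(1) w[OF h]
          by (intro add_mono sum_mono mult_right_mono contraction_mat_row contraction_mat_col) auto
        also have "\<dots> \<le> b" using s(2) by (simp flip: sum_divide_distrib)
        finally show ?thesis by (simp add: L2_set_def)
      qed
      finally show ?thesis by (simp add: mult_right_mono)
    qed
    have Qm: "(\<lambda>h. hs_norm n (Q z h)) \<in> borel_measurable M"
    proof -
      have "(\<lambda>h. \<Sum>i<m. X z (x i) * N h i $$ (k, l)) \<in> borel_measurable M" if "k < n" "l < n" for k l
        using that by (intro borel_measurable_sum borel_measurable_times borel_measurable_const Nm) auto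
      then show ?thesis
        unfolding hs_norm_def Q_def
        by (intro borel_measurable_sqrt[THEN measurable_compose[rotated]] borel_measurable_sum
              borel_measurable_power borel_measurable_norm[THEN measurable_compose[rotated]]) auto
    qed
    \<comment> \<open>Needed for integrability: a Bochner integral is 0 by convention for a
      non-integrable function, so a pointwise comparison alone would not compare the
      integrals.\<close>
    have Qb: "hs_norm n (Q z h) \<le> sqrt (\<Sum>k<n. \<Sum>l<n. (\<Sum>i<m. cmod (X z (x i)) * 2)\<^sup>2)" if h: "h \<in> space M" for h
    proof -
      have "cmod (Q z h $$ (k, l)) \<le> (\<Sum>i<m. cmod (X z (x i)) * 2)" if "k < n" "l < n" for k l
        using that N2'[OF h]
        by (auto simp: Q_def norm_mult intro!: order_trans[OF norm_sum] sum_mono mult_left_mono)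
      then show ?thesis unfolding hs_norm_def
        by (intro real_sqrt_le_mono sum_mono power_mono) auto
    qed
    have Qi: "integrable M (\<lambda>h. hs_norm n (Q z h))"
      by (rule integrable_const_bound[OF _ Qm]) (use Qb in auto)
    have "cmod (G z) \<le> (\<integral>h. cmod (P z h) \<partial>M)"
      using integral_norm_bound[of M "P z"] PG(2)[of z] by simp
    also have "\<dots> \<le> (\<integral>h. sqrt b * hs_norm n (Q z h) \<partial>M)"
      using PG(1) Qi PQ by (intro integral_mono) auto
    also have "\<dots> = sqrt b * (\<integral>h. hs_norm n (Q z h) \<partial>M)" by simp
    also have "\<dots> \<le> sqrt b * (lam * sqrt tau)"
    proof (rule mult_left_mono)
      \<comment> \<open>At \<open>Re z = 1\<close> each modulus is \<open>x i powr (a / 2)\<close>,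
        so the squares add up to \<open>tau\<close> again.\<close>
      have "(\<Sum>i<m. (cmod (X z (x i)))\<^sup>2) = tau"
        unfolding tau using z x by (intro sum.cong) (auto simp: normX power2_eq_square simp flip: powr_add)
      then show "(\<integral>h. hs_norm n (Q z h) \<partial>M) \<le> lam * sqrt tau"
        using N2[of "X z"] unfolding Q_def by simp
    qed (use pos in auto)
    finally show ?thesis .
  qed
  have hol: "G holomorphic_on UNIV"
    unfolding G_def S_def X_def by (intro holomorphic_intros) auto
  have "cmod (G (of_real t)) \<le> (2 * tau) powr (1 - t) * (sqrt b * (lam * sqrt tau)) powr t"
    by (rule three_lines[OF hol strip line0 line1]) (use pos tau in auto)
  also have "G (of_real t) = (\<integral>h. P (of_real t) h \<partial>M)" by (simp add: PG)
  also have "P (of_real t) = (\<lambda>h. (\<Sum>k<n. \<Sum>l<n. cnj (w h $$ (k, l)) * of_real (s k powr (t / 4) * s l powr (t / 4)) *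
             (\<Sum>i<m. of_real (x i powr (a * (1 - t / 2))) * N h i $$ (k, l))))"
  proof (intro ext)
    fix h
    have "S (of_real t) k = of_real (s k powr (t / 4))" if "k < n" for k
      using powr_of_real[OF s(1)[OF that], of "t / 4"] by (simp add: S_def)
    moreover have "X (of_real t) (x i) = of_real (x i powr (a * (1 - t / 2)))" if "i < m" for i
      using powr_of_real[OF x[OF that], of "a * (1 - t / 2)"] by (simp add: X_def)
    ultimately show "P (of_real t) h = (\<Sum>k<n. \<Sum>l<n. cnj (w h $$ (k, l)) * of_real (s k powr (t / 4) * s l powr (t / 4)) *
             (\<Sum>i<m. of_real (x i powr (a * (1 - t / 2))) * N h i $$ (k, l)))"
      unfolding P_def by (intro sum.cong refl) (simp add: Q_def)
  qed
  finally show ?thesis .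
qed

section \<open>Channels on bipartite systems\<close>

lemma bipartite_index:
  fixes i k :: nat
  assumes "i < d" "k < e"
  shows "i * e + k < d * e" "(i * e + k) div e = i" "(i * e + k) mod e = k"
proof -
  have "i * e + k < Suc i * e" using assms by simp
  also have "\<dots> \<le> d * e" using assms by (intro mult_le_mono1) auto
  finally show "i * e + k < d * e" .
qed (use assms in auto)

lemma bipartite_div_mod:
  fixes p :: nat
  assumes "p < d * e" shows "p div e < d" "p mod e < e"
  using assms by (auto simp: less_mult_imp_div_less intro!: mod_less_divisor gr0I)

lemma sum_bipartite:
  fixes f :: "nat \<Rightarrow> 'a :: comm_monoid_add"
  shows "(\<Sum>p<d * e. f p) = (\<Sum>i<d. \<Sum>k<e. f (i * e + k))"
proof -
  have "sum f {i * e..<i * e + e} = (\<Sum>k<e. f (i * e + k))" for i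
    using sum.shift_bounds_nat_ivl[of f 0 "i * e" e] by (simp add: lessThan_atLeast0 add.commute)
  then show ?thesis using sum.nat_group[of f e d] by simp
qed

lemma superop_sum:
  assumes \<Phi>: "superop dA dC \<Phi>" and "finite I" and Z: "\<And>i. i \<in> I \<Longrightarrow> Z i \<in> carrier_mat dA dA"
    and ab: "a < dC" "b < dC"
  shows "\<Phi> (Matrix.mat dA dA (\<lambda>(p, q). \<Sum>i\<in>I. c i * Z i $$ (p, q))) $$ (a, b) = (\<Sum>i\<in>I. c i * \<Phi> (Z i) $$ (a, b))"
  using assms(2) Z
proof (induction I rule: finite_induct)
  case empty
  \<comment> \<open>The image of the zero matrix is found from homogeneity with the scalar
    0.\<close>
  have e: "Matrix.mat dA dA (\<lambda>(p, q). \<Sum>i\<in>{}. c i * Z i $$ (p, q)) = 0 \<cdot>\<^sub>m 0\<^sub>m dA dA"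
    by (rule eq_matI) auto
  have z: "\<Phi> (0 \<cdot>\<^sub>m 0\<^sub>m dA dA) = 0 \<cdot>\<^sub>m \<Phi> (0\<^sub>m dA dA)" and zc: "\<Phi> (0\<^sub>m dA dA) \<in> carrier_mat dC dC"
    using \<Phi> zero_carrier_mat[of dA dA] unfolding superop_def by blast+
  show ?case unfolding e z using zc ab by simp
next
  case (insert i I)
  define R where "R = Matrix.mat dA dA (\<lambda>(p, q). \<Sum>i\<in>I. c i * Z i $$ (p, q))"
  have Zi: "Z i \<in> carrier_mat dA dA" and R: "R \<in> carrier_mat dA dA" using insert by (simp_all add: R_def)
  have IH: "\<Phi> R $$ (a, b) = (\<Sum>i\<in>I. c i * \<Phi> (Z i) $$ (a, b))"
    unfolding R_def using insert by blast
  have e: "Matrix.mat dA dA (\<lambda>(p, q). \<Sum>i\<in>insert i I. c i * Z i $$ (p, q)) = c i \<cdot>\<^sub>m Z i + R"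
    by (rule eq_matI) (use Zi insert.hyps in \<open>auto simp: R_def\<close>)
  have lin: "\<Phi> (c i \<cdot>\<^sub>m Z i + R) = c i \<cdot>\<^sub>m \<Phi> (Z i) + \<Phi> R"
    and car: "\<Phi> (Z i) \<in> carrier_mat dC dC" "\<Phi> R \<in> carrier_mat dC dC"
    using \<Phi> Zi R by (auto simp: superop_def)
  show ?case unfolding e lin using car ab insert.hyps by (simp add: IH)
qed

section \<open>Extension of superoperators by the identity on E\<close>

lemma E_block_carrier [simp]: "E_block dA dE X k l \<in> carrier_mat dA dA"
  by (simp add: E_block_def)

lemma superop_ext_carrier [simp]: "superop_ext dA dC dE \<Phi> X \<in> carrier_mat (dC * dE) (dC * dE)"
  by (simp add: superop_ext_def)

lemma superop_ext_dim [simp]: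
  "dim_row (superop_ext dA dC dE \<Phi> X) = dC * dE" "dim_col (superop_ext dA dC dE \<Phi> X) = dC * dE"
  by (simp_all add: superop_ext_def)

lemma superop_ext_index:
  assumes "a < dC" "b < dC" "k < dE" "l < dE"
  shows "superop_ext dA dC dE \<Phi> X $$ (a * dE + k, b * dE + l) = \<Phi> (E_block dA dE X k l) $$ (a, b)"
  using assms by (simp add: superop_ext_def bipartite_index)

lemma superop_ext_sum:
  assumes \<Phi>: "superop dA dC \<Phi>" and I: "finite I"
    and pq: "p < dC * dE" "q < dC * dE"
  shows "superop_ext dA dC dE \<Phi> (Matrix.mat (dA * dE) (dA * dE) (\<lambda>(p, q). \<Sum>i\<in>I. c i * Z i $$ (p, q))) $$ (p, q)
       = (\<Sum>i\<in>I. c i * superop_ext dA dC dE \<Phi> (Z i) $$ (p, q))"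
proof -
  note pq' = bipartite_div_mod[OF pq(1)] bipartite_div_mod[OF pq(2)]
  have "E_block dA dE (Matrix.mat (dA * dE) (dA * dE) (\<lambda>(p, q). \<Sum>i\<in>I. c i * Z i $$ (p, q))) k l
     = Matrix.mat dA dA (\<lambda>(p, q). \<Sum>i\<in>I. c i * E_block dA dE (Z i) k l $$ (p, q))" if "k < dE" "l < dE" for k l
    using that by (intro eq_matI) (auto simp: E_block_def bipartite_index)
  then show ?thesis
    using superop_sum[OF \<Phi> I, of "\<lambda>i. E_block dA dE (Z i) (p mod dE) (q mod dE)"] pq pq'
    by (simp add: superop_ext_def)
qed

section \<open>Operators that act on the second tensor factor\<close>

lemma tensor_one_carrier [simp]:
  "S \<in> carrier_mat e e \<Longrightarrow> tensor_mat (1\<^sub>m d) S \<in> carrier_mat (d * e) (d * e)"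
  by (auto simp: tensor_mat_def)

lemma tensor_one_index:
  assumes "S \<in> carrier_mat e e" "p < d * e" "q < d * e"
  shows "tensor_mat (1\<^sub>m d) S $$ (p, q) = (if p div e = q div e then S $$ (p mod e, q mod e) else 0)"
  using assms bipartite_div_mod[OF assms(2)] bipartite_div_mod[OF assms(3)]
  by (auto simp: tensor_mat_def)

lemma tensor_one_mult_left:
  assumes S: "S \<in> carrier_mat e e" and X: "X \<in> carrier_mat (d * e) r" and p: "i < d" "k < e" and q: "q < r"
  shows "(tensor_mat (1\<^sub>m d) S * X) $$ (i * e + k, q) = (\<Sum>k'<e. S $$ (k, k') * X $$ (i * e + k', q))"
proof -
  note p' = bipartite_index[OF p]
  have "(tensor_mat (1\<^sub>m d) S * X) $$ (i * e + k, q)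
      = (\<Sum>j<d. \<Sum>k'<e. tensor_mat (1\<^sub>m d) S $$ (i * e + k, j * e + k') * X $$ (j * e + k', q))"
    by (subst index_mult_sum[OF tensor_one_carrier[OF S] X p'(1) q]) (rule sum_bipartite)
  also have "\<dots> = (\<Sum>j<d. if j = i then \<Sum>k'<e. S $$ (k, k') * X $$ (i * e + k', q) else 0)"
    using p' by (intro sum.cong refl) (auto simp: tensor_one_index[OF S] bipartite_index)
  finally show ?thesis using p by simp
qed

lemma tensor_one_mult_right:
  assumes T: "T \<in> carrier_mat e e" and X: "X \<in> carrier_mat r (d * e)" and q: "j < d" "l < e" and p: "p < r"
  shows "(X * tensor_mat (1\<^sub>m d) T) $$ (p, j * e + l) = (\<Sum>l'<e. X $$ (p, j * e + l') * T $$ (l', l))"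
proof -
  note q' = bipartite_index[OF q]
  have "(X * tensor_mat (1\<^sub>m d) T) $$ (p, j * e + l)
      = (\<Sum>i<d. \<Sum>k'<e. X $$ (p, i * e + k') * tensor_mat (1\<^sub>m d) T $$ (i * e + k', j * e + l))"
    by (subst index_mult_sum[OF X tensor_one_carrier[OF T] p q'(1)]) (rule sum_bipartite)
  also have "\<dots> = (\<Sum>i<d. if i = j then \<Sum>l'<e. X $$ (p, j * e + l') * T $$ (l', l) else 0)"
    using q' by (intro sum.cong refl) (auto simp: tensor_one_index[OF T] bipartite_index)
  finally show ?thesis using q by simp
qed

lemma eq_mat_bipartiteI:
  assumes "A \<in> carrier_mat (d * e) (d * e)" "B \<in> carrier_mat (d * e) (d * e)"
    and "\<And>i j k l. i < d \<Longrightarrow> j < d \<Longrightarrow> k < e \<Longrightarrow> l < e \<Longrightarrow> A $$ (i * e + k, j * e + l) = B $$ (i * e + k, j * e + l)"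
  shows "A = B"
proof (rule eq_matI)
  fix p q assume "p < dim_row B" "q < dim_col B"
  then have "p < d * e" "q < d * e" using assms by auto
  then show "A $$ (p, q) = B $$ (p, q)"
    using assms(3)[of "p div e" "q div e" "p mod e" "q mod e"] bipartite_div_mod[of p d e] bipartite_div_mod[of q d e]
    by simp
qed (use assms in auto)

lemma tensor_one_mult:
  assumes S: "S \<in> carrier_mat e e" and T: "T \<in> carrier_mat e e"
  shows "tensor_mat (1\<^sub>m d) S * tensor_mat (1\<^sub>m d) T = tensor_mat (1\<^sub>m d) (S * T)"
proof (rule eq_mat_bipartiteI)
  note ST = mult_carrier_mat[OF S T]
  show "tensor_mat (1\<^sub>m d) S * tensor_mat (1\<^sub>m d) T \<in> carrier_mat (d * e) (d * e)"
    "tensor_mat (1\<^sub>m d) (S * T) \<in> carrier_mat (d * e) (d * e)"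
    using S T ST by (auto intro!: mult_carrier_mat[of _ "d * e" "d * e"])
  fix i j k l assume b: "i < d" "j < d" "k < e" "l < e"
  note b' = bipartite_index[OF b(1,3)] bipartite_index[OF b(2,4)]
  show "(tensor_mat (1\<^sub>m d) S * tensor_mat (1\<^sub>m d) T) $$ (i * e + k, j * e + l)
      = tensor_mat (1\<^sub>m d) (S * T) $$ (i * e + k, j * e + l)"
    unfolding tensor_one_mult_left[OF S tensor_one_carrier[OF T] b(1,3) b'(4)]
      tensor_one_index[OF ST b'(1,4)]
    using b b' by (auto simp: tensor_one_index[OF T] bipartite_index index_mult_sum[OF S T] simp del: index_mult_mat(1))
qed

lemma tensor_one_adjoint:
  assumes S: "S \<in> carrier_mat e e"
  shows "mat_adjoint (tensor_mat (1\<^sub>m d) S) = tensor_mat (1\<^sub>m d) (mat_adjoint S)"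
proof (rule eq_mat_bipartiteI)
  fix i j k l assume b: "i < d" "j < d" "k < e" "l < e"
  note b' = bipartite_index[OF b(1,3)] bipartite_index[OF b(2,4)]
  show "mat_adjoint (tensor_mat (1\<^sub>m d) S) $$ (i * e + k, j * e + l) = tensor_mat (1\<^sub>m d) (mat_adjoint S) $$ (i * e + k, j * e + l)"
    unfolding mat_adjoint_index[OF tensor_one_carrier[OF S] b'(1,4)]
      tensor_one_index[OF S b'(4,1)] tensor_one_index[OF mat_adjoint_carrier[OF S] b'(1,4)]
    using b b' by (auto simp: mat_adjoint_index[OF S])
qed (use S in auto)

lemma tensor_one_diag:
  "tensor_mat (1\<^sub>m d) (mat_diag e c) = mat_diag (d * e) (\<lambda>p. c (p mod e))"
proof (rule eq_mat_bipartiteI)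
  fix i j k l assume b: "i < d" "j < d" "k < e" "l < e"
  note b' = bipartite_index[OF b(1,3)] bipartite_index[OF b(2,4)]
  have "i * e + k = j * e + l \<longleftrightarrow> i = j \<and> k = l" using b' by metis
  then show "tensor_mat (1\<^sub>m d) (mat_diag e c) $$ (i * e + k, j * e + l) = mat_diag (d * e) (\<lambda>p. c (p mod e)) $$ (i * e + k, j * e + l)"
    unfolding tensor_one_index[OF mat_diag_dim b'(1,4)] using b b' by (auto simp: mat_diag_def)
qed auto

lemma tensor_one_one: "tensor_mat (1\<^sub>m d) (1\<^sub>m e) = 1\<^sub>m (d * e)"
  using tensor_one_diag[of d e "\<lambda>_. 1"] by simp

lemma unitary_tensor_one:
  assumes V: "unitary_mat e V"
  shows "unitary_mat (d * e) (tensor_mat (1\<^sub>m d) V)"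
  using unitary_matD[OF V]
  by (simp add: unitary_mat_def tensor_one_adjoint[of V e] tensor_one_mult[of _ e] tensor_one_one)

lemma tensor_one_spectral:
  assumes V: "unitary_mat e V"
  shows "tensor_mat (1\<^sub>m d) (spectral_mat e V c) = spectral_mat (d * e) (tensor_mat (1\<^sub>m d) V) (\<lambda>p. c (p mod e))"
proof -
  note V' = unitary_matD(1)[OF V]
  have VD: "V * mat_diag e c \<in> carrier_mat e e" using V' by (rule mult_carrier_mat) simp
  show ?thesis
    unfolding spectral_mat_def tensor_one_adjoint[OF V'] tensor_one_diag[symmetric]
    by (simp add: tensor_one_mult[OF V'] tensor_one_mult[OF VD] V')
qed

lemma tensor_one_sandwich_index:
  assumes S: "S \<in> carrier_mat e e" and T: "T \<in> carrier_mat e e" and X: "X \<in> carrier_mat (d * e) (d * e)"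
    and b: "i < d" "j < d" "k < e" "l < e"
  shows "(tensor_mat (1\<^sub>m d) S * X * tensor_mat (1\<^sub>m d) T) $$ (i * e + k, j * e + l)
     = (\<Sum>z\<in>{..<e} \<times> {..<e}. S $$ (k, fst z) * T $$ (snd z, l) * X $$ (i * e + fst z, j * e + snd z))"
proof -
  note b' = bipartite_index(1)[OF b(1,3)] bipartite_index(1)[OF b(2,4)]
  have SX: "tensor_mat (1\<^sub>m d) S * X \<in> carrier_mat (d * e) (d * e)"
    using tensor_one_carrier[OF S] X by (rule mult_carrier_mat)
  have "(tensor_mat (1\<^sub>m d) S * X * tensor_mat (1\<^sub>m d) T) $$ (i * e + k, j * e + l)
     = (\<Sum>l'<e. (\<Sum>k'<e. S $$ (k, k') * X $$ (i * e + k', j * e + l')) * T $$ (l', l))"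
    unfolding tensor_one_mult_right[OF T SX b(2,4) b'(1)]
    using b by (intro sum.cong refl) (simp add: tensor_one_mult_left[OF S X] bipartite_index)
  also have "\<dots> = (\<Sum>k'<e. \<Sum>l'<e. S $$ (k, k') * T $$ (l', l) * X $$ (i * e + k', j * e + l'))"
    by (subst sum.swap) (simp add: sum_distrib_right sum_distrib_left mult_ac)
  finally show ?thesis by (simp add: sum.cartesian_product case_prod_beta)
qed

text \<open>Each \<open>E\<close>-block of the sandwiched operator is a combination of blocks of
  \<open>X\<close> with scalar coefficients from \<open>S\<close> and \<open>T\<close>, and \<Phi>
  is linear. This is how powers of \<sigma> pass through the deviation.\<close>

lemma superop_ext_sandwich:
  assumes \<Phi>: "superop dA dC \<Phi>" and S: "S \<in> carrier_mat dE dE" and T: "T \<in> carrier_mat dE dE"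
    and X: "X \<in> carrier_mat (dA * dE) (dA * dE)"
  shows "superop_ext dA dC dE \<Phi> (tensor_mat (1\<^sub>m dA) S * X * tensor_mat (1\<^sub>m dA) T)
       = tensor_mat (1\<^sub>m dC) S * superop_ext dA dC dE \<Phi> X * tensor_mat (1\<^sub>m dC) T"
proof (rule eq_mat_bipartiteI)
  show "tensor_mat (1\<^sub>m dC) S * superop_ext dA dC dE \<Phi> X * tensor_mat (1\<^sub>m dC) T \<in> carrier_mat (dC * dE) (dC * dE)"
    using S T by (simp add: mult_carrier_mat[of _ "dC * dE" "dC * dE" _ "dC * dE"])
  fix a b k l assume b: "a < dC" "b < dC" "k < dE" "l < dE"
  let ?I = "{..<dE} \<times> {..<dE}"
  have "E_block dA dE (tensor_mat (1\<^sub>m dA) S * X * tensor_mat (1\<^sub>m dA) T) k l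
     = Matrix.mat dA dA (\<lambda>(p, q). \<Sum>z\<in>?I. (S $$ (k, fst z) * T $$ (snd z, l)) * E_block dA dE X (fst z) (snd z) $$ (p, q))"
    by (rule eq_matI) (use b in \<open>auto simp: E_block_def tensor_one_sandwich_index[OF S T X] simp del: index_mult_mat(1)\<close>)
  then have "\<Phi> (E_block dA dE (tensor_mat (1\<^sub>m dA) S * X * tensor_mat (1\<^sub>m dA) T) k l) $$ (a, b)
     = (\<Sum>z\<in>?I. (S $$ (k, fst z) * T $$ (snd z, l)) * \<Phi> (E_block dA dE X (fst z) (snd z)) $$ (a, b))"
    using superop_sum[OF \<Phi>, of ?I "\<lambda>z. E_block dA dE X (fst z) (snd z)" a b] b by simp
  then show "superop_ext dA dC dE \<Phi> (tensor_mat (1\<^sub>m dA) S * X * tensor_mat (1\<^sub>m dA) T) $$ (a * dE + k, b * dE + l)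
      = (tensor_mat (1\<^sub>m dC) S * superop_ext dA dC dE \<Phi> X * tensor_mat (1\<^sub>m dC) T) $$ (a * dE + k, b * dE + l)"
    unfolding superop_ext_index[OF b] tensor_one_sandwich_index[OF S T superop_ext_carrier b]
    using b by (auto simp: superop_ext_index intro!: sum.cong)
qed auto

section \<open>Trace and positivity under extended channels\<close>

lemma channel_ext_trace:
  assumes \<Phi>: "channel dA dC \<Phi>" and P: "P \<in> carrier_mat (dA * dE) (dA * dE)"
  shows "mat_trace (superop_ext dA dC dE \<Phi> P) = mat_trace P"
proof -
  have \<Phi>c: "\<Phi> X \<in> carrier_mat dC dC" "mat_trace (\<Phi> X) = mat_trace X" if "X \<in> carrier_mat dA dA" for X
    using \<Phi> that by (auto simp: channel_def superop_def)
  have "mat_trace (superop_ext dA dC dE \<Phi> P) = (\<Sum>a<dC. \<Sum>k<dE. \<Phi> (E_block dA dE P k k) $$ (a, a))"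
    by (simp add: mat_trace_def sum_bipartite superop_ext_index)
  also have "\<dots> = (\<Sum>k<dE. mat_trace (\<Phi> (E_block dA dE P k k)))"
    by (subst sum.swap) (simp add: mat_trace_def carrier_matD(1)[OF \<Phi>c(1)[OF E_block_carrier]])
  also have "\<dots> = (\<Sum>k<dE. \<Sum>i<dA. P $$ (i * dE + k, i * dE + k))"
    by (simp add: \<Phi>c) (simp add: mat_trace_def E_block_def)
  also have "\<dots> = mat_trace P"
    using P by (subst sum.swap) (simp add: mat_trace_def sum_bipartite)
  finally show ?thesis .
qed

lemma channel_ext_psd:
  "channel dA dC \<Phi> \<Longrightarrow> psd (dA * dE) P \<Longrightarrow> psd (dC * dE) (superop_ext dA dC dE \<Phi> P)"
  by (simp add: channel_def completely_positive_def)

text \<open>A measurement in the computational basis followed by a stochastic map. Both the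
  perfectly randomizing channel (all transition probabilities \<open>1 / dC\<close>) and hash
  channels (deterministic transitions) have this form, so complete positivity has to be checked only
  once.\<close>

definition classical_channel :: "nat \<Rightarrow> nat \<Rightarrow> (nat \<Rightarrow> nat \<Rightarrow> real) \<Rightarrow> complex mat \<Rightarrow> complex mat" where
  "classical_channel dA dC t \<theta> = Matrix.mat dC dC
     (\<lambda>(c, c'). if c = c' then \<Sum>a<dA. complex_of_real (t a c) * \<theta> $$ (a, a) else 0)"

lemma channel_classical:
  assumes t: "\<And>a c. a < dA \<Longrightarrow> c < dC \<Longrightarrow> t a c \<ge> 0" and t1: "\<And>a. a < dA \<Longrightarrow> (\<Sum>c<dC. t a c) = 1"
  shows "channel dA dC (classical_channel dA dC t)"
  unfolding channel_def completely_positive_def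
proof (intro conjI allI impI ballI)
  show "superop dA dC (classical_channel dA dC t)"
    unfolding superop_def classical_channel_def
    by (auto intro!: eq_matI simp: sum.distrib distrib_left sum_distrib_left mult_ac)
next
  fix X :: "complex mat" assume X: "X \<in> carrier_mat dA dA"
  have "mat_trace (classical_channel dA dC t X) = (\<Sum>a<dA. \<Sum>c<dC. complex_of_real (t a c) * X $$ (a, a))"
    by (subst sum.swap) (simp add: mat_trace_def classical_channel_def)
  also have "\<dots> = (\<Sum>a<dA. X $$ (a, a))"
    using t1 by (simp flip: sum_distrib_right of_real_sum)
  also have "\<dots> = mat_trace X" using X by (simp add: mat_trace_def)
  finally show "mat_trace (classical_channel dA dC t X) = mat_trace X" .
next
  fix dE P assume P: "psd (dA * dE) P"
  \<comment> \<open>The form of the output at \<open>v\<close> is a combination, with the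
    nonnegative weights \<open>t a c\<close>, of forms of \<open>P\<close> at the vectors
    \<open>|a> \<otimes> v_c\<close>, where \<open>v_c\<close> is the \<open>c\<close>-th block of
    \<open>v\<close>.\<close>
  have "qform (dC * dE) (superop_ext dA dC dE (classical_channel dA dC t) P) v
      = (\<Sum>c<dC. \<Sum>a<dA. complex_of_real (t a c) * qform (dA * dE) P (\<lambda>r. if r div dE = a then v (c * dE + r mod dE) else 0))" for v
  proof -
    have ext: "superop_ext dA dC dE (classical_channel dA dC t) P $$ (c * dE + k, c' * dE + l)
       = (if c = c' then \<Sum>a<dA. complex_of_real (t a c) * P $$ (a * dE + k, a * dE + l) else 0)"
      if "c < dC" "c' < dC" "k < dE" "l < dE" for c c' k l
      using that by (simp add: superop_ext_index classical_channel_def E_block_def)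
    have q: "qform (dA * dE) P (\<lambda>r. if r div dE = a then v (c * dE + r mod dE) else 0)
       = (\<Sum>k<dE. \<Sum>l<dE. cnj (v (c * dE + k)) * P $$ (a * dE + k, a * dE + l) * v (c * dE + l))" if a: "a < dA" for a c
    proof -
      have "qform (dA * dE) P (\<lambda>r. if r div dE = a then v (c * dE + r mod dE) else 0)
         = (\<Sum>i<dA. \<Sum>k<dE. \<Sum>j<dA. \<Sum>l<dE. if i = a \<and> j = a then cnj (v (c * dE + k)) * P $$ (a * dE + k, a * dE + l) * v (c * dE + l) else 0)"
        unfolding qform_def sum_bipartite by (intro sum.cong refl) (auto simp: bipartite_index)
      also have "\<dots> = (\<Sum>i<dA. if i = a then (\<Sum>k<dE. \<Sum>l<dE. cnj (v (c * dE + k)) * P $$ (a * dE + k, a * dE + l) * v (c * dE + l)) else 0)"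
      proof (intro sum.cong refl)
        fix i
        have "(\<Sum>j<dA. \<Sum>l<dE. if i = a \<and> j = a then F l else 0) = (if i = a then \<Sum>l<dE. F l else 0)" for F :: "nat \<Rightarrow> complex"
        proof -
          have "(\<Sum>j<dA. \<Sum>l<dE. if i = a \<and> j = a then F l else 0) = (\<Sum>j<dA. if j = a then (if i = a then \<Sum>l<dE. F l else 0) else 0)"
            by (intro sum.cong) auto
          then show ?thesis using a by simp
        qed
        then show "(\<Sum>k<dE. \<Sum>j<dA. \<Sum>l<dE. if i = a \<and> j = a then cnj (v (c * dE + k)) * P $$ (a * dE + k, a * dE + l) * v (c * dE + l) else 0)
          = (if i = a then (\<Sum>k<dE. \<Sum>l<dE. cnj (v (c * dE + k)) * P $$ (a * dE + k, a * dE + l) * v (c * dE + l)) else 0)"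
          by simp
      qed
      finally show ?thesis using a by simp
    qed
    have "qform (dC * dE) (superop_ext dA dC dE (classical_channel dA dC t) P) v
      = (\<Sum>c<dC. \<Sum>k<dE. \<Sum>c'<dC. \<Sum>l<dE. if c' = c then cnj (v (c * dE + k)) * (\<Sum>a<dA. complex_of_real (t a c) * P $$ (a * dE + k, a * dE + l)) * v (c * dE + l) else 0)"
      unfolding qform_def sum_bipartite by (intro sum.cong refl) (auto simp: ext)
    also have "\<dots> = (\<Sum>c<dC. \<Sum>k<dE. \<Sum>l<dE. cnj (v (c * dE + k)) * (\<Sum>a<dA. complex_of_real (t a c) * P $$ (a * dE + k, a * dE + l)) * v (c * dE + l))"
    proof (rule sum.cong[OF refl], rule sum.cong[OF refl])
      fix c k assume c: "c \<in> {..<dC}"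
      have collapse: "(\<Sum>c'<dC. \<Sum>l<dE. if c' = c then F l else 0) = (\<Sum>l<dE. F l)" for F :: "nat \<Rightarrow> complex"
      proof -
        have "(\<Sum>c'<dC. \<Sum>l<dE. if c' = c then F l else 0) = (\<Sum>c'<dC. if c' = c then \<Sum>l<dE. F l else 0)"
          by (intro sum.cong) auto
        then show ?thesis using c by simp
      qed
      show "(\<Sum>c'<dC. \<Sum>l<dE. if c' = c then cnj (v (c * dE + k)) * (\<Sum>a<dA. complex_of_real (t a c) * P $$ (a * dE + k, a * dE + l)) * v (c * dE + l) else 0)
        = (\<Sum>l<dE. cnj (v (c * dE + k)) * (\<Sum>a<dA. complex_of_real (t a c) * P $$ (a * dE + k, a * dE + l)) * v (c * dE + l))"
        by (rule collapse)
    qed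
    also have "\<dots> = (\<Sum>c<dC. \<Sum>k<dE. \<Sum>l<dE. \<Sum>a<dA. complex_of_real (t a c) * (cnj (v (c * dE + k)) * P $$ (a * dE + k, a * dE + l) * v (c * dE + l)))"
      by (simp add: sum_distrib_left sum_distrib_right mult_ac)
    also have "\<dots> = (\<Sum>c<dC. \<Sum>a<dA. \<Sum>k<dE. \<Sum>l<dE. complex_of_real (t a c) * (cnj (v (c * dE + k)) * P $$ (a * dE + k, a * dE + l) * v (c * dE + l)))"
      by (intro sum.cong refl trans[OF sum.cong[OF refl sum.swap] sum.swap])
    also have "\<dots> = (\<Sum>c<dC. \<Sum>a<dA. complex_of_real (t a c) * qform (dA * dE) P (\<lambda>r. if r div dE = a then v (c * dE + r mod dE) else 0))"
      by (intro sum.cong refl) (simp add: q sum_distrib_left)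
    finally show ?thesis .
  qed
  moreover have "0 \<le> qform (dA * dE) P u" for u using P by (simp add: psd_iff_qform)
  moreover have "0 \<le> complex_of_real (t a c)" if "a < dA" "c < dC" for a c
    using t[OF that] by (simp add: less_eq_complex_def)
  ultimately show "psd (dC * dE) (superop_ext dA dC dE (classical_channel dA dC t) P)"
    by (auto simp: psd_iff_qform intro!: sum_nonneg mult_nonneg_nonneg)
qed

lemma channel_cong:
  assumes \<Phi>: "channel dA dC \<Phi>" and eq: "\<And>X. X \<in> carrier_mat dA dA \<Longrightarrow> \<Psi> X = \<Phi> X"
  shows "channel dA dC \<Psi>"
proof -
  have "superop_ext dA dC dE \<Psi> X = superop_ext dA dC dE \<Phi> X" for dE X
    by (simp add: superop_ext_def eq)
  then show ?thesis using \<Phi> by (simp add: channel_def completely_positive_def superop_def eq)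
qed

lemma channel_perfectly_randomizing:
  assumes "dC > 0" shows "channel dA dC (perfectly_randomizing dC)"
proof (rule channel_cong)
  show "channel dA dC (classical_channel dA dC (\<lambda>_ _. 1 / real dC))"
    using assms by (intro channel_classical) auto
  show "perfectly_randomizing dC X = classical_channel dA dC (\<lambda>_ _. 1 / real dC) X" if "X \<in> carrier_mat dA dA" for X
    using that by (intro eq_matI)
      (auto simp: perfectly_randomizing_def classical_channel_def mat_trace_def sum_divide_distrib)
qed

lemma channel_hash:
  assumes f: "f ` {..<dA} \<subseteq> {..<dC}" shows "channel dA dC (hash_channel dA dC f)"
proof (rule channel_cong)
  show "channel dA dC (classical_channel dA dC (\<lambda>a c. if c = f a then 1 else 0))"
    using f by (intro channel_classical) auto
  show "hash_channel dA dC f X = classical_channel dA dC (\<lambda>a c. if c = f a then 1 else 0) X" for X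
    by (intro eq_matI)
      (auto simp: hash_channel_def classical_channel_def mat_sum_def ket_proj_def intro!: sum.cong sum.neutral)
qed

section \<open>Measurable choice of contractions\<close>

text \<open>Matrices are encoded as functions \<open>nat => nat => complex\<close>, so that
  separability of the product topology gives a countable dense set of contractions. For fixed
  \<open>Y\<close> the pairing depends on finitely many coordinates and is continuous, hence a
  sequence tending to a maximizer comes arbitrarily close to the trace norm.\<close>

lemma countable_contractions:
  obtains V :: "nat \<Rightarrow> complex mat" where "\<And>j. contraction_mat n (V j)"
    and "\<And>Y e. Y \<in> carrier_mat n n \<Longrightarrow> e > 0 \<Longrightarrow> \<exists>j. schatten_norm 1 Y - e < Re (hs_inner n (V j) Y)"
proof -
  define mk where "mk w = Matrix.mat n n (\<lambda>(k, l). w k l :: complex)" for w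
  define S where "S = {w. contraction_mat n (mk w)}"
  obtain T where T: "countable T" "T \<subseteq> S" "S \<subseteq> closure T"
    using separable[of S] by metis
  have "contraction_mat n (mk (\<lambda>_ _. 0))"
    by (auto simp: contraction_mat_def mk_def intro!: sum_nonneg)
  then have "T \<noteq> {}" using T(3) by (auto simp: S_def)
  define V where "V j = mk (from_nat_into T j)" for j
  show thesis
  proof (rule that)
    show "contraction_mat n (V j)" for j
      using from_nat_into[OF \<open>T \<noteq> {}\<close>, of j] T(2) by (auto simp: V_def S_def)
    fix Y :: "complex mat" and e :: real assume Y: "Y \<in> carrier_mat n n" and e: "e > 0"
    obtain W where W: "contraction_mat n W" "hs_inner n W Y = of_real (schatten_norm 1 Y)"
      using schatten_1_attained[OF Y] by blast
    define w0 where "w0 k l = W $$ (k, l)" for k l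
    have "mk w0 = W" using contraction_matD(1)[OF W(1)] by (auto simp: mk_def w0_def)
    then have "w0 \<in> closure T" using W(1) T(3) by (auto simp: S_def)
    then obtain ws where ws: "\<And>j. ws j \<in> T" "ws \<longlonglongrightarrow> w0" by (auto simp: closure_sequential)
    define F where "F w = Re (\<Sum>k<n. \<Sum>l<n. cnj (w k l) * Y $$ (k, l))" for w
    have F: "F w = Re (hs_inner n (mk w) Y)" for w
      by (simp add: F_def hs_inner_def mk_def)
    have "continuous_on UNIV (\<lambda>w :: nat \<Rightarrow> nat \<Rightarrow> complex. w k l)" for k l
      by (rule continuous_on_product_then_coordinatewise[OF continuous_on_product_coordinates])
    then have "continuous_on UNIV F"
      unfolding F_def by (intro continuous_intros)
    then have "(\<lambda>j. F (ws j)) \<longlonglongrightarrow> F w0"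
      by (rule continuous_on_tendsto_compose[OF _ ws(2)]) auto
    moreover have "F w0 > schatten_norm 1 Y - e"
      using e by (simp add: F \<open>mk w0 = W\<close> W(2))
    ultimately have "\<forall>\<^sub>F j in sequentially. F (ws j) > schatten_norm 1 Y - e"
      by (rule order_tendstoD)
    then obtain j where "F (ws j) > schatten_norm 1 Y - e"
      by (auto simp: eventually_sequentially)
    moreover obtain i where "ws j = from_nat_into T i"
      using from_nat_into_surj[OF T(1) ws(1)] by metis
    ultimately show "\<exists>j. schatten_norm 1 Y - e < Re (hs_inner n (V j) Y)"
      by (auto simp: F V_def)
  qed
qed

lemma borel_measurable_hs_inner:
  assumes "\<And>k l. k < n \<Longrightarrow> l < n \<Longrightarrow> (\<lambda>h. Y h $$ (k, l)) \<in> borel_measurable M"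
  shows "(\<lambda>h. hs_inner n W (Y h)) \<in> borel_measurable M"
  unfolding hs_inner_def using assms
  by (intro borel_measurable_sum borel_measurable_times borel_measurable_const) auto

text \<open>By duality the trace norm is a countable supremum of real-linear functions of the
  entries. This sidesteps the dependence of spectral data on \<open>h\<close>.\<close>

lemma borel_measurable_schatten_norm_1:
  assumes Yc: "\<And>h. h \<in> space M \<Longrightarrow> Y h \<in> carrier_mat n n"
    and Ym: "\<And>k l. k < n \<Longrightarrow> l < n \<Longrightarrow> (\<lambda>h. Y h $$ (k, l)) \<in> borel_measurable M"
  shows "(\<lambda>h. schatten_norm 1 (Y h)) \<in> borel_measurable M"
proof -
  obtain V :: "nat \<Rightarrow> complex mat" where V: "\<And>j. contraction_mat n (V j)"
    "\<And>Y e. Y \<in> carrier_mat n n \<Longrightarrow> e > 0 \<Longrightarrow> \<exists>j. schatten_norm 1 Y - e < Re (hs_inner n (V j) Y)"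
    by (rule countable_contractions[of n]) blast
  have le: "Re (hs_inner n (V j) (Y h)) \<le> schatten_norm 1 (Y h)" if "h \<in> space M" for j h
    using hs_inner_le_schatten_1[OF Yc[OF that] V(1)[of j]] complex_Re_le_cmod order_trans by blast
  have meas: "(\<lambda>h. SUP j. Re (hs_inner n (V j) (Y h))) \<in> borel_measurable M"
  proof (rule borel_measurable_cSUP)
    show "(\<lambda>h. Re (hs_inner n (V j) (Y h))) \<in> borel_measurable M" for j
      using borel_measurable_hs_inner[OF Ym, of n "V j"] by simp
    show "bdd_above (range (\<lambda>j. Re (hs_inner n (V j) (Y h))))" if "h \<in> space M" for h
      using le[OF that] by (auto intro!: bdd_aboveI)
  qed auto
  have eq: "schatten_norm 1 (Y h) = (SUP j. Re (hs_inner n (V j) (Y h)))" if h: "h \<in> space M" for h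
  proof (rule antisym)
    show "(SUP j. Re (hs_inner n (V j) (Y h))) \<le> schatten_norm 1 (Y h)"
      by (rule cSUP_least) (auto simp: le[OF h])
    show "schatten_norm 1 (Y h) \<le> (SUP j. Re (hs_inner n (V j) (Y h)))"
    proof (rule field_le_epsilon)
      fix e :: real assume "e > 0"
      then obtain j where "schatten_norm 1 (Y h) - e < Re (hs_inner n (V j) (Y h))"
        using V(2)[OF Yc[OF h]] by blast
      also have "\<dots> \<le> (SUP j. Re (hs_inner n (V j) (Y h)))"
        using le[OF h] by (intro cSUP_upper) (auto intro!: bdd_aboveI)
      finally show "schatten_norm 1 (Y h) \<le> (SUP j. Re (hs_inner n (V j) (Y h))) + e" by simp
    qed
  qed
  show ?thesis by (rule measurable_cong[THEN iffD2, OF eq meas])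
qed

text \<open>An exact maximizer might depend on \<open>h\<close> non-measurably. Giving up
  \<open>e\<close> allows the first good member of a countable list to be taken; its index
  \<open>J\<close> is a measurable function with values in a countable space.\<close>

lemma measurable_near_optimal_contraction:
  assumes Yc: "\<And>h. h \<in> space M \<Longrightarrow> Y h \<in> carrier_mat n n"
    and Ym: "\<And>k l. k < n \<Longrightarrow> l < n \<Longrightarrow> (\<lambda>h. Y h $$ (k, l)) \<in> borel_measurable M"
    and e: "e > 0"
  obtains w where "\<And>h. contraction_mat n (w h)"
    "\<And>k l. (\<lambda>h. w h $$ (k, l)) \<in> borel_measurable M"
    "\<And>h. h \<in> space M \<Longrightarrow> schatten_norm 1 (Y h) - e < Re (hs_inner n (w h) (Y h))"
proof -
  obtain V :: "nat \<Rightarrow> complex mat" where V: "\<And>j. contraction_mat n (V j)"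
    "\<And>Y e. Y \<in> carrier_mat n n \<Longrightarrow> e > 0 \<Longrightarrow> \<exists>j. schatten_norm 1 Y - e < Re (hs_inner n (V j) Y)"
    by (rule countable_contractions[of n]) blast
  define J where "J h = (LEAST j. schatten_norm 1 (Y h) - e < Re (hs_inner n (V j) (Y h)))" for h
  have [measurable]: "(\<lambda>h. schatten_norm 1 (Y h)) \<in> borel_measurable M"
    by (rule borel_measurable_schatten_norm_1[OF Yc Ym])
  have [measurable]: "(\<lambda>h. hs_inner n (V j) (Y h)) \<in> borel_measurable M" for j
    by (rule borel_measurable_hs_inner[OF Ym])
  have J: "J \<in> measurable M (count_space UNIV)"
    unfolding J_def by (intro measurable_Least) measurable
  show thesis
  proof (rule that[of "\<lambda>h. V (J h)"])
    show "(\<lambda>h. V (J h) $$ (k, l)) \<in> borel_measurable M" for k l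
      using measurable_compose[OF J, of "\<lambda>j. V j $$ (k, l)" borel] by simp
    show "schatten_norm 1 (Y h) - e < Re (hs_inner n (V (J h)) (Y h))" if "h \<in> space M" for h
      using LeastI_ex[OF V(2)[OF Yc[OF that] e]] by (simp add: J_def)
  qed (rule V(1))
qed

section \<open>Supports and CQ operators\<close>

text \<open>The columns of a Hermitian \<rho> are orthogonal to its kernel and so lie in its
  support. By hypothesis their components are then orthogonal to the kernel of \<sigma>, in
  particular to each eigenvector with \<open>s r = 0\<close>, and the projection removes
  nothing.\<close>

lemma support_projection:
  assumes \<rho>: "\<rho> \<in> carrier_mat (dA * dE) (dA * dE)" "mat_adjoint \<rho> = \<rho>" and V: "unitary_mat dE V"
    and supp: "supp (dA * dE) \<rho> \<subseteq> tensor_space dA dE (supp dE (spectral_mat dE V s))"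
  shows "tensor_mat (1\<^sub>m dA) (spectral_mat dE V (\<lambda>k. if s k = 0 then 0 else 1)) * \<rho> = \<rho>"
proof (rule eq_mat_bipartiteI)
  let ?Pr = "spectral_mat dE V (\<lambda>k. if s k = 0 then 0 else 1)"
  note V' = unitary_matD[OF V]
  note Pr = spectral_mat_carrier[OF V, of "\<lambda>k. if s k = 0 then 0 else 1"]
  show "tensor_mat (1\<^sub>m dA) ?Pr * \<rho> \<in> carrier_mat (dA * dE) (dA * dE)"
    using tensor_one_carrier[OF Pr] \<rho>(1) by (rule mult_carrier_mat)
  fix i j k l assume b: "i < dA" "j < dA" "k < dE" "l < dE"
  define q where "q = j * dE + l"
  have q: "q < dA * dE" using b by (simp add: q_def bipartite_index)
  define u where "u = Matrix.vec dE (\<lambda>k. \<rho> $$ (i * dE + k, q))"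
  have "col \<rho> q \<in> supp (dA * dE) \<rho>"
  proof -
    have "col \<rho> q \<bullet>c w = 0" if w: "w \<in> mat_kernel \<rho>" for w
    proof -
      have wc: "w \<in> carrier_vec (dA * dE)" and w0: "\<rho> *\<^sub>v w = 0\<^sub>v (dA * dE)"
        using w \<rho>(1) by (auto simp: mat_kernel_def)
      have "col \<rho> q \<bullet>c w = (\<Sum>r<dA * dE. \<rho> $$ (r, q) * cnj (w $ r))"
        using wc q \<rho>(1) by (auto simp: scalar_prod_def lessThan_atLeast0)
      also have "\<dots> = cnj (\<Sum>r<dA * dE. \<rho> $$ (q, r) * w $ r)"
        using mat_adjoint_index[OF \<rho>(1) _ q, unfolded \<rho>(2)] by simp
      also have "\<dots> = 0"
        using index_mult_mat_vec_sum[OF \<rho>(1) wc q] w0 q by simp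
      finally show ?thesis .
    qed
    moreover have "col \<rho> q \<in> carrier_vec (dA * dE)"
      using \<rho>(1) by (intro carrier_vecI) simp
    ultimately show ?thesis by (simp add: supp_def)
  qed
  then have "Matrix.vec dE (\<lambda>k. col \<rho> q $ (i * dE + k)) \<in> supp dE (spectral_mat dE V s)"
    using supp b(1) by (auto simp: tensor_space_def)
  moreover have "Matrix.vec dE (\<lambda>k. col \<rho> q $ (i * dE + k)) = u"
    using b(1) \<rho>(1) q by (intro eq_vecI) (auto simp: u_def bipartite_index)
  ultimately have "u \<in> supp dE (spectral_mat dE V s)" by simp
  then have u: "u \<bullet>c w = 0" if "w \<in> mat_kernel (spectral_mat dE V s)" for w
    using that by (simp add: supp_def)
  have 0: "(\<Sum>l<dE. cnj (V $$ (l, r)) * u $ l) = 0" if r: "r < dE" "s r = 0" for r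
  proof -
    have "spectral_mat dE V s *\<^sub>v col V r = 0\<^sub>v dE"
    proof (rule eq_vecI)
      fix p assume "p < dim_vec (0\<^sub>v dE)"
      then have p: "p < dE" by simp
      have VV: "(\<Sum>l<dE. cnj (V $$ (l, t)) * V $$ (l, r)) = (if t = r then 1 else 0)" if "t < dE" for t
      proof -
        have "(mat_adjoint V * V) $$ (t, r) = (\<Sum>l<dE. cnj (V $$ (l, t)) * V $$ (l, r))"
          using that r by (subst index_mult_sum[OF mat_adjoint_carrier[OF V'(1)] V'(1)])
            (auto simp: mat_adjoint_index[OF V'(1)])
        then show ?thesis using that r by (simp add: V'(3))
      qed
      have "(spectral_mat dE V s *\<^sub>v col V r) $ p
         = (\<Sum>l<dE. (\<Sum>t<dE. s t * (V $$ (p, t) * cnj (V $$ (l, t)))) * V $$ (l, r))"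
        using V'(1) r p
        by (subst index_mult_mat_vec_sum[OF spectral_mat_carrier[OF V] _ p]) (auto simp: spectral_mat_index[OF V p])
      also have "\<dots> = (\<Sum>t<dE. s t * V $$ (p, t) * (\<Sum>l<dE. cnj (V $$ (l, t)) * V $$ (l, r)))"
        unfolding sum_distrib_left sum_distrib_right by (subst sum.swap) (simp add: mult_ac)
      also have "\<dots> = (\<Sum>t<dE. if t = r then s r * V $$ (p, r) else 0)"
        by (intro sum.cong) (auto simp: VV)
      also have "\<dots> = 0" using r by simp
      finally show "(spectral_mat dE V s *\<^sub>v col V r) $ p = 0\<^sub>v dE $ p" using p by simp
    qed (use carrier_matD(1)[OF spectral_mat_carrier[OF V]] in auto)
    then have "col V r \<in> mat_kernel (spectral_mat dE V s)"
      using V'(1) carrier_matD[OF spectral_mat_carrier[OF V]] by (auto simp: mat_kernel_def)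
    from u[OF this] show ?thesis
      using V'(1) r by (auto simp: u_def scalar_prod_def lessThan_atLeast0 mult.commute)
  qed
  have "(tensor_mat (1\<^sub>m dA) ?Pr * \<rho>) $$ (i * dE + k, q) = (\<Sum>l<dE. ?Pr $$ (k, l) * u $ l)"
    using tensor_one_mult_left[OF Pr \<rho>(1) b(1,3) q] by (simp add: u_def)
  also have "\<dots> = (\<Sum>l<dE. \<Sum>r<dE. (if s r = 0 then 0 else 1) * V $$ (k, r) * (cnj (V $$ (l, r)) * u $ l))"
    using b by (intro sum.cong refl) (simp add: spectral_mat_index[OF V] sum_distrib_right sum_distrib_left mult_ac)
  also have "\<dots> = (\<Sum>r<dE. (if s r = 0 then 0 else 1) * V $$ (k, r) * (\<Sum>l<dE. cnj (V $$ (l, r)) * u $ l))"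
    by (subst sum.swap) (simp only: sum_distrib_left)
  also have "\<dots> = (\<Sum>r<dE. V $$ (k, r) * (\<Sum>l<dE. cnj (V $$ (l, r)) * u $ l))"
    using 0 by (intro sum.cong) auto
  also have "\<dots> = (\<Sum>l<dE. (\<Sum>r<dE. V $$ (k, r) * cnj (V $$ (l, r))) * u $ l)"
    unfolding sum_distrib_left sum_distrib_right by (subst sum.swap) (simp add: mult_ac)
  also have "\<dots> = (\<Sum>l<dE. if k = l then u $ k else 0)"
  proof (rule sum.cong[OF refl])
    fix l assume "l \<in> {..<dE}"
    then have "(\<Sum>r<dE. V $$ (k, r) * cnj (V $$ (l, r))) = (if k = l then 1 else 0)"
      using spectral_mat_index[OF V b(3), of l "\<lambda>_. 1", symmetric] b by (simp add: spectral_mat_one[OF V])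
    then show "(\<Sum>r<dE. V $$ (k, r) * cnj (V $$ (l, r))) * u $ l = (if k = l then u $ k else 0)"
      by simp
  qed
  also have "\<dots> = \<rho> $$ (i * dE + k, q)" using b by (simp add: u_def)
  finally show "(tensor_mat (1\<^sub>m dA) ?Pr * \<rho>) $$ (i * dE + k, j * dE + l) = \<rho> $$ (i * dE + k, j * dE + l)"
    by (simp add: q_def)
qed (use \<rho> in auto)

section \<open>CQ operators as the commutant of a classical label\<close>

lemma cq_iff:
  "cq dA dE X \<longleftrightarrow> X \<in> carrier_mat (dA * dE) (dA * dE) \<and>
     (\<forall>p<dA * dE. \<forall>q<dA * dE. p div dE \<noteq> q div dE \<longrightarrow> X $$ (p, q) = 0)"
proof
  assume "cq dA dE X"
  then obtain Y where Y: "\<And>x. x < dA \<Longrightarrow> Y x \<in> carrier_mat dE dE"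
    and X: "X = mat_sum (dA * dE) (\<lambda>x. tensor_mat (ket_proj dA x) (Y x)) {..<dA}"
    by (auto simp: cq_def)
  have "tensor_mat (ket_proj dA x) (Y x) $$ (p, q) = 0"
    if "x < dA" "p < dA * dE" "q < dA * dE" "p div dE \<noteq> q div dE" for x p q
    using Y[OF that(1)] that bipartite_div_mod[OF that(2)] bipartite_div_mod[OF that(3)]
    by (auto simp: tensor_mat_def ket_proj_def)
  then show "X \<in> carrier_mat (dA * dE) (dA * dE) \<and>
     (\<forall>p<dA * dE. \<forall>q<dA * dE. p div dE \<noteq> q div dE \<longrightarrow> X $$ (p, q) = 0)"
    by (auto simp: X mat_sum_def)
next
  assume X: "X \<in> carrier_mat (dA * dE) (dA * dE) \<and>
     (\<forall>p<dA * dE. \<forall>q<dA * dE. p div dE \<noteq> q div dE \<longrightarrow> X $$ (p, q) = 0)"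
  define Y where "Y x = Matrix.mat dE dE (\<lambda>(k, l). X $$ (x * dE + k, x * dE + l))" for x
  have "X = mat_sum (dA * dE) (\<lambda>x. tensor_mat (ket_proj dA x) (Y x)) {..<dA}"
  proof (rule eq_mat_bipartiteI)
    fix i j k l assume b: "i < dA" "j < dA" "k < dE" "l < dE"
    note b' = bipartite_index[OF b(1,3)] bipartite_index[OF b(2,4)]
    have "tensor_mat (ket_proj dA x) (Y x) $$ (i * dE + k, j * dE + l)
        = (if x = i then (if i = j then X $$ (i * dE + k, i * dE + l) else 0) else 0)" if "x < dA" for x
      using that b b' by (auto simp: tensor_mat_def ket_proj_def Y_def)
    then have "mat_sum (dA * dE) (\<lambda>x. tensor_mat (ket_proj dA x) (Y x)) {..<dA} $$ (i * dE + k, j * dE + l)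
        = (\<Sum>x<dA. if x = i then (if i = j then X $$ (i * dE + k, i * dE + l) else 0) else 0)"
      using b b' by (simp add: mat_sum_def)
    then show "X $$ (i * dE + k, j * dE + l)
        = mat_sum (dA * dE) (\<lambda>x. tensor_mat (ket_proj dA x) (Y x)) {..<dA} $$ (i * dE + k, j * dE + l)"
      using X b b' by auto
  qed (use X in \<open>auto simp: mat_sum_def\<close>)
  then show "cq dA dE X" unfolding cq_def by (intro exI[of _ Y]) (auto simp: Y_def)
qed

text \<open>An observable on \<open>A\<close> with a different eigenvalue for each basis state.
  Commuting with it is the same as being block diagonal, so closure of CQ operators under products
  and functional calculus becomes a statement about a commutant.\<close>

definition classical_label :: "nat \<Rightarrow> nat \<Rightarrow> complex mat" where
  "classical_label dA dE = mat_diag (dA * dE) (\<lambda>p. of_nat (p div dE))"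

lemma classical_label_carrier [simp]: "classical_label dA dE \<in> carrier_mat (dA * dE) (dA * dE)"
  by (simp add: classical_label_def)

lemma cq_iff_commute:
  "cq dA dE X \<longleftrightarrow> X \<in> carrier_mat (dA * dE) (dA * dE) \<and> X * classical_label dA dE = classical_label dA dE * X"
proof (cases "X \<in> carrier_mat (dA * dE) (dA * dE)")
  case True
  have "X * classical_label dA dE = classical_label dA dE * X \<longleftrightarrow>
    (\<forall>p<dA * dE. \<forall>q<dA * dE. X $$ (p, q) * of_nat (q div dE) = of_nat (p div dE) * X $$ (p, q))"
    using True unfolding classical_label_def
    by (auto simp: mat_eq_iff mat_diag_mult_left[OF True] mat_diag_mult_right[OF True])
  also have "\<dots> \<longleftrightarrow> (\<forall>p<dA * dE. \<forall>q<dA * dE. p div dE \<noteq> q div dE \<longrightarrow> X $$ (p, q) = 0)"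
  proof -
    have "z * of_nat b = of_nat a * z \<longleftrightarrow> (a \<noteq> b \<longrightarrow> z = 0)" for a b :: nat and z :: complex
      by (auto simp: mult.commute[of "of_nat _"])
    then show ?thesis by simp
  qed
  finally show ?thesis using True by (simp add: cq_iff)
qed (simp add: cq_iff)

lemma cq_mult:
  assumes X: "cq dA dE X" and Y: "cq dA dE Y"
  shows "cq dA dE (X * Y)"
proof -
  let ?n = "dA * dE" and ?D = "classical_label dA dE"
  have [simp]: "X \<in> carrier_mat ?n ?n" "Y \<in> carrier_mat ?n ?n"
    and XD: "X * ?D = ?D * X" and YD: "Y * ?D = ?D * Y"
    using X Y by (auto simp: cq_iff_commute)
  have "X * Y * ?D = X * (Y * ?D)" by (rule assoc_mult_mat[of _ ?n ?n _ ?n _ ?n]) auto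
  also have "\<dots> = (X * ?D) * Y" unfolding YD by (rule assoc_mult_mat[of _ ?n ?n _ ?n _ ?n, symmetric]) auto
  also have "\<dots> = ?D * (X * Y)" unfolding XD by (rule assoc_mult_mat[of _ ?n ?n _ ?n _ ?n]) auto
  finally show ?thesis by (simp add: cq_iff_commute mult_carrier_mat[of _ ?n ?n])
qed

lemma cq_tensor_one: "S \<in> carrier_mat dE dE \<Longrightarrow> cq dA dE (tensor_mat (1\<^sub>m dA) S)"
  by (simp add: cq_iff tensor_one_index)

text \<open>In the eigenbasis, commuting with the given matrix forces the entries of
  \<open>D\<close> between different eigenvalues to vanish. Since \<open>g\<close> takes equal
  values at equal eigenvalues, these are the only entries that could obstruct commuting with the new
  matrix.\<close>

lemma commute_spectral_function:
  assumes U: "unitary_mat n U" and D: "D \<in> carrier_mat n n"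
    and comm: "spectral_mat n U (\<lambda>i. complex_of_real (d i)) * D = D * spectral_mat n U (\<lambda>i. complex_of_real (d i))"
  shows "spectral_mat n U (\<lambda>i. g (d i)) * D = D * spectral_mat n U (\<lambda>i. g (d i))"
proof -
  note U' = unitary_matD[OF U]
  note [simp] = U'(1) D mult_carrier_mat[of _ n n _ n]
  define E where "E = mat_adjoint U * D * U"
  have [simp]: "E \<in> carrier_mat n n" by (simp add: E_def)
  have D': "D = U * (E * mat_adjoint U)"
  proof -
    have "U * (E * mat_adjoint U) = U * (mat_adjoint U * (D * (U * mat_adjoint U)))"
      by (simp add: E_def assoc_mult_mat[of _ n n _ n _ n])
    also have "\<dots> = D" using unitary_cancel(2)[OF U D] by (simp add: U'(2) right_mult_one_mat[of _ n n])
    finally show ?thesis ..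
  qed
  have L: "spectral_mat n U c * D = U * (mat_diag n c * E) * mat_adjoint U" for c
  proof -
    have "spectral_mat n U c * D = U * (mat_diag n c * (mat_adjoint U * (U * (E * mat_adjoint U))))"
      unfolding spectral_mat_def by (subst D') (simp add: assoc_mult_mat[of _ n n _ n _ n])
    also have "mat_adjoint U * (U * (E * mat_adjoint U)) = E * mat_adjoint U"
      by (rule unitary_cancel[OF U]) simp
    finally show ?thesis by (simp add: assoc_mult_mat[of _ n n _ n _ n])
  qed
  have R: "D * spectral_mat n U c = U * (E * mat_diag n c) * mat_adjoint U" for c
  proof -
    have "D * spectral_mat n U c = U * (E * (mat_adjoint U * (U * (mat_diag n c * mat_adjoint U))))"
      unfolding spectral_mat_def by (subst D') (simp add: assoc_mult_mat[of _ n n _ n _ n])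
    also have "mat_adjoint U * (U * (mat_diag n c * mat_adjoint U)) = mat_diag n c * mat_adjoint U"
      by (rule unitary_cancel[OF U]) simp
    finally show ?thesis by (simp add: assoc_mult_mat[of _ n n _ n _ n])
  qed
  have inj: "A = B" if "U * A * mat_adjoint U = U * B * mat_adjoint U" "A \<in> carrier_mat n n" "B \<in> carrier_mat n n" for A B
  proof -
    have "mat_adjoint U * (U * A * mat_adjoint U) * U = A" if "A \<in> carrier_mat n n" for A
    proof -
      have "mat_adjoint U * (U * A * mat_adjoint U) * U = mat_adjoint U * (U * (A * (mat_adjoint U * U)))"
        using that by (simp add: assoc_mult_mat[of _ n n _ n _ n])
      also have "\<dots> = A" using that unitary_cancel(1)[OF U that] by (simp add: U'(3) right_mult_one_mat[of _ n n])
      finally show ?thesis .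
    qed
    then show ?thesis using that by metis
  qed
  have "mat_diag n (\<lambda>i. complex_of_real (d i)) * E = E * mat_diag n (\<lambda>i. complex_of_real (d i))"
    using comm unfolding L R by (rule inj) auto
  then have "\<forall>i<n. \<forall>j<n. complex_of_real (d i) * E $$ (i, j) = E $$ (i, j) * complex_of_real (d j)"
    by (simp add: mat_diag_mult_left[of _ n n] mat_diag_mult_right[of _ n n] mat_eq_iff)
  then have "d i = d j \<or> E $$ (i, j) = 0" if "i < n" "j < n" for i j
    using that by (auto simp: mult.commute[of "complex_of_real _"])
  then have "\<forall>i<n. \<forall>j<n. g (d i) * E $$ (i, j) = E $$ (i, j) * g (d j)"
    by (metis mult.commute mult_zero_right)
  then have "mat_diag n (\<lambda>i. g (d i)) * E = E * mat_diag n (\<lambda>i. g (d i))"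
    by (simp add: mat_diag_mult_left[of _ n n] mat_diag_mult_right[of _ n n] mat_eq_iff)
  then show ?thesis unfolding L R by simp
qed

lemma cq_spectral_function:
  assumes U: "unitary_mat (dA * dE) U" and "cq dA dE (spectral_mat (dA * dE) U (\<lambda>i. complex_of_real (d i)))"
  shows "cq dA dE (spectral_mat (dA * dE) U (\<lambda>i. g (d i)))"
  using assms commute_spectral_function[OF U classical_label_carrier] by (simp add: cq_iff_commute)

section \<open>The decoupling bound\<close>

lemma superop_diff:
  assumes \<Phi>: "superop dA dC \<Phi>" and \<Psi>: "superop dA dC \<Psi>"
  shows "superop dA dC (\<lambda>\<theta>. \<Phi> \<theta> - \<Psi> \<theta>)"
  unfolding superop_def
proof (intro conjI ballI allI)
  fix X Y :: "complex mat" and z :: complex assume X: "X \<in> carrier_mat dA dA"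
  have c: "\<Phi> X \<in> carrier_mat dC dC" "\<Psi> X \<in> carrier_mat dC dC"
    using \<Phi> \<Psi> X by (auto simp: superop_def)
  then show "\<Phi> X - \<Psi> X \<in> carrier_mat dC dC" by auto
  have "\<Phi> (z \<cdot>\<^sub>m X) = z \<cdot>\<^sub>m \<Phi> X" "\<Psi> (z \<cdot>\<^sub>m X) = z \<cdot>\<^sub>m \<Psi> X"
    using \<Phi> \<Psi> X by (auto simp: superop_def)
  then show "\<Phi> (z \<cdot>\<^sub>m X) - \<Psi> (z \<cdot>\<^sub>m X) = z \<cdot>\<^sub>m (\<Phi> X - \<Psi> X)"
    using c by (auto intro!: eq_matI simp: right_diff_distrib)
  assume Y: "Y \<in> carrier_mat dA dA"
  have d: "\<Phi> Y \<in> carrier_mat dC dC" "\<Psi> Y \<in> carrier_mat dC dC"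
    using \<Phi> \<Psi> Y by (auto simp: superop_def)
  have "\<Phi> (X + Y) = \<Phi> X + \<Phi> Y" "\<Psi> (X + Y) = \<Psi> X + \<Psi> Y"
    using \<Phi> \<Psi> X Y by (auto simp: superop_def)
  then show "\<Phi> (X + Y) - \<Psi> (X + Y) = \<Phi> X - \<Psi> X + (\<Phi> Y - \<Psi> Y)"
    using c d by (auto intro!: eq_matI)
qed

lemma channel_superop: "channel dA dC \<Phi> \<Longrightarrow> superop dA dC \<Phi>"
  by (simp add: channel_def)

lemma deviation_eq_diff:
  assumes "dC > 0"
  shows "deviation dA dC dE \<Phi> X = superop_ext dA dC dE \<Phi> X - superop_ext dA dC dE (perfectly_randomizing dC) X"
proof (rule eq_mat_bipartiteI)
  fix a b k l assume b: "a < dC" "b < dC" "k < dE" "l < dE"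
  show "deviation dA dC dE \<Phi> X $$ (a * dE + k, b * dE + l)
      = (superop_ext dA dC dE \<Phi> X - superop_ext dA dC dE (perfectly_randomizing dC) X) $$ (a * dE + k, b * dE + l)"
    using b by (simp add: deviation_def superop_ext_index bipartite_index perfectly_randomizing_def)
qed (auto simp: deviation_def)

lemma superop_deviation:
  assumes "dC > 0" "channel dA dC \<Phi>"
  shows "superop dA dC (\<lambda>\<theta>. \<Phi> \<theta> - perfectly_randomizing dC \<theta>)"
  using assms by (intro superop_diff channel_superop channel_perfectly_randomizing)

lemma deviation_carrier [simp]: "deviation dA dC dE \<Phi> X \<in> carrier_mat (dC * dE) (dC * dE)"
  by (simp add: deviation_def)

lemma hs_inner_diff:
  assumes "A \<in> carrier_mat n n" "B \<in> carrier_mat n n"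
  shows "hs_inner n W (A - B) = hs_inner n W A - hs_inner n W B"
  using assms by (simp add: hs_inner_def right_diff_distrib sum_subtractf)

text \<open>The trivial estimate: both channels turn \<open>P\<close> into a positive operator of
  the same trace, and the triangle inequality gives the factor 2.\<close>

lemma hs_inner_deviation_le:
  assumes dC: "dC > 0" and \<Phi>: "channel dA dC \<Phi>" and P: "psd (dA * dE) P" and W: "contraction_mat (dC * dE) W"
  shows "cmod (hs_inner (dC * dE) W (deviation dA dC dE \<Phi> P)) \<le> 2 * Re (mat_trace P)"
proof -
  have Pc: "P \<in> carrier_mat (dA * dE) (dA * dE)" using P by (simp add: psd_def)
  have "cmod (hs_inner (dC * dE) W (superop_ext dA dC dE \<Psi> P)) \<le> Re (mat_trace P)" if "channel dA dC \<Psi>" for \<Psi>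
    using hs_inner_psd_le[OF W channel_ext_psd[OF that P]] by (simp add: channel_ext_trace[OF that Pc])
  from this[OF \<Phi>] this[OF channel_perfectly_randomizing[OF dC]] show ?thesis
    unfolding deviation_eq_diff[OF dC] hs_inner_diff[OF superop_ext_carrier superop_ext_carrier]
    by (intro order_trans[OF norm_triangle_ineq4]) simp
qed

section \<open>Linear combinations, 2-norms and positivity under conjugation\<close>

lemma sandwich_index:
  fixes A B Z :: "complex mat"
  assumes A: "A \<in> carrier_mat n n" and B: "B \<in> carrier_mat n n" and Z: "Z \<in> carrier_mat n n"
    and pq: "p < n" "q < n"
  shows "(A * Z * B) $$ (p, q) = (\<Sum>s<n. \<Sum>r<n. A $$ (p, r) * B $$ (s, q) * Z $$ (r, s))"
proof -
  have "(A * Z * B) $$ (p, q) = (\<Sum>s<n. (\<Sum>r<n. A $$ (p, r) * Z $$ (r, s)) * B $$ (s, q))"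
    using pq by (subst index_mult_sum[OF mult_carrier_mat[OF A Z] B])
      (auto simp: index_mult_sum[OF A Z] simp del: index_mult_mat(1))
  also have "\<dots> = (\<Sum>s<n. \<Sum>r<n. A $$ (p, r) * B $$ (s, q) * Z $$ (r, s))"
    unfolding sum_distrib_right by (intro sum.cong refl) (simp only: mult.assoc mult.commute[of "Z $$ _"])
  finally show ?thesis .
qed

lemma sandwich_sum:
  fixes A B :: "complex mat" and Z :: "'i \<Rightarrow> complex mat"
  assumes A: "A \<in> carrier_mat n n" and B: "B \<in> carrier_mat n n" and Z: "\<And>i. i \<in> I \<Longrightarrow> Z i \<in> carrier_mat n n"
  shows "A * Matrix.mat n n (\<lambda>(p, q). \<Sum>i\<in>I. c i * Z i $$ (p, q)) * B
       = Matrix.mat n n (\<lambda>(p, q). \<Sum>i\<in>I. c i * (A * Z i * B) $$ (p, q))"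
proof (rule eq_matI)
  fix p q assume "p < dim_row (Matrix.mat n n (\<lambda>(p, q). \<Sum>i\<in>I. c i * (A * Z i * B) $$ (p, q)))"
    "q < dim_col (Matrix.mat n n (\<lambda>(p, q). \<Sum>i\<in>I. c i * (A * Z i * B) $$ (p, q)))"
  then have pq: "p < n" "q < n" by auto
  have "(A * Matrix.mat n n (\<lambda>(p, q). \<Sum>i\<in>I. c i * Z i $$ (p, q)) * B) $$ (p, q)
     = (\<Sum>s<n. \<Sum>r<n. \<Sum>i\<in>I. c i * (A $$ (p, r) * B $$ (s, q) * Z i $$ (r, s)))"
    by (subst sandwich_index[OF A B _ pq]) (auto simp: sum_distrib_left mult_ac)
  also have "\<dots> = (\<Sum>i\<in>I. \<Sum>s<n. \<Sum>r<n. c i * (A $$ (p, r) * B $$ (s, q) * Z i $$ (r, s)))"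
    by (rule trans[OF sum.cong[OF refl sum.swap] sum.swap])
  also have "\<dots> = (\<Sum>i\<in>I. c i * (A * Z i * B) $$ (p, q))"
    by (intro sum.cong refl) (simp only: sandwich_index[OF A B Z pq] sum_distrib_left)
  finally show "(A * Matrix.mat n n (\<lambda>(p, q). \<Sum>i\<in>I. c i * Z i $$ (p, q)) * B) $$ (p, q)
     = Matrix.mat n n (\<lambda>(p, q). \<Sum>i\<in>I. c i * (A * Z i * B) $$ (p, q)) $$ (p, q)"
    using pq by simp
qed (use A B in auto)

lemma spectral_mat_eq_sum:
  assumes U: "unitary_mat m U"
  shows "spectral_mat m U c = Matrix.mat m m (\<lambda>(p, q). \<Sum>i<m. c i * spectral_mat m U (\<lambda>j. if j = i then 1 else 0) $$ (p, q))"
proof (rule eq_matI)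
  fix p q assume "p < dim_row (Matrix.mat m m (\<lambda>(p, q). \<Sum>i<m. c i * spectral_mat m U (\<lambda>j. if j = i then 1 else 0) $$ (p, q)))"
    "q < dim_col (Matrix.mat m m (\<lambda>(p, q). \<Sum>i<m. c i * spectral_mat m U (\<lambda>j. if j = i then 1 else 0) $$ (p, q)))"
  then have pq: "p < m" "q < m" by auto
  have "spectral_mat m U (\<lambda>j. if j = i then 1 else 0) $$ (p, q) = U $$ (p, i) * cnj (U $$ (q, i))" if "i < m" for i
  proof -
    have "spectral_mat m U (\<lambda>j. if j = i then 1 else 0) $$ (p, q)
       = (\<Sum>k<m. if k = i then U $$ (p, i) * cnj (U $$ (q, i)) else 0)"
      unfolding spectral_mat_index[OF U pq] by (intro sum.cong) auto
    then show ?thesis using that by simp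
  qed
  then show "spectral_mat m U c $$ (p, q) = Matrix.mat m m (\<lambda>(p, q). \<Sum>i<m. c i * spectral_mat m U (\<lambda>j. if j = i then 1 else 0) $$ (p, q)) $$ (p, q)"
    using pq by (simp add: spectral_mat_index[OF U pq])
qed (use carrier_matD[OF spectral_mat_carrier[OF U, of c]] in auto)

lemma hs_norm_unitary:
  assumes U: "unitary_mat n U" and Y: "Y \<in> carrier_mat n n"
  shows "hs_norm n (mat_adjoint U * Y * U) = hs_norm n Y"
proof -
  note U' = unitary_matD[OF U]
  note [simp] = U'(1) Y mult_carrier_mat[of _ n n _ n] assoc_mult_mat[of _ n n _ n _ n] mat_adjoint_mult[of _ n n _ n]
  have "mat_adjoint (mat_adjoint U * Y * U) * (mat_adjoint U * Y * U)
      = mat_adjoint U * (mat_adjoint Y * (U * (mat_adjoint U * (Y * U))))" by simp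
  also have "U * (mat_adjoint U * (Y * U)) = Y * U"
    by (rule unitary_cancel[OF U]) simp
  finally have "mat_trace (mat_adjoint (mat_adjoint U * Y * U) * (mat_adjoint U * Y * U))
      = mat_trace (mat_adjoint U * (mat_adjoint Y * Y * U))" by simp
  also have "\<dots> = mat_trace ((mat_adjoint Y * Y * U) * mat_adjoint U)"
    by (rule mat_trace_comm[of _ n n]) auto
  also have "\<dots> = mat_trace (mat_adjoint Y * Y)"
    by (simp add: U'(2) right_mult_one_mat[of _ n n])
  finally have "complex_of_real ((hs_norm n (mat_adjoint U * Y * U))\<^sup>2) = of_real ((hs_norm n Y)\<^sup>2)"
    by (subst (1 2) hs_norm_square) auto
  then have "(hs_norm n (mat_adjoint U * Y * U))\<^sup>2 = (hs_norm n Y)\<^sup>2" by (simp only: of_real_eq_iff)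
  then show ?thesis by (simp add: power2_eq_iff_nonneg)
qed

lemma hs_norm_spectral:
  assumes U: "unitary_mat m U"
  shows "hs_norm m (spectral_mat m U c) = sqrt (\<Sum>i<m. (cmod (c i))\<^sup>2)"
proof -
  have "complex_of_real ((hs_norm m (spectral_mat m U c))\<^sup>2) = (\<Sum>i<m. cnj (c i) * c i)"
    by (subst hs_norm_square) (simp_all add: U spectral_mat_adjoint[OF U] spectral_mat_mult[OF U] mat_trace_spectral[OF U])
  also have "\<dots> = of_real (\<Sum>i<m. (cmod (c i))\<^sup>2)"
    by (simp add: complex_norm_square mult.commute del: of_real_power)
  finally have "(hs_norm m (spectral_mat m U c))\<^sup>2 = (\<Sum>i<m. (cmod (c i))\<^sup>2)" by (simp only: of_real_eq_iff)
  then show ?thesis by (metis hs_norm_nonneg real_sqrt_unique)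
qed

text \<open>With a square root \<open>B\<close> of \<open>X\<close> the sandwich becomes
  \<open>(B T)* (B T)\<close>.\<close>

lemma psd_sandwich:
  assumes X: "psd n X" and T: "T \<in> carrier_mat n n"
  shows "psd n (mat_adjoint T * X * T)"
proof -
  obtain U d where U: "unitary_mat n U" and X': "X = spectral_mat n U (\<lambda>i. complex_of_real (d i))"
    and d: "\<And>i. i < n \<Longrightarrow> d i \<ge> 0"
    using psd_mat_fun_spectral[OF X] by metis
  define B where "B = spectral_mat n U (\<lambda>i. complex_of_real (sqrt (d i)))"
  have B: "B \<in> carrier_mat n n" by (simp add: B_def U)
  have "mat_adjoint B * B = X"
    unfolding B_def X' spectral_mat_adjoint[OF U] spectral_mat_mult[OF U]
    by (rule spectral_mat_cong) (use d in \<open>simp flip: of_real_mult\<close>)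
  then have "mat_adjoint T * X * T = mat_adjoint (B * T) * (B * T)"
    using B T by (auto simp: mat_adjoint_mult[of _ n n _ n] assoc_mult_mat[of _ n n _ n _ n] mult_carrier_mat[of _ n n _ n])
  then show ?thesis using psd_adjoint_mult[OF mult_carrier_mat[OF B T]] by simp
qed

text \<open>With the eigenbasis fixed, the deviation is linear in the eigenvalues; the later
  dependence on \<open>z\<close> therefore sits in scalar coefficients only.\<close>

lemma deviation_spectral:
  assumes dC: "dC > 0" and \<Phi>: "channel dA dC \<Phi>" and U: "unitary_mat (dA * dE) U"
  shows "deviation dA dC dE \<Phi> (spectral_mat (dA * dE) U c)
     = Matrix.mat (dC * dE) (dC * dE) (\<lambda>(p, q). \<Sum>i<dA * dE. c i *
         deviation dA dC dE \<Phi> (spectral_mat (dA * dE) U (\<lambda>j. if j = i then 1 else 0)) $$ (p, q))"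
proof (rule eq_mat_bipartiteI)
  fix i j k l assume b: "i < dC" "j < dC" "k < dE" "l < dE"
  note b' = bipartite_index(1)[OF b(1,3)] bipartite_index(1)[OF b(2,4)]
  show "deviation dA dC dE \<Phi> (spectral_mat (dA * dE) U c) $$ (i * dE + k, j * dE + l)
     = Matrix.mat (dC * dE) (dC * dE) (\<lambda>(p, q). \<Sum>i<dA * dE. c i *
         deviation dA dC dE \<Phi> (spectral_mat (dA * dE) U (\<lambda>j. if j = i then 1 else 0)) $$ (p, q)) $$ (i * dE + k, j * dE + l)"
    unfolding deviation_def
    by (subst spectral_mat_eq_sum[OF U], subst superop_ext_sum[OF superop_deviation[OF dC \<Phi>]]) (use b' in auto)
qed auto

lemma borel_measurable_deviation:
  assumes R: "channel_family dA dC M R" and p: "p < dC * dE" and q: "q < dC * dE"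
  shows "(\<lambda>h. deviation dA dC dE (R h) X $$ (p, q)) \<in> borel_measurable M"
proof -
  note pq = bipartite_div_mod[OF p] bipartite_div_mod[OF q]
  have "deviation dA dC dE (R h) X $$ (p, q) = R h (E_block dA dE X (p mod dE) (q mod dE)) $$ (p div dE, q div dE)
      - perfectly_randomizing dC (E_block dA dE X (p mod dE) (q mod dE)) $$ (p div dE, q div dE)" for h
    using p q pq by (simp add: deviation_def superop_ext_def perfectly_randomizing_def)
  moreover have "(\<lambda>h. R h (E_block dA dE X (p mod dE) (q mod dE)) $$ (p div dE, q div dE)) \<in> borel_measurable M"
    using R pq by (simp add: channel_family_def)
  ultimately show ?thesis by simp
qed

lemma borel_measurable_sandwich:
  fixes A B :: "complex mat" and Z :: "'h \<Rightarrow> complex mat"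
  assumes A: "A \<in> carrier_mat n n" and B: "B \<in> carrier_mat n n" and Z: "\<And>h. h \<in> space M \<Longrightarrow> Z h \<in> carrier_mat n n"
    and m: "\<And>p q. p < n \<Longrightarrow> q < n \<Longrightarrow> (\<lambda>h. Z h $$ (p, q)) \<in> borel_measurable M" and pq: "p < n" "q < n"
  shows "(\<lambda>h. (A * Z h * B) $$ (p, q)) \<in> borel_measurable M"
proof -
  have eq: "(A * Z h * B) $$ (p, q) = (\<Sum>s<n. \<Sum>r<n. A $$ (p, r) * B $$ (s, q) * Z h $$ (r, s))" if "h \<in> space M" for h
    by (rule sandwich_index[OF A B Z[OF that] pq])
  have meas: "(\<lambda>h. \<Sum>s<n. \<Sum>r<n. A $$ (p, r) * B $$ (s, q) * Z h $$ (r, s)) \<in> borel_measurable M"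
    using m by (intro borel_measurable_sum borel_measurable_times borel_measurable_const) auto
  show ?thesis by (rule measurable_cong[THEN iffD2, OF eq meas])
qed

text \<open>The hypothesis \<open>rnd\<close> merges the two cases of the theorem: it concerns all
  operators \<open>Y\<close> in general, but only CQ operators when \<rho> is CQ. Positivity of
  \<open>lam\<close> is what the three lines theorem asks of its boundary constants.\<close>

lemma decoupling_bound_pos:
  fixes M :: "'h measure"
  assumes \<alpha>: "1 < \<alpha>" "\<alpha> \<le> 2"
    and \<rho>: "density_op (dA * dE) \<rho>" and \<sigma>: "density_op dE \<sigma>"
    and supp: "supp (dA * dE) \<rho> \<subseteq> tensor_space dA dE (supp dE \<sigma>)"
    and R: "channel_family dA dC M R" and lam: "lam > 0"
    and rnd: "\<And>Y. Y \<in> carrier_mat (dA * dE) (dA * dE) \<Longrightarrow> (cq dA dE \<rho> \<Longrightarrow> cq dA dE Y) \<Longrightarrow>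
      (\<integral>h. schatten_norm 2 (deviation dA dC dE (R h) Y) \<partial>M) \<le> lam * schatten_norm 2 Y"
  shows "(\<integral>h. schatten_norm 1 (deviation dA dC dE (R h) \<rho>) \<partial>M)
     \<le> 2 powr (2 / \<alpha> - 1) * 2 powr ((\<alpha> - 1) / \<alpha> * (log 2 (real dC) - sandwiched_entropy dA \<alpha> \<rho> \<sigma> + 2 * log 2 lam))"
proof -
  define m n where "m = dA * dE" and "n = dC * dE"
  \<comment> \<open>The solution of \<open>\<alpha> * (1 - t / 2) = 1\<close>; with it the exponent
    of \<sigma> in the sandwiched entropy is exactly \<open>- t / 4\<close>.\<close>
  define t where "t = 2 * (\<alpha> - 1) / \<alpha>"
  have t: "0 < t" "t \<le> 1" using \<alpha> by (auto simp: t_def field_simps)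
  have at: "\<alpha> * (1 - t / 2) = 1" "(1 - \<alpha>) / (2 * \<alpha>) = - (t / 4)"
    using \<alpha> by (auto simp: t_def field_simps)
  have \<rho>psd: "psd m \<rho>" and \<rho>tr: "mat_trace \<rho> = 1" and \<rho>c: "\<rho> \<in> carrier_mat m m"
    and \<sigma>psd: "psd dE \<sigma>" and \<sigma>tr: "mat_trace \<sigma> = 1"
    using \<rho> \<sigma> by (auto simp: density_op_def psd_def m_def)
  note \<rho>h = psd_hermitian[OF \<rho>psd]
  interpret prob_space M using R by (simp add: channel_family_def)
  have chan: "channel dA dC (R h)" if "h \<in> space M" for h
    using R that by (simp add: channel_family_def)
  \<comment> \<open>An operator on a zero-dimensional \<open>C\<close> has trace 0, whereas channels
    keep the trace 1 of \<rho>; and a probability space has at least one \<open>h\<close>.\<close>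
  have dC: "dC > 0"
  proof (rule ccontr)
    assume "\<not> dC > 0"
    obtain h where h: "h \<in> space M" using not_empty by blast
    have "mat_trace (superop_ext dA dC dE (R h) \<rho>) = 1"
      using channel_ext_trace[OF chan[OF h]] \<rho>c \<rho>tr by (simp add: m_def)
    then show False using \<open>\<not> dC > 0\<close> by (simp add: mat_trace_def)
  qed
  note dev_le = hs_inner_deviation_le[OF dC chan, folded n_def]

  obtain V s where V: "unitary_mat dE V" and \<sigma>V: "\<sigma> = spectral_mat dE V (\<lambda>k. complex_of_real (s k))"
    and \<sigma>p: "mat_powr \<sigma> (- (t / 4)) = spectral_mat dE V (\<lambda>k. complex_of_real (s k powr (- (t / 4))))"
    and s0: "\<And>k. k < dE \<Longrightarrow> s k \<ge> 0"
    using psd_mat_fun_spectral[OF \<sigma>psd, of "\<lambda>x. x powr (- (t / 4))"] unfolding mat_powr_def by metis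
  have s1: "(\<Sum>k<dE. s k) = 1"
  proof -
    have "complex_of_real (\<Sum>k<dE. s k) = 1"
      using \<sigma>tr unfolding \<sigma>V mat_trace_spectral[OF V] by simp
    then show ?thesis by (simp only: of_real_eq_1_iff)
  qed
  define Sm Sp where "Sm = spectral_mat dE V (\<lambda>k. complex_of_real (s k powr (- (t / 4))))"
    and "Sp = spectral_mat dE V (\<lambda>k. complex_of_real (s k powr (t / 4)))"
  define Tm Tp where "Tm = tensor_mat (1\<^sub>m dA) Sm" and "Tp = tensor_mat (1\<^sub>m dA) Sp"
  have Sc: "Sm \<in> carrier_mat dE dE" "Sp \<in> carrier_mat dE dE" by (auto simp: Sm_def Sp_def V)
  have Tc: "Tm \<in> carrier_mat m m" "Tp \<in> carrier_mat m m" using Sc by (auto simp: Tm_def Tp_def m_def)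
  have Tmh: "mat_adjoint Tm = Tm"
    using Sc by (simp add: Tm_def tensor_one_adjoint[of _ dE] Sm_def spectral_mat_adjoint[OF V])
  \<comment> \<open>The projection onto the support of \<sigma>. As \<open>0 powr r = 0\<close> for
    every \<open>r\<close>, the powers \<open>t / 4\<close> and \<open>- t / 4\<close> multiply to
    it and not to the identity; the support hypothesis then says that it fixes \<rho>.\<close>
  define Pr where "Pr = tensor_mat (1\<^sub>m dA) (spectral_mat dE V (\<lambda>k. if complex_of_real (s k) = 0 then 0 else 1))"
  have Prc: "Pr \<in> carrier_mat m m" by (simp add: Pr_def m_def V)
  have Prh: "mat_adjoint Pr = Pr"
    unfolding Pr_def by (subst tensor_one_adjoint[of _ dE]) (auto simp: V spectral_mat_adjoint[OF V] if_distrib cong: if_cong)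
  have TT: "Tp * Tm = Pr" "Tm * Tp = Pr"
    unfolding Tp_def Tm_def Pr_def tensor_one_mult[OF Sc(2,1)] tensor_one_mult[OF Sc]
    unfolding Sp_def Sm_def spectral_mat_mult[OF V]
    by (intro arg_cong[of _ _ "tensor_mat _"] spectral_mat_cong, use s0 in \<open>force simp flip: of_real_mult powr_add\<close>)+
  have Pr\<rho>: "Pr * \<rho> = \<rho>"
    unfolding Pr_def
    by (rule support_projection[OF _ \<rho>h V]) (use \<rho>c supp in \<open>simp_all add: m_def flip: \<sigma>V\<close>)
  have \<rho>Pr: "\<rho> * Pr = \<rho>"
    using arg_cong[OF Pr\<rho>, of mat_adjoint] by (simp add: mat_adjoint_mult[OF Prc \<rho>c] Prh \<rho>h)

  define X where "X = Tm * \<rho> * Tm"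
  have Xpsd: "psd m X"
    using psd_sandwich[OF \<rho>psd Tc(1)] by (simp add: X_def Tmh)
  obtain U x where U: "unitary_mat m U" and XU: "X = spectral_mat m U (\<lambda>i. complex_of_real (x i))"
    and Xp: "mat_powr X \<alpha> = spectral_mat m U (\<lambda>i. complex_of_real (x i powr \<alpha>))"
    and x0: "\<And>i. i < m \<Longrightarrow> x i \<ge> 0"
    using psd_mat_fun_spectral[OF Xpsd, of "\<lambda>x. x powr \<alpha>"] unfolding mat_powr_def by metis
  have Xc: "X \<in> carrier_mat m m" by (simp add: XU U)
  note [simp] = mult_carrier_mat[of _ m m _ m] Tc \<rho>c Prc Xc
  have \<rho>X: "\<rho> = Tp * X * Tp"
  proof -
    have "Tp * X * Tp = (Tp * Tm) * \<rho> * (Tm * Tp)"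
      by (simp add: X_def assoc_mult_mat[of _ m m _ m _ m])
    then show ?thesis by (simp add: TT Pr\<rho> \<rho>Pr)
  qed
  define tau where "tau = (\<Sum>i<m. x i powr \<alpha>)"
  have H: "sandwiched_entropy dA \<alpha> \<rho> \<sigma> = 1 / (1 - \<alpha>) * log 2 tau"
  proof -
    have "Re (mat_trace (mat_powr X \<alpha>)) = tau"
      by (simp add: Xp mat_trace_spectral[OF U] tau_def)
    then show ?thesis
      unfolding sandwiched_entropy_def Let_def at(2) \<sigma>p Sm_def[symmetric] Tm_def[symmetric] X_def[symmetric] by simp
  qed
  \<comment> \<open>If \<open>tau\<close> were 0, all eigenvalues of \<open>X\<close> would vanish,
    and with \<open>X\<close> also \<open>\<rho> = Tp * X * Tp\<close>, contrary to its unit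
    trace.\<close>
  have tau: "tau > 0"
  proof (rule ccontr)
    assume "\<not> tau > 0"
    then have "tau = 0" using sum_nonneg[of "{..<m}" "\<lambda>i. x i powr \<alpha>"] by (simp add: tau_def)
    then have "x i = 0" if "i < m" for i
      using that by (auto simp: tau_def sum_nonneg_eq_0_iff)
    then have "X = spectral_mat m U (\<lambda>i. 0)" unfolding XU by (intro spectral_mat_cong) auto
    then have "X = 0\<^sub>m m m"
      using Xc by (intro eq_matI) (auto simp: spectral_mat_index[OF U])
    then have "\<rho> = 0\<^sub>m m m" using \<rho>X by (simp add: right_mult_zero_mat[of _ m m] left_mult_zero_mat[of _ m m])
    then show False using \<rho>tr by (simp add: mat_trace_def)
  qed

  define V' where "V' = tensor_mat (1\<^sub>m dC) V"
  have V': "unitary_mat n V'" unfolding V'_def n_def by (rule unitary_tensor_one[OF V])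
  note V'c = unitary_matD(1)[OF V']
  \<comment> \<open>The eigenvalues of \<open>1 \<otimes> \<sigma>\<close> on
    \<open>C \<otimes> E\<close>: each eigenvalue of \<sigma> occurs \<open>dC\<close> times, which
    is where \<open>|C|\<close> enters the bound.\<close>
  define s' where "s' p = s (p mod dE)" for p
  have s'0: "s' p \<ge> 0" if "p < n" for p
    using that bipartite_div_mod(2)[of p dC dE] s0 by (simp add: s'_def n_def)
  have s'1: "(\<Sum>p<n. s' p) = real dC"
    unfolding n_def sum_bipartite by (simp add: s'_def s1)
  \<comment> \<open>The rank-one eigenprojections of \<open>X\<close>. They are positive of trace 1,
    so the trivial estimate holds for each of them with constant 2.\<close>
  define P where "P i = spectral_mat m U (\<lambda>j. if j = i then 1 else 0)" for i
  have Ppsd: "psd m (P i)" and Ptr: "i < m \<Longrightarrow> mat_trace (P i) = 1" for i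
  proof -
    have "P i = spectral_mat m U (\<lambda>j. complex_of_real (if j = i then 1 else 0))"
      unfolding P_def by (rule spectral_mat_cong) auto
    then show "psd m (P i)" using psd_spectral[OF U, of "\<lambda>j. if j = i then 1 else 0"] by simp
    show "i < m \<Longrightarrow> mat_trace (P i) = 1" by (simp add: P_def mat_trace_spectral[OF U])
  qed
  define D where "D h Y = deviation dA dC dE (R h) Y" for h Y
  have Dc [simp]: "D h Y \<in> carrier_mat n n" for h Y by (simp add: D_def n_def)
  define N where "N h i = mat_adjoint V' * D h (P i) * V'" for h i
  have Nc: "N h i \<in> carrier_mat n n" for h i
    using V'c by (simp add: N_def mult_carrier_mat[of _ n n _ n])
  have DN: "mat_adjoint V' * D h (spectral_mat m U c) * V' = Matrix.mat n n (\<lambda>(k, l). \<Sum>i<m. c i * N h i $$ (k, l))"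
    if "h \<in> space M" for h c
  proof -
    have "D h (spectral_mat m U c) = Matrix.mat n n (\<lambda>(p, q). \<Sum>i<m. c i * D h (P i) $$ (p, q))"
      unfolding D_def P_def m_def n_def by (rule deviation_spectral[OF dC chan[OF that]]) (use U in \<open>simp add: m_def\<close>)
    then show ?thesis unfolding N_def using V'c by (simp add: sandwich_sum)
  qed
  have Dm: "(\<lambda>h. D h Y $$ (k, l)) \<in> borel_measurable M" if "k < n" "l < n" for Y k l
    unfolding D_def by (rule borel_measurable_deviation[OF R]) (use that in \<open>auto simp: n_def\<close>)
  define bound where "bound = (2 * tau) powr (1 - t) * (sqrt (real dC) * (lam * sqrt tau)) powr t"

  have main: "(\<integral>h. schatten_norm 1 (D h \<rho>) \<partial>M) \<le> bound + e" if e: "e > 0" for e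
  proof -
    \<comment> \<open>The contractions are adapted to \<rho>, that is, to the point
      \<open>t\<close>, and then stay the same for all \<open>z\<close>.\<close>
    obtain w where w: "\<And>h. contraction_mat n (w h)"
      "\<And>k l. (\<lambda>h. w h $$ (k, l)) \<in> borel_measurable M"
      "\<And>h. h \<in> space M \<Longrightarrow> schatten_norm 1 (D h \<rho>) - e < Re (hs_inner n (w h) (D h \<rho>))"
      by (rule measurable_near_optimal_contraction[of M "\<lambda>h. D h \<rho>" n e]) (use Dm e in auto)
    note wc = contraction_matD(1)[OF w(1)]
    define w' where "w' h = mat_adjoint V' * w h * V'" for h
    have w'contr: "contraction_mat n (w' h)" for h
      unfolding w'_def
      by (intro contraction_mat_mult contraction_mat_adjoint[OF contraction_mat_unitary] contraction_mat_unitary[OF V'] V' w)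
    have w'm: "(\<lambda>h. w' h $$ (k, l)) \<in> borel_measurable M" if "k < n" "l < n" for k l
      unfolding w'_def by (rule borel_measurable_sandwich[of _ n]) (use V'c wc w(2) that in auto)
    have hs_eq: "hs_inner n (w h) (D h \<rho>) = (\<Sum>k<n. \<Sum>l<n. cnj (w' h $$ (k, l)) *
        of_real (s' k powr (t / 4) * s' l powr (t / 4)) *
        (\<Sum>i<m. of_real (x i powr (\<alpha> * (1 - t / 2))) * N h i $$ (k, l)))" if h: "h \<in> space M" for h
    proof -
      define G where "G = mat_diag n (\<lambda>p. complex_of_real (s' p powr (t / 4)))"
      define E where "E = mat_adjoint V' * D h X * V'"
      have [simp]: "G \<in> carrier_mat n n" "V' \<in> carrier_mat n n" "w h \<in> carrier_mat n n" using V'c wc by (auto simp: G_def)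
      have Ec [simp]: "E \<in> carrier_mat n n" by (simp add: E_def mult_carrier_mat[of _ n n _ n])
      \<comment> \<open>The deviation acts on \<open>A\<close> only, so the powers of \<sigma> move
        outside, with the identity on \<open>A\<close> replaced by that on \<open>C\<close>.\<close>
      have "D h \<rho> = tensor_mat (1\<^sub>m dC) Sp * D h X * tensor_mat (1\<^sub>m dC) Sp"
        unfolding \<rho>X Tp_def D_def deviation_def
        by (rule superop_ext_sandwich[OF superop_deviation[OF dC chan[OF h]] Sc(2) Sc(2)]) (use Xc in \<open>simp add: m_def\<close>)
      also have "tensor_mat (1\<^sub>m dC) Sp = V' * G * mat_adjoint V'"
        by (simp only: Sp_def tensor_one_spectral[OF V]) (simp only: V'_def G_def s'_def n_def spectral_mat_def)
      finally have "D h \<rho> = V' * (G * E * G) * mat_adjoint V'"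
        by (simp add: E_def assoc_mult_mat[of _ n n _ n _ n] mult_carrier_mat[of _ n n _ n])
      then have "hs_inner n (w h) (D h \<rho>) = hs_inner n (w' h) (G * E * G)"
        unfolding w'_def by (simp add: hs_inner_sandwich mult_carrier_mat[of _ n n _ n])
      also have "\<dots> = (\<Sum>k<n. \<Sum>l<n. cnj (w' h $$ (k, l)) *
        of_real (s' k powr (t / 4) * s' l powr (t / 4)) * E $$ (k, l))"
        unfolding hs_inner_def
      proof (intro sum.cong refl)
        fix k l assume "k \<in> {..<n}" "l \<in> {..<n}"
        then have "(G * E * G) $$ (k, l) = of_real (s' k powr (t / 4)) * E $$ (k, l) * of_real (s' l powr (t / 4))"
          unfolding G_def by (simp add: mat_diag_mult_left[OF Ec] mat_diag_mult_right[of _ n n])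
        then show "cnj (w' h $$ (k, l)) * (G * E * G) $$ (k, l)
          = cnj (w' h $$ (k, l)) * of_real (s' k powr (t / 4) * s' l powr (t / 4)) * E $$ (k, l)"
          by (simp add: mult_ac)
      qed
      \<comment> \<open>The exponent is 1, so this only rewrites each eigenvalue as a power; it puts
        the sum into the form taken by the interpolated family at \<open>t\<close>.\<close>
      also have "E = Matrix.mat n n (\<lambda>(k, l). \<Sum>i<m. of_real (x i powr (\<alpha> * (1 - t / 2))) * N h i $$ (k, l))"
        unfolding E_def XU DN[OF h] at(1) using x0 by (intro eq_matI) auto
      finally show ?thesis by simp
    qed
    have le2: "cmod (hs_inner n W (D h \<rho>)) \<le> 2" if "h \<in> space M" "contraction_mat n W" for h W
      using dev_le[OF that(1), of dE \<rho> W] \<rho>psd that(2) \<rho>tr by (simp add: D_def m_def n_def)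
    have "cmod (\<integral>h. hs_inner n (w h) (D h \<rho>) \<partial>M) \<le> bound"
    proof -
      have "(\<integral>h. hs_inner n (w h) (D h \<rho>) \<partial>M) = (\<integral>h. (\<Sum>k<n. \<Sum>l<n. cnj (w' h $$ (k, l)) *
        of_real (s' k powr (t / 4) * s' l powr (t / 4)) *
        (\<Sum>i<m. of_real (x i powr (\<alpha> * (1 - t / 2))) * N h i $$ (k, l))) \<partial>M)"
        by (rule Bochner_Integration.integral_cong) (auto simp: hs_eq)
      also have "cmod \<dots> \<le> bound"
        unfolding bound_def
      proof (rule interpolated_expectation_bound[OF prob_space_axioms w'contr w'm])
        show "(\<lambda>h. N h i $$ (k, l)) \<in> borel_measurable M" if "k < n" "l < n" for i k l
          unfolding N_def by (rule borel_measurable_sandwich[of _ n]) (use V'c that Dm in auto)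
        show "cmod (hs_inner n W (N h i)) \<le> 2" if h: "h \<in> space M" "i < m" and W: "contraction_mat n W" for h i W
        proof -
          have "hs_inner n W (N h i) = hs_inner n (V' * W * mat_adjoint V') (D h (P i))"
            unfolding N_def using V'c contraction_matD(1)[OF W] by (simp add: hs_inner_sandwich)
          moreover have "contraction_mat n (V' * W * mat_adjoint V')"
            by (intro contraction_mat_mult contraction_mat_adjoint[OF contraction_mat_unitary] contraction_mat_unitary[OF V'] V' W)
          ultimately show ?thesis
            using dev_le[OF h(1), of dE "P i"] Ppsd[of i] Ptr[OF h(2)] by (simp add: D_def m_def n_def)
        qed
        \<comment> \<open>The sum is the deviation of \<open>g(X)\<close> in the eigenbasis of
          \<open>1 \<otimes> \<sigma>\<close>, and the 2-norm does not see the change of basis. If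
          \<rho> is CQ, then so are \<open>X\<close> and \<open>g(X)\<close>, hence
          \<open>rnd\<close> applies.\<close>
        show "(\<integral>h. hs_norm n (Matrix.mat n n (\<lambda>(k, l). \<Sum>i<m. g (x i) * N h i $$ (k, l))) \<partial>M)
           \<le> lam * sqrt (\<Sum>i<m. (cmod (g (x i)))\<^sup>2)" for g :: "real \<Rightarrow> complex"
        proof -
          define Y where "Y = spectral_mat m U (\<lambda>i. g (x i))"
          have Yc: "Y \<in> carrier_mat m m" by (simp add: Y_def U)
          have "hs_norm n (Matrix.mat n n (\<lambda>(k, l). \<Sum>i<m. g (x i) * N h i $$ (k, l)))
              = schatten_norm 2 (deviation dA dC dE (R h) Y)" if "h \<in> space M" for h
          proof -
            have "hs_norm n (Matrix.mat n n (\<lambda>(k, l). \<Sum>i<m. g (x i) * N h i $$ (k, l))) = hs_norm n (D h Y)"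
              unfolding DN[OF that, symmetric] Y_def by (rule hs_norm_unitary[OF V']) simp
            then show ?thesis
              using schatten_norm_2[OF Dc[of h Y]] by (simp add: D_def)
          qed
          then have "(\<integral>h. hs_norm n (Matrix.mat n n (\<lambda>(k, l). \<Sum>i<m. g (x i) * N h i $$ (k, l))) \<partial>M)
              = (\<integral>h. schatten_norm 2 (deviation dA dC dE (R h) Y) \<partial>M)"
            by (intro Bochner_Integration.integral_cong) auto
          also have "\<dots> \<le> lam * schatten_norm 2 Y"
          proof (rule rnd)
            show "Y \<in> carrier_mat (dA * dE) (dA * dE)" using Yc by (simp add: m_def)
            assume "cq dA dE \<rho>"
            then have "cq dA dE X"
              unfolding X_def Tm_def by (intro cq_mult cq_tensor_one Sc)
            then show "cq dA dE Y"
              using cq_spectral_function[of dA dE U x g] U by (simp add: Y_def XU m_def)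
          qed
          also have "schatten_norm 2 Y = sqrt (\<Sum>i<m. (cmod (g (x i)))\<^sup>2)"
            unfolding schatten_norm_2[OF Yc] unfolding Y_def by (rule hs_norm_spectral[OF U])
          finally show ?thesis .
        qed
        show "(\<Sum>k<n. s' k) \<le> real dC" by (simp add: s'1)
        show "tau = (\<Sum>i<m. x i powr \<alpha>)" by (rule tau_def)
      qed (use Nc s'0 x0 tau \<alpha> lam dC t in auto)
      finally show ?thesis .
    qed
    moreover have int1: "integrable M (\<lambda>h. schatten_norm 1 (D h \<rho>))"
    proof (rule integrable_const_bound[where B = 2])
      show "AE h in M. norm (schatten_norm 1 (D h \<rho>)) \<le> 2"
      proof (rule AE_I2)
        fix h assume h: "h \<in> space M"
        obtain W where "contraction_mat n W" "hs_inner n W (D h \<rho>) = of_real (schatten_norm 1 (D h \<rho>))"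
          using schatten_1_attained[OF Dc] by blast
        then show "norm (schatten_norm 1 (D h \<rho>)) \<le> 2" using le2[OF h, of W] by simp
      qed
      show "(\<lambda>h. schatten_norm 1 (D h \<rho>)) \<in> borel_measurable M"
        by (rule borel_measurable_schatten_norm_1[of _ _ n]) (auto simp: Dm)
    qed
    moreover have int2: "integrable M (\<lambda>h. hs_inner n (w h) (D h \<rho>))"
    proof (rule integrable_const_bound[where B = 2])
      show "AE h in M. cmod (hs_inner n (w h) (D h \<rho>)) \<le> 2" by (rule AE_I2) (rule le2[OF _ w(1)])
      show "(\<lambda>h. hs_inner n (w h) (D h \<rho>)) \<in> borel_measurable M"
        unfolding hs_inner_def
        by (intro borel_measurable_sum borel_measurable_times Dm
            borel_measurable_continuous_onI[THEN measurable_compose[rotated], of cnj] continuous_intros w(2)) auto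
    qed
    moreover have "(\<integral>h. schatten_norm 1 (D h \<rho>) \<partial>M) \<le> (\<integral>h. Re (hs_inner n (w h) (D h \<rho>)) + e \<partial>M)"
      using int1 int2 w(3) by (intro integral_mono) (auto simp: less_imp_le algebra_simps)
    moreover have "(\<integral>h. Re (hs_inner n (w h) (D h \<rho>)) + e \<partial>M) = Re (\<integral>h. hs_inner n (w h) (D h \<rho>) \<partial>M) + e"
      using int2 by (simp add: prob_space)
    ultimately show ?thesis
      using complex_Re_le_cmod[of "\<integral>h. hs_inner n (w h) (D h \<rho>) \<partial>M"] by linarith
  qed
  have "(\<integral>h. schatten_norm 1 (D h \<rho>) \<partial>M) \<le> bound"
    by (rule field_le_epsilon) (rule main)
  also have "bound = 2 powr (2 / \<alpha> - 1) * 2 powr ((\<alpha> - 1) / \<alpha> * (log 2 (real dC) - sandwiched_entropy dA \<alpha> \<rho> \<sigma> + 2 * log 2 lam))"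
  proof -
    \<comment> \<open>All factors are written as powers of 2, so that only an identity between
      exponents, affine in \<open>c\<close>, \<open>L\<close> and \<open>T\<close>, remains.\<close>
    define c L T where "c = log 2 (real dC)" and "L = log 2 lam" and "T = log 2 tau"
    have e: "real dC = 2 powr c" "lam = 2 powr L" "tau = 2 powr T"
      using dC lam tau by (auto simp: c_def L_def T_def)
    have q: "sqrt (2 powr r) = 2 powr (r / 2)" for r :: real
      by (simp add: powr_half_sqrt[symmetric] powr_powr)
    have "bound = 2 powr ((1 + T) * (1 - t) + (c / 2 + (L + T / 2)) * t)"
    proof -
      have "2 * 2 powr T = 2 powr (1 + T)" "2 powr (c / 2) * (2 powr L * 2 powr (T / 2)) = 2 powr (c / 2 + (L + T / 2))"
        by (simp_all add: powr_add)
      then show ?thesis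
        unfolding bound_def e q by (simp only: powr_powr powr_add[of 2 "(1 + T) * (1 - t)"])
    qed
    also have "(1 + T) * (1 - t) + (c / 2 + (L + T / 2)) * t
       = (2 / \<alpha> - 1) + (\<alpha> - 1) / \<alpha> * (c - 1 / (1 - \<alpha>) * T + 2 * L)"
    proof -
      \<comment> \<open>Naming the reciprocals leaves \<open>(1 - r) * u = - r\<close> as the only
        relation that is not linear; it cancels the factor \<open>1 / (1 - \<alpha>)\<close> of the
        entropy.\<close>
      define r u where "r = 1 / \<alpha>" and "u = 1 / (1 - \<alpha>)"
      have eqs: "(\<alpha> - 1) / \<alpha> = 1 - r" "2 / \<alpha> = 2 * r" "t = 2 - 2 * r" and ru: "(1 - r) * u = - r"
        using \<alpha> by (auto simp: t_def r_def u_def divide_simps)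
      have "(1 - r) * (c - u * T + 2 * L) = (1 - r) * c - ((1 - r) * u) * T + 2 * (1 - r) * L"
        by (simp add: algebra_simps)
      then show ?thesis unfolding eqs u_def[symmetric] ru by (simp add: algebra_simps)
    qed
    finally show ?thesis by (simp add: H powr_add c_def L_def T_def)
  qed
  finally show ?thesis by (simp add: D_def)
qed

section \<open>Hash families and nonpositive parameters\<close>

lemma channel_family_hash:
  assumes "hash_family dA dC N f"
  shows "channel_family dA dC N (\<lambda>h. hash_channel dA dC (f h))"
  unfolding channel_family_def
proof (intro conjI ballI allI impI)
  show "prob_space N" using assms by (simp add: hash_family_def)
  show "channel dA dC (hash_channel dA dC (f h))" if "h \<in> space N" for h
    using assms that by (intro channel_hash) (auto simp: hash_family_def)
  fix X :: "complex mat" and i j assume ij: "i < dC" "j < dC"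
  have [measurable]: "(\<lambda>h. f h x) \<in> measurable N (count_space UNIV)" if "x < dA" for x
    using assms that by (simp add: hash_family_def)
  have "(\<lambda>h. if i = f h x \<and> j = f h x then X $$ (x, x) else 0) \<in> borel_measurable N" if "x < dA" for x
    using measurable_compose[of "\<lambda>h. f h x" N "count_space UNIV" "\<lambda>y. if i = y \<and> j = y then X $$ (x, x) else 0" borel] that
    by simp
  then have "(\<lambda>h. \<Sum>x<dA. if i = f h x \<and> j = f h x then X $$ (x, x) else 0) \<in> borel_measurable N"
    by (intro borel_measurable_sum) auto
  moreover have "hash_channel dA dC (f h) X $$ (i, j) = (\<Sum>x<dA. if i = f h x \<and> j = f h x then X $$ (x, x) else 0)" for h
    using ij by (auto simp: hash_channel_def mat_sum_def ket_proj_def intro!: sum.cong)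
  ultimately show "(\<lambda>h. hash_channel dA dC (f h) X $$ (i, j)) \<in> borel_measurable N" by simp
qed

text \<open>A family that is randomizing for some \<open>\<lambda> \<le> 0\<close> is so for every positive \<open>\<lambda>\<close>; letting \<open>\<lambda>\<close> tend
  to \<open>0\<close> gives the bound \<open>0\<close>.\<close>

lemma decoupling_bound:
  fixes M :: "'h measure"
  assumes \<alpha>: "1 < \<alpha>" "\<alpha> \<le> 2"
    and \<rho>: "density_op (dA * dE) \<rho>" and \<sigma>: "density_op dE \<sigma>"
    and supp: "supp (dA * dE) \<rho> \<subseteq> tensor_space dA dE (supp dE \<sigma>)"
    and R: "channel_family dA dC M R"
    and rnd: "\<And>Y. Y \<in> carrier_mat (dA * dE) (dA * dE) \<Longrightarrow> (cq dA dE \<rho> \<Longrightarrow> cq dA dE Y) \<Longrightarrow>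
      (\<integral>h. schatten_norm 2 (deviation dA dC dE (R h) Y) \<partial>M) \<le> lam * schatten_norm 2 Y"
  shows "ereal (\<integral>h. schatten_norm 1 (deviation dA dC dE (R h) \<rho>) \<partial>M)
        \<le> ereal (2 powr (2 / \<alpha> - 1)) *
          eexp2 (ereal ((\<alpha> - 1) / \<alpha>) *
            (ereal (log 2 (real dC) - sandwiched_entropy dA \<alpha> \<rho> \<sigma>) + 2 * elog2 lam))"
proof (cases "lam > 0")
  case True
  have "2 * ereal (log 2 lam) = ereal (2 * log 2 lam)" by (metis numeral_eq_ereal times_ereal.simps(1))
  then show ?thesis
    using decoupling_bound_pos[OF \<alpha> \<rho> \<sigma> supp R True rnd] True by (simp add: elog2_def)
next
  case False
  define I where "I = (\<integral>h. schatten_norm 1 (deviation dA dC dE (R h) \<rho>) \<partial>M)"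
  define c where "c = (\<alpha> - 1) / \<alpha>"
  define K where "K = 2 powr (2 / \<alpha> - 1) * 2 powr (c * (log 2 (real dC) - sandwiched_entropy dA \<alpha> \<rho> \<sigma>))"
  have c: "c > 0" using \<alpha> by (simp add: c_def)
  \<comment> \<open>The parameter \<open>l\<close> is isolated as a power with exponent
    \<open>2 * c > 0\<close>, which tends to 0 with \<open>l\<close> while \<open>K\<close> stays
    fixed.\<close>
  have "I \<le> K * l powr (2 * c)" if l: "l > 0" for l
  proof -
    have "I \<le> 2 powr (2 / \<alpha> - 1) * 2 powr (c * (log 2 (real dC) - sandwiched_entropy dA \<alpha> \<rho> \<sigma> + 2 * log 2 l))"
      unfolding I_def c_def
    proof (rule decoupling_bound_pos[OF \<alpha> \<rho> \<sigma> supp R l])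
      fix Y assume Y: "Y \<in> carrier_mat (dA * dE) (dA * dE)" "cq dA dE \<rho> \<Longrightarrow> cq dA dE Y"
      have "schatten_norm 2 Y \<ge> 0" by (simp add: schatten_norm_2[OF Y(1)])
      then have "lam * schatten_norm 2 Y \<le> l * schatten_norm 2 Y"
        using False l by (intro mult_right_mono) auto
      with rnd[OF Y] show "(\<integral>h. schatten_norm 2 (deviation dA dC dE (R h) Y) \<partial>M) \<le> l * schatten_norm 2 Y"
        by simp
    qed
    also have "\<dots> = K * (2 powr (log 2 l)) powr (2 * c)"
      by (simp add: K_def powr_powr powr_add distrib_left mult_ac)
    also have "2 powr (log 2 l) = l" using l by simp
    finally show ?thesis .
  qed
  then have "eventually (\<lambda>l. I \<le> K * l powr (2 * c)) (at_right 0)"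
    by (auto simp: eventually_at_filter)
  moreover have "((\<lambda>l. K * l powr (2 * c)) \<longlongrightarrow> K * 0) (at_right 0)"
  proof -
    have "((\<lambda>l :: real. l powr (2 * c)) \<longlongrightarrow> 0) (at_right 0)"
      using c by real_asymp
    then show ?thesis by (rule tendsto_mult_left)
  qed
  ultimately have I: "I \<le> 0"
    by (intro tendsto_lowerbound[of _ _ "at_right (0::real)"]) auto
  \<comment> \<open>A finite number added to \<open>- \<infinity>\<close> leaves it unchanged, and
    the positive factor \<open>c\<close> preserves its sign, so the right-hand side of the bound is
    0.\<close>
  have inf: "ereal c * (ereal r + 2 * elog2 lam) = - \<infinity>" for r
  proof -
    have "2 * elog2 lam = - \<infinity>" using False by (simp add: elog2_def ereal_mult_eq_MInfty)
    then show ?thesis using c by (simp add: ereal_mult_eq_MInfty)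
  qed
  have "eexp2 (- \<infinity>) = 0"
    using eexp2.simps(3) by (simp only: MInfty_eq_minfinity)
  then show ?thesis
    unfolding c_def[symmetric] I_def[symmetric] inf using I by simp
qed

theorem theorem8:
  fixes dA dC dE :: nat and lam \<alpha> :: real and \<rho> \<sigma> :: "complex mat"
    and M :: "'h measure" and R :: "'h \<Rightarrow> complex mat \<Rightarrow> complex mat"
    and N :: "'k measure" and f :: "'k \<Rightarrow> nat \<Rightarrow> nat"
  assumes "1 < \<alpha>" and "\<alpha> \<le> 2"
    and "density_op (dA * dE) \<rho>" and "density_op dE \<sigma>"
    and "supp (dA * dE) \<rho> \<subseteq> tensor_space dA dE (supp dE \<sigma>)"
  shows "(channel_family dA dC M R \<and> randomizing dA dC M R lam \<longrightarrow>
      ereal (\<integral>h. schatten_norm 1 (deviation dA dC dE (R h) \<rho>) \<partial>M)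
        \<le> ereal (2 powr (2 / \<alpha> - 1)) *
          eexp2 (ereal ((\<alpha> - 1) / \<alpha>) *
            (ereal (log 2 (real dC) - sandwiched_entropy dA \<alpha> \<rho> \<sigma>) + 2 * elog2 lam)))
    \<and> (cq dA dE \<rho> \<and> hash_family dA dC N f \<and> hash_randomizing dA dC N f lam \<longrightarrow>
      ereal (\<integral>h. schatten_norm 1 (deviation dA dC dE (hash_channel dA dC (f h)) \<rho>) \<partial>N)
        \<le> ereal (2 powr (2 / \<alpha> - 1)) *
          eexp2 (ereal ((\<alpha> - 1) / \<alpha>) *
            (ereal (log 2 (real dC) - sandwiched_entropy dA \<alpha> \<rho> \<sigma>) + 2 * elog2 lam)))"
proof (intro conjI impI)
  assume "channel_family dA dC M R \<and> randomizing dA dC M R lam"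
  then show "ereal (\<integral>h. schatten_norm 1 (deviation dA dC dE (R h) \<rho>) \<partial>M)
        \<le> ereal (2 powr (2 / \<alpha> - 1)) *
          eexp2 (ereal ((\<alpha> - 1) / \<alpha>) *
            (ereal (log 2 (real dC) - sandwiched_entropy dA \<alpha> \<rho> \<sigma>) + 2 * elog2 lam))"
    by (intro decoupling_bound assms) (auto simp: randomizing_def randomizing_on_def)
next
  assume h: "cq dA dE \<rho> \<and> hash_family dA dC N f \<and> hash_randomizing dA dC N f lam"
  \<comment> \<open>Since \<rho> is CQ, only CQ operators have to be tested, and for these the hash
    property is exactly the required inequality.\<close>
  show "ereal (\<integral>h. schatten_norm 1 (deviation dA dC dE (hash_channel dA dC (f h)) \<rho>) \<partial>N)
        \<le> ereal (2 powr (2 / \<alpha> - 1)) *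
          eexp2 (ereal ((\<alpha> - 1) / \<alpha>) *
            (ereal (log 2 (real dC) - sandwiched_entropy dA \<alpha> \<rho> \<sigma>) + 2 * elog2 lam))"
    by (rule decoupling_bound[OF assms channel_family_hash])
       (use h in \<open>auto simp: hash_randomizing_def randomizing_on_def\<close>)
qed

end
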